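(* Let $E=\bigcup_{j=1}^{\ell+1}E_j\subset\mathbb{R}$ be a finite union of bounded closed disjoint intervals, let $J_0$ lie in the isospectral torus $\mathcal{T}_E$, and let $J=J_0+\delta J$ be a two-sided Jacobi matrix such that $$\sum_{n\in\mathbb{Z}}\bigl(|\delta a_n|+|\delta b_n|\bigr)<\infty .$$ Then for every $\alpha>\frac12$, $$\sum_{\lambda\in\sigma(J)\setminus E}\operatorname{dist}(\lambda,E)^{\alpha}<\infty .$$
   Context: A two-sided Jacobi matrix with parameters $\{a_n,b_n\}_{n\in\mathbb{Z}}$ ($a_n>0$, $b_n\in\mathbb{R}$, bounded) is the bounded selfadjoint operator $J$ on $\ell^2(\mathbb{Z})$ with matrix elements $J_{kk}=b_k$, $J_{k,k+1}=a_k$, $J_{k,k-1}=a_{k-1}$, and $J_{k\ell}=0$ for $|k-\ell|\ge2$. The numbers $\delta a_n,\delta b_n$ are the differences of the Jacobi parameters of $J$ and $J_0$. The intervals $E_j$ have positive length. The isospectral torus $\mathcal{T}_E$ is the set of two-sided Jacobi matrices $J_0$ with $\sigma(J_0)=E$ that are reflectionless on $E$, i.e. for every $n\in\mathbb{Z}$, $\lim_{\eta\downarrow0}\operatorname{Re}\langle\delta_n,(J_0-\lambda-i\eta)^{-1}\delta_n\rangle=0$ for Lebesgue-a.e. $\lambda\in E$; all such $J_0$ are almost periodic. *)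

theory Defs
  imports "HOL-Analysis.Analysis"
begin

text \<open>
  The Hilbert space of square-summable complex sequences on the integers is represented by its
  carrier \<open>l2\<close> inside the type of all functions; operators on it are total functions on sequences
  of which only the restriction to \<open>l2\<close> matters.
\<close>

definition l2 :: "(int \<Rightarrow> complex) set" where
  "l2 = {u. (\<lambda>n. (cmod (u n))\<^sup>2) summable_on UNIV}"

text \<open>The inner product is linear in the second argument.\<close>

definition l2_inner :: "(int \<Rightarrow> complex) \<Rightarrow> (int \<Rightarrow> complex) \<Rightarrow> complex" where
  "l2_inner u v = (\<Sum>\<^sub>\<infinity>n. cnj (u n) * v n)"

definition l2_norm :: "(int \<Rightarrow> complex) \<Rightarrow> real" where
  "l2_norm u = sqrt (\<Sum>\<^sub>\<infinity>n. (cmod (u n))\<^sup>2)"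

definition delta :: "int \<Rightarrow> int \<Rightarrow> complex" where
  "delta n = (\<lambda>k. if k = n then 1 else 0)"

definition l2_bounded_operator :: "((int \<Rightarrow> complex) \<Rightarrow> (int \<Rightarrow> complex)) \<Rightarrow> bool" where
  "l2_bounded_operator T \<longleftrightarrow>
     (\<forall>u\<in>l2. T u \<in> l2) \<and>
     (\<forall>u\<in>l2. \<forall>v\<in>l2. T (\<lambda>n. u n + v n) = (\<lambda>n. T u n + T v n)) \<and>
     (\<forall>c. \<forall>u\<in>l2. T (\<lambda>n. c * u n) = (\<lambda>n. c * T u n)) \<and>
     (\<exists>C. \<forall>u\<in>l2. l2_norm (T u) \<le> C * l2_norm u)"

definition shifted_operator ::
    "((int \<Rightarrow> complex) \<Rightarrow> (int \<Rightarrow> complex)) \<Rightarrow> complex \<Rightarrow> (int \<Rightarrow> complex) \<Rightarrow> (int \<Rightarrow> complex)" where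
  "shifted_operator T z u = (\<lambda>n. T u n - z * u n)"

definition l2_spectrum :: "((int \<Rightarrow> complex) \<Rightarrow> (int \<Rightarrow> complex)) \<Rightarrow> complex set" where
  "l2_spectrum T = {z. \<not> (\<exists>R. l2_bounded_operator R \<and>
     (\<forall>u\<in>l2. R (shifted_operator T z u) = u \<and> shifted_operator T z (R u) = u))}"

text \<open>Meaningful only for \<open>z\<close> outside the spectrum, where \<open>T - z\<close> is a bijection of \<open>l2\<close>.\<close>

definition l2_resolvent ::
    "((int \<Rightarrow> complex) \<Rightarrow> (int \<Rightarrow> complex)) \<Rightarrow> complex \<Rightarrow> (int \<Rightarrow> complex) \<Rightarrow> (int \<Rightarrow> complex)" where
  "l2_resolvent T z = inv_into l2 (shifted_operator T z)"

text \<open>A two-sided Jacobi matrix is identified with its pair of parameter sequences.\<close>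

definition jacobi_parameters :: "(int \<Rightarrow> real) \<Rightarrow> (int \<Rightarrow> real) \<Rightarrow> bool" where
  "jacobi_parameters a b \<longleftrightarrow> (\<forall>n. a n > 0) \<and> bounded (range a) \<and> bounded (range b)"

definition jacobi_matrix :: "(int \<Rightarrow> real) \<Rightarrow> (int \<Rightarrow> real) \<Rightarrow> int \<Rightarrow> int \<Rightarrow> real" where
  "jacobi_matrix a b k m =
     (if m = k then b k else if m = k + 1 then a k else if m = k - 1 then a (k - 1) else 0)"

text \<open>Each row of the matrix has at most three nonzero entries.\<close>

definition jacobi_operator ::
    "(int \<Rightarrow> real) \<Rightarrow> (int \<Rightarrow> real) \<Rightarrow> (int \<Rightarrow> complex) \<Rightarrow> (int \<Rightarrow> complex)" where
  "jacobi_operator a b u = (\<lambda>k. \<Sum>m\<in>{k-1..k+1}. of_real (jacobi_matrix a b k m) * u m)"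

definition reflectionless_on :: "(int \<Rightarrow> real) \<Rightarrow> (int \<Rightarrow> real) \<Rightarrow> real set \<Rightarrow> bool" where
  "reflectionless_on a b E \<longleftrightarrow>
     (\<forall>n. AE x in lebesgue. x \<in> E \<longrightarrow>
        ((\<lambda>y. Re (l2_inner (delta n)
                 (l2_resolvent (jacobi_operator a b) (of_real x + \<i> * of_real y) (delta n))))
          \<longlongrightarrow> 0) (at_right 0))"

definition isospectral_torus :: "real set \<Rightarrow> ((int \<Rightarrow> real) \<times> (int \<Rightarrow> real)) set" where
  "isospectral_torus E = {(a, b). jacobi_parameters a b \<and>
     l2_spectrum (jacobi_operator a b) = complex_of_real ` E \<and> reflectionless_on a b E}"

end

theory Submission
  imports Defs "HOL-Complex_Analysis.Complex_Analysis"
begin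

text \<open>
  Let \<open>G\<^sub>n(z)\<close> be the diagonal entries of the resolvent of \<open>J\<^sub>0\<close>. Since \<open>G\<^sub>n\<close> is a Herglotz function
  with vanishing real part a.e. on \<open>E\<close>, it continues analytically across the interior of every band,
  with imaginary boundary values. Multiplied by \<open>S(z) = \<Prod>\<surd>(z - e)\<close>, the product over the band edges \<open>e\<close>,
  it becomes real on the whole real line and extends by Schwarz reflection to an entire function,
  and the maximum principle on a large circle gives \<open>|G\<^sub>n(x)| \<le> C dist(x, E)\<close> to the power \<open>-1/2\<close>
  with \<open>C\<close> independent of \<open>n\<close>.

  If \<open>[x\<^sub>1, x\<^sub>2]\<close> lies in a gap, \<open>B = (J\<^sub>0 - x\<^sub>1)(J\<^sub>0 - x\<^sub>2)\<close> is positive definite, while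
  \<open>(J - x\<^sub>1)(J - x\<^sub>2)\<close> is almost negative on the span of approximate eigenvectors of \<open>J\<close> for \<open>N\<close> spectral
  points in \<open>[x\<^sub>1, x\<^sub>2]\<close>. On a \<open>B\<close>-orthonormal basis of this span the perturbation therefore
  contributes at least \<open>N/2\<close>. By Bessel's inequality it contributes at most a multiple of
  \<open>\<Sum>(|\<delta>a\<^sub>n| + |\<delta>b\<^sub>n|)\<close> times the supremum over \<open>n\<close> of the diagonal entries of the inverse of \<open>B\<close>,
  which are \<open>(G\<^sub>n(x\<^sub>2) - G\<^sub>n(x\<^sub>1)) / (x\<^sub>2 - x\<^sub>1)\<close>. So the number of spectral points at distance at least \<open>s\<close>
  from \<open>E\<close> is \<open>O(1/\<surd>s)\<close>, which is summable against \<open>s\<close> to the power \<open>\<alpha> > 1/2\<close>.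
\<close>

subsection \<open>The Hilbert space\<close>

text \<open>The exponent 1/2 has one source: at a band edge the diagonal Green functions grow at
  most like an inverse square root. This enters only through difference quotients over intervals
  whose length stays bounded below, so it becomes a count O(1/sqrt s) without loss; ordered by
  decreasing distance, the j-th spectral point is then at distance O(1/j^2). The obstacle is
  uniformity in n. The perturbation is merely summable, so the diagonal entries of the inverse of B
  need one bound for all sites. J0 need not be periodic, so a maximum over one period cannot serve;
  instead every constant of the edge estimate comes from the circle |z| = K and from the edges,
  where nothing depends on n. The a priori bound 1/|Im z| is also uniform but says nothing on the
  real axis, hence the detour through an entire function. The points of the spectrum of J outside E
  are not known beforehand to be isolated or to be eigenvalues. Therefore regular values are
  described by lower bounds for the norm of (J - z)u, spectral points by approximate eigenvectors,
  and all counting is done in finite sets of spectral points with constants independent of the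
  set.\<close>

lemma l2_summable: "u \<in> l2 \<Longrightarrow> (\<lambda>n. (cmod (u n))\<^sup>2) summable_on UNIV"
  by (simp add: l2_def)

lemma zero_in_l2: "(\<lambda>n. 0) \<in> l2"
  by (simp add: l2_def)

lemma l2_add: assumes "u \<in> l2" "v \<in> l2" shows "(\<lambda>n. u n + v n) \<in> l2"
proof -
  have "(\<lambda>n. 2 * (cmod (u n))\<^sup>2 + 2 * (cmod (v n))\<^sup>2) summable_on UNIV"
    using assms by (intro summable_on_add summable_on_cmult_right) (auto simp: l2_def)
  moreover have "(cmod (u n + v n))\<^sup>2 \<le> 2 * (cmod (u n))\<^sup>2 + 2 * (cmod (v n))\<^sup>2" for n
  proof -
    have "(cmod (u n + v n))\<^sup>2 \<le> (cmod (u n) + cmod (v n))\<^sup>2"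
      by (intro power_mono norm_triangle_ineq) auto
    also have "\<dots> \<le> 2 * (cmod (u n))\<^sup>2 + 2 * (cmod (v n))\<^sup>2"
      using sum_squares_bound[of "cmod (u n)" "cmod (v n)"] unfolding power2_sum by linarith
    finally show ?thesis .
  qed
  ultimately show ?thesis
    unfolding l2_def mem_Collect_eq by (rule summable_on_comparison_test) (rule zero_le_power2)
qed

lemma l2_mult_bounded:
  assumes "u \<in> l2" "\<And>n. cmod (c n) \<le> C" shows "(\<lambda>n. c n * u n) \<in> l2"
proof -
  have "(\<lambda>n. C\<^sup>2 * (cmod (u n))\<^sup>2) summable_on UNIV"
    using assms by (intro summable_on_cmult_right) (auto simp: l2_def)
  moreover have "(cmod (c n * u n))\<^sup>2 \<le> C\<^sup>2 * (cmod (u n))\<^sup>2" for n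
    unfolding norm_mult power_mult_distrib using assms(2)[of n]
    by (intro mult_right_mono power_mono) auto
  ultimately show ?thesis
    unfolding l2_def mem_Collect_eq by (rule summable_on_comparison_test) (rule zero_le_power2)
qed

lemma l2_cmult: "u \<in> l2 \<Longrightarrow> (\<lambda>n. c * u n) \<in> l2"
  by (rule l2_mult_bounded[where C="cmod c"]) auto

lemma bij_int_shift: "bij (\<lambda>n::int. n + k)"
  by (rule bij_betw_byWitness[where f'="\<lambda>n. n - k"]) auto

lemma l2_shift: "u \<in> l2 \<Longrightarrow> (\<lambda>n. u (n + k)) \<in> l2"
  unfolding l2_def mem_Collect_eq using summable_on_reindex_bij_betw[OF bij_int_shift, of "\<lambda>n. (cmod (u n))\<^sup>2" k]
  by blast

lemma l2_inner_abs_summable: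
  assumes "u \<in> l2" "v \<in> l2"
  shows "(\<lambda>n. cmod (u n) * cmod (v n)) summable_on UNIV"
proof (rule summable_on_comparison_test)
  show "(\<lambda>n. (cmod (u n))\<^sup>2 + (cmod (v n))\<^sup>2) summable_on UNIV"
    using assms by (intro summable_on_add) (auto simp: l2_def)
  show "cmod (u n) * cmod (v n) \<le> (cmod (u n))\<^sup>2 + (cmod (v n))\<^sup>2" for n
    using sum_squares_bound[of "cmod (u n)" "cmod (v n)"]
      mult_nonneg_nonneg[OF norm_ge_zero[of "u n"] norm_ge_zero[of "v n"]] by linarith
qed auto

lemma l2_inner_summable:
  assumes "u \<in> l2" "v \<in> l2"
  shows "(\<lambda>n. u n \<bullet> v n) summable_on UNIV"
proof -
  have "(\<lambda>n. norm (u n \<bullet> v n)) summable_on UNIV"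
    by (rule Infinite_Sum.abs_summable_on_comparison_test'[OF l2_inner_abs_summable[OF assms]])
      (simp add: Cauchy_Schwarz_ineq2)
  then show ?thesis by (rule abs_summable_summable)
qed

text \<open>The inner product type classes are real, so \<open>ell2\<close> carries the real part of
  the complex inner product. Complex scalars come back as the operators
  \<open>cscale\<close>.\<close>

typedef ell2 = l2 using zero_in_l2 by blast

setup_lifting type_definition_ell2

declare Rep_ell2 [simp]

instantiation ell2 :: real_inner
begin

lift_definition zero_ell2 :: ell2 is "\<lambda>n. 0" by (rule zero_in_l2)
lift_definition plus_ell2 :: "ell2 \<Rightarrow> ell2 \<Rightarrow> ell2" is "\<lambda>u v n. u n + v n" by (rule l2_add)
lift_definition uminus_ell2 :: "ell2 \<Rightarrow> ell2" is "\<lambda>u n. - u n"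
  using l2_cmult[of _ "-1"] by simp
lift_definition minus_ell2 :: "ell2 \<Rightarrow> ell2 \<Rightarrow> ell2" is "\<lambda>u v n. u n - v n"
  using l2_add l2_cmult[of _ "-1"] by fastforce
lift_definition scaleR_ell2 :: "real \<Rightarrow> ell2 \<Rightarrow> ell2" is "\<lambda>r u n. r *\<^sub>R u n"
  unfolding scaleR_conv_of_real by (rule l2_cmult)
lift_definition inner_ell2 :: "ell2 \<Rightarrow> ell2 \<Rightarrow> real" is "\<lambda>u v. \<Sum>\<^sub>\<infinity>n. u n \<bullet> v n" .
definition norm_ell2 :: "ell2 \<Rightarrow> real" where "norm_ell2 u = sqrt (u \<bullet> u)"
definition sgn_ell2 :: "ell2 \<Rightarrow> ell2" where "sgn_ell2 u = scaleR (inverse (norm u)) u"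
definition dist_ell2 :: "ell2 \<Rightarrow> ell2 \<Rightarrow> real" where "dist_ell2 u v = norm (u - v)"
definition uniformity_ell2 :: "(ell2 \<times> ell2) filter"
  where "uniformity_ell2 = (INF e\<in>{0<..}. principal {(x, y). dist x y < e})"
definition open_ell2 :: "ell2 set \<Rightarrow> bool"
  where "open_ell2 U \<longleftrightarrow> (\<forall>x\<in>U. \<forall>\<^sub>F (x', y) in uniformity. x' = x \<longrightarrow> y \<in> U)"

instance
proof
  fix x y z :: ell2 and r s :: real
  show "x + y + z = x + (y + z)" "x + y = y + x" "0 + x = x" "- x + x = 0" "x - y = x + - y"
    by (transfer, simp add: ac_simps)+
  show "r *\<^sub>R (x + y) = r *\<^sub>R x + r *\<^sub>R y" "(r + s) *\<^sub>R x = r *\<^sub>R x + s *\<^sub>R x"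
    "r *\<^sub>R s *\<^sub>R x = (r * s) *\<^sub>R x" "1 *\<^sub>R x = x"
    by (transfer, simp add: scaleR_add_right scaleR_add_left)+
  show "dist x y = norm (x - y)" by (rule dist_ell2_def)
  show "sgn x = scaleR (inverse (norm x)) x" by (rule sgn_ell2_def)
  show "uniformity = (INF e\<in>{0<..}. principal {(x::ell2, y). dist x y < e})"
    by (rule uniformity_ell2_def)
  show "open U = (\<forall>x\<in>U. \<forall>\<^sub>F (x', y) in uniformity. x' = x \<longrightarrow> y \<in> U)" for U :: "ell2 set"
    by (rule open_ell2_def)
  show "x \<bullet> y = y \<bullet> x" by transfer (simp add: inner_commute)
  show "(x + y) \<bullet> z = x \<bullet> z + y \<bullet> z"
    by transfer (simp add: inner_add_left infsum_add l2_inner_summable)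
  show "r *\<^sub>R x \<bullet> y = r * (x \<bullet> y)"
    by transfer (simp add: infsum_cmult_right')
  show "0 \<le> x \<bullet> x" by transfer (rule infsum_nonneg, simp)
  show "(x \<bullet> x = 0) = (x = 0)"
  proof
    assume "x \<bullet> x = 0"
    then show "x = 0"
    proof transfer
      fix u assume u: "u \<in> l2" and "(\<Sum>\<^sub>\<infinity>n. u n \<bullet> u n) = 0"
      then have "u n \<bullet> u n = 0" for n
        by (intro nonneg_infsum_le_0D[of "\<lambda>n. u n \<bullet> u n" UNIV]) (auto simp: l2_inner_summable)
      then show "u = (\<lambda>n. 0)" by auto
    qed
  qed (transfer, simp)
  show "norm x = sqrt (x \<bullet> x)" by (rule norm_ell2_def)
qed

end

lemma Rep_ell2_simps [simp]:
  "Rep_ell2 0 n = 0" "Rep_ell2 (u + v) n = Rep_ell2 u n + Rep_ell2 v n"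
  "Rep_ell2 (u - v) n = Rep_ell2 u n - Rep_ell2 v n" "Rep_ell2 (- u) n = - Rep_ell2 u n"
  "Rep_ell2 (r *\<^sub>R u) n = r *\<^sub>R Rep_ell2 u n"
  by (simp_all add: zero_ell2.rep_eq plus_ell2.rep_eq minus_ell2.rep_eq uminus_ell2.rep_eq
      scaleR_ell2.rep_eq)

lemma ell2_eqI: "(\<And>n. Rep_ell2 u n = Rep_ell2 v n) \<Longrightarrow> u = v"
  using Rep_ell2_inject by blast

lemma ell2_norm_square: "(norm u)\<^sup>2 = (\<Sum>\<^sub>\<infinity>n. (cmod (Rep_ell2 u n))\<^sup>2)"
  by (simp add: power2_norm_eq_inner inner_ell2.rep_eq)

lemma l2_norm_Rep_ell2: "l2_norm (Rep_ell2 u) = norm u"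
  unfolding l2_norm_def ell2_norm_square[symmetric] by simp

lemma ell2_sum_le_norm_square:
  assumes "finite F" shows "(\<Sum>n\<in>F. (cmod (Rep_ell2 u n))\<^sup>2) \<le> (norm u)\<^sup>2"
  unfolding ell2_norm_square using assms
  by (intro finite_sum_le_infsum) (auto intro: l2_summable)

lemma cmod_Rep_ell2_le_norm: "cmod (Rep_ell2 u n) \<le> norm u"
  using ell2_sum_le_norm_square[of "{n}" u] by (simp add: power2_le_iff_abs_le)

instance ell2 :: complete_space
proof
  fix X :: "nat \<Rightarrow> ell2"
  assume C: "Cauchy X"
  have "Cauchy (\<lambda>m. Rep_ell2 (X m) n)" for n
  proof (rule CauchyI)
    fix e :: real assume "e > 0"
    then obtain M where M: "\<forall>m\<ge>M. \<forall>k\<ge>M. norm (X m - X k) < e" using C CauchyD by blast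
    have "norm (Rep_ell2 (X m) n - Rep_ell2 (X k) n) < e" if "m \<ge> M" "k \<ge> M" for m k
      using M that cmod_Rep_ell2_le_norm[of "X m - X k" n] by fastforce
    then show "\<exists>M. \<forall>m\<ge>M. \<forall>k\<ge>M. norm (Rep_ell2 (X m) n - Rep_ell2 (X k) n) < e" by blast
  qed
  then have "\<forall>n. \<exists>l. (\<lambda>m. Rep_ell2 (X m) n) \<longlonglongrightarrow> l"
    using Cauchy_convergent convergent_def by blast
  then obtain L where L: "\<And>n. (\<lambda>m. Rep_ell2 (X m) n) \<longlonglongrightarrow> L n" by metis
  \<comment> \<open>Letting k tend to infinity for a fixed finite \<open>F\<close> gives a bound
    independent of \<open>F\<close>. It serves twice: the coordinatewise limit lies in
    \<open>l2\<close>, and the convergence holds in norm.\<close>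
  have fin: "(\<Sum>n\<in>F. (cmod (Rep_ell2 (X m) n - L n))\<^sup>2) \<le> e\<^sup>2"
    if "finite F" "\<forall>k\<ge>m. norm (X m - X k) < e" for F m and e :: real
  proof (rule tendsto_upperbound)
    show "(\<lambda>k. \<Sum>n\<in>F. (cmod (Rep_ell2 (X m) n - Rep_ell2 (X k) n))\<^sup>2) \<longlonglongrightarrow>
      (\<Sum>n\<in>F. (cmod (Rep_ell2 (X m) n - L n))\<^sup>2)"
      by (intro tendsto_intros L)
    show "\<forall>\<^sub>F k in sequentially. (\<Sum>n\<in>F. (cmod (Rep_ell2 (X m) n - Rep_ell2 (X k) n))\<^sup>2) \<le> e\<^sup>2"
    proof (rule eventually_sequentiallyI)
      fix k assume "k \<ge> m"
      then have "norm (X m - X k) \<le> e" using that by fastforce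
      then have "(norm (X m - X k))\<^sup>2 \<le> e\<^sup>2" by (intro power_mono) auto
      then show "(\<Sum>n\<in>F. (cmod (Rep_ell2 (X m) n - Rep_ell2 (X k) n))\<^sup>2) \<le> e\<^sup>2"
        using ell2_sum_le_norm_square[OF \<open>finite F\<close>, of "X m - X k"] by simp
    qed
  qed auto
  have diff: "(\<lambda>n. Rep_ell2 (X m) n - L n) \<in> l2" if "\<forall>k\<ge>m. norm (X m - X k) < e" for m and e :: real
    unfolding l2_def mem_Collect_eq
    by (rule nonneg_bdd_above_summable_on) (auto intro!: bdd_aboveI2[where M="e\<^sup>2"] fin that)
  obtain M1 where "\<forall>m\<ge>M1. \<forall>k\<ge>M1. norm (X m - X k) < 1" using C CauchyD zero_less_one by blast
  then have "(\<lambda>n. Rep_ell2 (X M1) n - L n) \<in> l2" by (intro diff[where e=1]) auto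
  then have "(\<lambda>n. Rep_ell2 (X M1) n + (-1) * (Rep_ell2 (X M1) n - L n)) \<in> l2"
    by (intro l2_add l2_cmult Rep_ell2)
  then have Ll2: "L \<in> l2" by simp
  define U where "U = Abs_ell2 L"
  have RU: "Rep_ell2 U = L" unfolding U_def using Ll2 by (rule Abs_ell2_inverse)
  have "X \<longlonglongrightarrow> U"
  proof (rule LIMSEQ_I)
    fix e :: real assume "e > 0"
    then have "e/2 > 0" by simp
    then obtain M where M: "\<forall>m\<ge>M. \<forall>k\<ge>M. norm (X m - X k) < e/2" using C CauchyD by blast
    have "norm (X m - U) < e" if "m \<ge> M" for m
    proof -
      have "\<forall>k\<ge>m. norm (X m - X k) < e/2" using M that by auto
      then have "(norm (X m - U))\<^sup>2 \<le> (e/2)\<^sup>2"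
        unfolding ell2_norm_square
        by (intro infsum_le_finite_sums) (use fin RU l2_summable[OF Rep_ell2, of "X m - U"] in auto)
      then show ?thesis using \<open>e > 0\<close> power2_le_imp_le[of "norm (X m - U)" "e/2"] by simp
    qed
    then show "\<exists>M. \<forall>m\<ge>M. norm (X m - U) < e" by blast
  qed
  then show "convergent X" by (rule convergentI)
qed

instance ell2 :: banach ..

section \<open>Complex scalars and the standard basis\<close>

lift_definition cscale :: "complex \<Rightarrow> ell2 \<Rightarrow> ell2" is "\<lambda>c u n. c * u n" by (rule l2_cmult)

lemma Rep_cscale [simp]: "Rep_ell2 (cscale c u) n = c * Rep_ell2 u n"
  by (simp add: cscale.rep_eq)

lemma norm_cscale [simp]: "norm (cscale c u) = cmod c * norm u"
proof -
  have "(norm (cscale c u))\<^sup>2 = (cmod c * norm u)\<^sup>2"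
    unfolding power_mult_distrib ell2_norm_square
    by (simp add: norm_mult power_mult_distrib infsum_cmult_right')
  then show ?thesis by (simp add: power2_eq_iff_nonneg)
qed

lemma cscale_of_real: "cscale (of_real r) u = r *\<^sub>R u"
  by (rule ell2_eqI) (simp add: scaleR_conv_of_real)

text \<open>Multiplication by \<i> is skew for the real part of a Hermitian product. That <u, Ju> is
  real will be used in the form: Ju is orthogonal to \<i>u.\<close>

lemma inner_cscale_ii: "u \<bullet> cscale \<i> v = - (cscale \<i> u \<bullet> v)"
  unfolding inner_ell2.rep_eq infsum_uminus[symmetric] by (simp add: inner_complex_def algebra_simps)

lemma inner_cscale_ii_self [simp]: "u \<bullet> cscale \<i> u = 0"
  using inner_cscale_ii[of u u] by (simp add: inner_commute)

lift_definition ket :: "int \<Rightarrow> ell2" is delta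
proof -
  fix n :: int
  have "(\<lambda>k. (cmod (delta n k))\<^sup>2) summable_on UNIV \<longleftrightarrow> (\<lambda>k. (cmod (delta n k))\<^sup>2) summable_on {n}"
    by (rule summable_on_cong_neutral) (auto simp: delta_def)
  then show "delta n \<in> l2" by (simp add: l2_def)
qed

lemma Rep_ket [simp]: "Rep_ell2 (ket n) k = (if k = n then 1 else 0)"
  by (simp add: ket.rep_eq delta_def)

lemma infsum_single: "(\<And>k. k \<noteq> n \<Longrightarrow> f k = 0) \<Longrightarrow> infsum f UNIV = f n"
  using infsum_cong_neutral[of "{n}" UNIV f f] by auto

lemma inner_ket: "ket n \<bullet> u = Re (Rep_ell2 u n)"
  unfolding inner_ell2.rep_eq by (subst infsum_single[of n]) (auto simp: inner_complex_def)

text \<open>Together with \<open>inner_ket\<close> this recovers a complex coordinate from two real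
  inner products; later arguments therefore test against both \<open>ket n\<close> and
  \<open>cscale \<i> (ket n)\<close>.\<close>

lemma inner_cscale_ket: "cscale \<i> (ket n) \<bullet> u = Im (Rep_ell2 u n)"
  unfolding inner_ell2.rep_eq by (subst infsum_single[of n]) (auto simp: inner_complex_def)

lemma norm_ket [simp]: "norm (ket n) = 1"
  by (simp add: norm_eq_sqrt_inner inner_ket)

lemma l2_inner_delta: "l2_inner (delta n) u = u n"
  unfolding l2_inner_def by (subst infsum_single[of n]) (auto simp: delta_def)

subsection \<open>Jacobi operators\<close>

lemma jacobi_operator_apply:
  "jacobi_operator a b u k =
     of_real (a (k - 1)) * u (k - 1) + of_real (b k) * u k + of_real (a k) * u (k + 1)"
proof -
  have "{k-1..k+1} = {k-1, k, k+1}" by auto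
  then show ?thesis by (simp add: jacobi_operator_def jacobi_matrix_def)
qed

lemma jacobi_parametersD:
  assumes "jacobi_parameters a b"
  obtains C where "C > 0" "\<And>n. \<bar>a n\<bar> \<le> C" "\<And>n. \<bar>b n\<bar> \<le> C"
proof -
  obtain A B where "\<And>n. \<bar>a n\<bar> \<le> A" "\<And>n. \<bar>b n\<bar> \<le> B"
    using assms unfolding jacobi_parameters_def bounded_iff by auto
  then have "\<bar>a n\<bar> \<le> max 1 (max A B)" "\<bar>b n\<bar> \<le> max 1 (max A B)" for n
    by (meson max.coboundedI1 max.coboundedI2)+
  then show ?thesis using that[of "max 1 (max A B)"] by auto
qed

text \<open>Not lifted, because the product is in \<open>l2\<close> only for suitable
  \<open>c\<close>; \<open>Abs_ell2\<close> makes it total, and \<open>Rep_bounded_mult\<close>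
  gives the coordinates for bounded \<open>c\<close>.\<close>

definition bounded_mult :: "(int \<Rightarrow> real) \<Rightarrow> ell2 \<Rightarrow> ell2" where
  "bounded_mult c u = Abs_ell2 (\<lambda>n. of_real (c n) * Rep_ell2 u n)"

lemma Rep_bounded_mult:
  assumes "bounded (range c)"
  shows "Rep_ell2 (bounded_mult c u) n = of_real (c n) * Rep_ell2 u n"
proof -
  obtain C where C: "\<And>n. \<bar>c n\<bar> \<le> C" using assms unfolding bounded_iff by auto
  have "(\<lambda>n. of_real (c n) * Rep_ell2 u n) \<in> l2"
    by (rule l2_mult_bounded[where C=C]) (use C in auto)
  then show ?thesis unfolding bounded_mult_def by (simp add: Abs_ell2_inverse)
qed

lift_definition shift :: "int \<Rightarrow> ell2 \<Rightarrow> ell2" is "\<lambda>k u n. u (n + k)" by (rule l2_shift)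

lemma Rep_shift [simp]: "Rep_ell2 (shift k u) n = Rep_ell2 u (n + k)"
  by (simp add: shift.rep_eq)

lemma norm_le_ell2I:
  assumes "\<And>n. cmod (Rep_ell2 u n) \<le> C * cmod (Rep_ell2 v n)" "C \<ge> 0"
  shows "norm u \<le> C * norm v"
proof -
  have "(norm u)\<^sup>2 \<le> (\<Sum>\<^sub>\<infinity>n. C\<^sup>2 * (cmod (Rep_ell2 v n))\<^sup>2)"
    unfolding ell2_norm_square using assms
    by (intro infsum_mono summable_on_cmult_right) 
       (auto simp: l2_summable power_mult_distrib[symmetric] intro: power_mono)
  also have "\<dots> = (C * norm v)\<^sup>2"
    by (simp add: power_mult_distrib ell2_norm_square infsum_cmult_right')
  finally show ?thesis using assms(2) by (simp add: power2_le_iff_abs_le)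
qed

lemma bounded_linear_bounded_mult:
  assumes "bounded (range c)" shows "bounded_linear (bounded_mult c)"
proof -
  obtain C where C: "\<And>n. \<bar>c n\<bar> \<le> C" using assms unfolding bounded_iff by auto
  have "C \<ge> 0" using C[of 0] by linarith
  show ?thesis
  proof (rule bounded_linear_intro[where K=C])
    show "norm (bounded_mult c u) \<le> norm u * C" for u
      using norm_le_ell2I[of "bounded_mult c u" C u] C \<open>C \<ge> 0\<close>
      by (simp add: Rep_bounded_mult[OF assms] norm_mult mult_right_mono mult.commute)
  qed (auto intro!: ell2_eqI simp: Rep_bounded_mult[OF assms] algebra_simps)
qed

lemma norm_shift [simp]: "norm (shift k u) = norm u"
proof -
  have "(norm (shift k u))\<^sup>2 = (norm u)\<^sup>2" unfolding ell2_norm_square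
    using infsum_reindex_bij_betw[OF bij_int_shift[of k], of "\<lambda>n. (cmod (Rep_ell2 u n))\<^sup>2"] by simp
  then show ?thesis by (simp add: power2_eq_iff_nonneg)
qed

lemma bounded_linear_shift: "bounded_linear (shift k)"
  by (rule bounded_linear_intro[where K=1]) (auto intro!: ell2_eqI)

lemma inner_shift: "shift k u \<bullet> v = u \<bullet> shift (- k) v"
  unfolding inner_ell2.rep_eq
  using infsum_reindex_bij_betw[OF bij_int_shift[of k], of "\<lambda>n. Rep_ell2 u n \<bullet> Rep_ell2 v (n - k)"]
  by simp

lemma inner_bounded_mult:
  "bounded (range c) \<Longrightarrow> bounded_mult c u \<bullet> v = u \<bullet> bounded_mult c v"
  unfolding inner_ell2.rep_eq by (simp add: Rep_bounded_mult inner_complex_def algebra_simps)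

text \<open>Composed of shifts and multiplications so that boundedness and symmetry are inherited:
  the diagonal term is symmetric and the two off-diagonal terms are adjoint to each other.\<close>

definition jop :: "(int \<Rightarrow> real) \<Rightarrow> (int \<Rightarrow> real) \<Rightarrow> ell2 \<Rightarrow> ell2" where
  "jop a b u = shift (-1) (bounded_mult a u) + bounded_mult b u + bounded_mult a (shift 1 u)"

context
  fixes a b assumes jp: "jacobi_parameters a b"
begin

lemma bounded_params: "bounded (range a)" "bounded (range b)"
  using jp by (auto simp: jacobi_parameters_def)

lemma Rep_jop: "Rep_ell2 (jop a b u) = jacobi_operator a b (Rep_ell2 u)"
  by (rule ext) (simp add: jop_def jacobi_operator_apply Rep_bounded_mult bounded_params)

lemma bounded_linear_jop: "bounded_linear (jop a b)"
  unfolding jop_def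
  by (intro bounded_linear_add bounded_linear_compose[OF bounded_linear_shift]
      bounded_linear_compose[OF bounded_linear_bounded_mult] bounded_linear_shift
      bounded_linear_bounded_mult bounded_params)

lemma jop_symmetric: "jop a b u \<bullet> v = u \<bullet> jop a b v"
  unfolding jop_def by (simp add: inner_add_left inner_add_right inner_shift inner_bounded_mult bounded_params)

lemma jop_cscale: "jop a b (cscale c u) = cscale c (jop a b u)"
  by (rule ell2_eqI) (simp add: Rep_jop jacobi_operator_apply algebra_simps)

end

subsection \<open>Spectrum and resolvent\<close>

text \<open>The Lax-Milgram argument: solutions of Tu = v are the fixed points of u - t(Tu - v), and
  expanding the squared norm shows that this map contracts squared distances by 1 - 2tc + t^2
  K^2.\<close>

lemma coercive_surj:
  fixes T :: "'a::{real_inner,complete_space} \<Rightarrow> 'a"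
  assumes T: "bounded_linear T" and c: "c > 0" and coer: "\<And>u. c * (norm u)\<^sup>2 \<le> u \<bullet> T u"
  shows "surj T"
proof -
  obtain K0 where K0: "\<And>u. norm (T u) \<le> norm u * K0"
    using bounded_linear.nonneg_bounded[OF T] by blast
  define K where "K = max c K0"
  have K: "norm (T u) \<le> K * norm u" for u
    using order_trans[OF K0[of u] mult_left_mono[of K0 K "norm u"]] by (simp add: K_def mult.commute)
  have Kpos: "K > 0" "c \<le> K" using c by (auto simp: K_def)
  \<comment> \<open>This \<open>t\<close> minimizes 1 - 2tc + t^2 K^2, and the minimum is
    \<open>q\<close>. Having chosen \<open>K\<close> at least \<open>c\<close> keeps
    \<open>q\<close> nonnegative.\<close>
  define t where "t = c / K\<^sup>2"
  define q where "q = 1 - c\<^sup>2 / K\<^sup>2"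
  have q: "0 \<le> q" "q < 1"
    using Kpos c by (auto simp: q_def power_mono divide_le_eq)
  have "\<exists>u. T u = v" for v
  proof -
    define f where "f u = u - t *\<^sub>R (T u - v)" for u
    have contr: "dist (f u) (f w) \<le> sqrt q * dist u w" for u w
    proof -
      define d where "d = u - w"
      have Td: "T u - T w = T d" unfolding d_def using linear_diff[OF bounded_linear.linear[OF T]] by metis
      have "f u - f w = d - t *\<^sub>R T d"
        unfolding f_def Td[symmetric] unfolding d_def by (simp add: algebra_simps)
      then have "(norm (f u - f w))\<^sup>2 = (norm d)\<^sup>2 - 2 * t * (d \<bullet> T d) + t\<^sup>2 * (norm (T d))\<^sup>2"
        unfolding power2_norm_eq_inner by (simp add: inner_diff_left inner_diff_right inner_commute power2_eq_square)
      also have "\<dots> \<le> (norm d)\<^sup>2 - 2 * t * (c * (norm d)\<^sup>2) + t\<^sup>2 * (K * norm d)\<^sup>2"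
      proof -
        have "t \<ge> 0" using c by (simp add: t_def)
        then have "2 * t * (c * (norm d)\<^sup>2) \<le> 2 * t * (d \<bullet> T d)"
          using coer[of d] by (intro mult_left_mono) auto
        moreover have "t\<^sup>2 * (norm (T d))\<^sup>2 \<le> t\<^sup>2 * (K * norm d)\<^sup>2"
          using K[of d] by (intro mult_left_mono power_mono) auto
        ultimately show ?thesis by linarith
      qed
      also have "\<dots> = q * (norm d)\<^sup>2"
        using Kpos by (simp add: t_def q_def power_mult_distrib field_simps power2_eq_square)
      finally have "norm (f u - f w) \<le> sqrt (q * (norm d)\<^sup>2)" by (rule real_le_rsqrt)
      then show ?thesis by (simp add: dist_norm d_def real_sqrt_mult)
    qed
    have "\<exists>!u. f u = u"
      using contr q by (intro banach_fix_type[where c="sqrt q"]) auto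
    then obtain u where "f u = u" by blast
    then have "t *\<^sub>R (T u - v) = 0" by (simp add: f_def)
    moreover have "t \<noteq> 0" using c Kpos by (simp add: t_def)
    ultimately show ?thesis by auto
  qed
  then show ?thesis by (metis surjI)
qed

lemma inner_cscale: "u \<bullet> cscale z v = cscale (cnj z) u \<bullet> v"
  unfolding inner_ell2.rep_eq by (simp add: inner_complex_def algebra_simps)

lemma inner_cscale_self: "cscale c u \<bullet> u = Re c * (norm u)\<^sup>2"
proof -
  have "cscale c u \<bullet> u = (\<Sum>\<^sub>\<infinity>n. Re c * (cmod (Rep_ell2 u n))\<^sup>2)"
    unfolding inner_ell2.rep_eq
    unfolding cmod_power2
    by (rule infsum_cong) (simp add: inner_complex_def power2_eq_square algebra_simps)
  then show ?thesis by (simp add: infsum_cmult_right' ell2_norm_square)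
qed

lemma cscale_add: "cscale z (u + v) = cscale z u + cscale z v"
  and cscale_diff: "cscale z (u - v) = cscale z u - cscale z v"
  and cscale_diff_left: "cscale (z - w) u = cscale z u - cscale w u"
  and cscale_cscale: "cscale z (cscale w u) = cscale (z * w) u"
  and cscale_scaleR: "cscale z (r *\<^sub>R u) = r *\<^sub>R cscale z u"
  by (rule ell2_eqI, simp add: algebra_simps)+

lemma bounded_linear_cscale: "bounded_linear (cscale z)"
  by (rule bounded_linear_intro[where K="cmod z"]) (auto simp: cscale_add cscale_scaleR mult.commute)

definition jsh :: "(int \<Rightarrow> real) \<Rightarrow> (int \<Rightarrow> real) \<Rightarrow> complex \<Rightarrow> ell2 \<Rightarrow> ell2" where
  "jsh a b z u = jop a b u - cscale z u"

text \<open>Total because \<open>inv\<close> is; it is the resolvent only at regular values, where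
  \<open>jsh a b z\<close> is a bijection.\<close>

definition rsv :: "(int \<Rightarrow> real) \<Rightarrow> (int \<Rightarrow> real) \<Rightarrow> complex \<Rightarrow> ell2 \<Rightarrow> ell2" where
  "rsv a b z = inv (jsh a b z)"

definition green :: "(int \<Rightarrow> real) \<Rightarrow> (int \<Rightarrow> real) \<Rightarrow> int \<Rightarrow> complex \<Rightarrow> complex" where
  "green a b n z = Rep_ell2 (rsv a b z (ket n)) n"

context
  fixes a b assumes jp: "jacobi_parameters a b"
begin

lemma bounded_linear_jsh: "bounded_linear (jsh a b z)"
  unfolding jsh_def
  by (intro bounded_linear_sub bounded_linear_jop[OF jp] bounded_linear_cscale)

lemma jsh_diff: "jsh a b z (u - v) = jsh a b z u - jsh a b z v"
  using linear_diff[OF bounded_linear.linear[OF bounded_linear_jsh]] by metis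

lemma jsh_add: "jsh a b z (u + v) = jsh a b z u + jsh a b z v"
  using linear_add[OF bounded_linear.linear[OF bounded_linear_jsh]] by metis

lemma jsh_scaleR: "jsh a b z (r *\<^sub>R u) = r *\<^sub>R jsh a b z u"
  using linear_scale[OF bounded_linear.linear[OF bounded_linear_jsh]] by metis

lemma jsh_cscale: "jsh a b z (cscale c u) = cscale c (jsh a b z u)"
  by (simp add: jsh_def jop_cscale[OF jp] cscale_diff cscale_cscale mult.commute)

lemma jsh_shift: "jsh a b z u = jsh a b w u + cscale (w - z) u"
  by (simp add: jsh_def cscale_diff_left)

lemma jsh_adjoint: "jsh a b z u \<bullet> v = u \<bullet> jsh a b (cnj z) v"
  by (simp add: jsh_def inner_diff_left inner_diff_right jop_symmetric[OF jp] inner_cscale)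

lemma Rep_jsh: "Rep_ell2 (jsh a b z u) = shifted_operator (jacobi_operator a b) z (Rep_ell2 u)"
  by (rule ext) (simp add: jsh_def shifted_operator_def Rep_jop[OF jp])

text \<open>J - z is J - Re z minus \<i> Im z, and the cross term vanishes because Ju is orthogonal
  to \<i>u. Consequently J - z and its adjoint have equal norms on each vector, that is, J - z is
  normal.\<close>

lemma norm_jsh_square:
  "(norm (jsh a b z u))\<^sup>2 = (norm (jsh a b (of_real (Re z)) u))\<^sup>2 + (Im z)\<^sup>2 * (norm u)\<^sup>2"
proof -
  define p where "p = jsh a b (of_real (Re z)) u"
  have e: "jsh a b z u = p - Im z *\<^sub>R cscale \<i> u"
    unfolding p_def jsh_def
    by (rule ell2_eqI) (simp add: complex_eq_iff algebra_simps)
  have "jop a b u \<bullet> cscale \<i> u = - (cscale \<i> (jop a b u) \<bullet> u)"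
    by (rule inner_cscale_ii)
  also have "\<dots> = - (jop a b u \<bullet> cscale \<i> u)"
    using jop_symmetric[OF jp, of "cscale \<i> u" u] by (simp add: jop_cscale[OF jp] inner_commute[of "cscale \<i> u" "jop a b u"])
  finally have "jop a b u \<bullet> cscale \<i> u = 0" by simp
  then have "p \<bullet> (Im z *\<^sub>R cscale \<i> u) = 0"
    by (simp add: p_def jsh_def inner_diff_left cscale_of_real)
  moreover have "(norm (p - q))\<^sup>2 = (norm p)\<^sup>2 + (norm q)\<^sup>2" if "p \<bullet> q = 0" for q
    unfolding power2_norm_eq_inner using that
    by (simp add: inner_diff_left inner_diff_right inner_commute[of q p])
  ultimately have "(norm (p - Im z *\<^sub>R cscale \<i> u))\<^sup>2 = (norm p)\<^sup>2 + (norm (Im z *\<^sub>R cscale \<i> u))\<^sup>2"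
    by blast
  then show ?thesis by (simp add: e power_mult_distrib flip: p_def)
qed

lemma norm_jsh_cnj: "norm (jsh a b (cnj z) u) = norm (jsh a b z u)"
proof -
  have "(norm (jsh a b (cnj z) u))\<^sup>2 = (norm (jsh a b z u))\<^sup>2"
    unfolding norm_jsh_square[of z] norm_jsh_square[of "cnj z"] by simp
  then show ?thesis by (simp add: power2_eq_iff_nonneg)
qed

lemma Im_le_norm_jsh: "\<bar>Im z\<bar> * norm u \<le> norm (jsh a b z u)"
proof -
  have "(\<bar>Im z\<bar> * norm u)\<^sup>2 \<le> (norm (jsh a b z u))\<^sup>2"
    unfolding norm_jsh_square[of z] by (simp add: power_mult_distrib)
  then show ?thesis by (rule power2_le_imp_le) simp
qed

text \<open>For a normal operator a lower bound already decides invertibility, so this is the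
  resolvent set (\<open>not_in_spectrum_iff\<close>) in a form that can be tested on
  vectors.\<close>

definition regular_value :: "complex \<Rightarrow> bool" where
  "regular_value z \<longleftrightarrow> (\<exists>c>0. \<forall>u. c * norm u \<le> norm (jsh a b z u))"

lemma regular_value_cnj: "regular_value (cnj z) \<longleftrightarrow> regular_value z"
  by (simp add: regular_value_def norm_jsh_cnj)

text \<open>The quadratic form of (J - cnj z)(J - z) is the squared norm of (J - z)u, hence
  coercive. The product is therefore onto, and so is its outer factor.\<close>

lemma regular_value_surj: assumes "regular_value z" shows "surj (jsh a b (cnj z))"
proof -
  obtain c where c: "c > 0" "\<And>u. c * norm u \<le> norm (jsh a b z u)"
    using assms regular_value_def by blast
  have "surj (\<lambda>u. jsh a b (cnj z) (jsh a b z u))"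
  proof (rule coercive_surj)
    show "bounded_linear (\<lambda>u. jsh a b (cnj z) (jsh a b z u))"
      by (intro bounded_linear_compose[OF bounded_linear_jsh] bounded_linear_jsh)
    show "c\<^sup>2 > 0" using c by simp
    show "c\<^sup>2 * (norm u)\<^sup>2 \<le> u \<bullet> jsh a b (cnj z) (jsh a b z u)" for u
      using power_mono[OF c(2)[of u], of 2] c(1)
      by (simp add: jsh_adjoint[symmetric] power2_norm_eq_inner[symmetric] power_mult_distrib)
  qed
  then show ?thesis by (auto simp: surj_def)
qed

lemma regular_value_bij: assumes "regular_value z" shows "bij (jsh a b z)"
proof (rule bijI)
  show "surj (jsh a b z)"
    using regular_value_surj[of "cnj z"] assms by (simp add: regular_value_cnj)
  obtain c where c: "c > 0" "\<And>u. c * norm u \<le> norm (jsh a b z u)"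
    using assms regular_value_def by blast
  show "inj (jsh a b z)"
  proof (rule injI)
    fix u v assume "jsh a b z u = jsh a b z v"
    then have "jsh a b z (u - v) = 0" by (simp add: jsh_diff)
    then have "c * norm (u - v) \<le> 0" using c(2)[of "u - v"] by simp
    then show "u = v" using c(1) by (simp add: mult_le_0_iff)
  qed
qed

lemma jsh_rsv: "regular_value z \<Longrightarrow> jsh a b z (rsv a b z v) = v"
  unfolding rsv_def using regular_value_bij bij_is_surj surj_f_inv_f by metis

lemma rsv_jsh: "regular_value z \<Longrightarrow> rsv a b z (jsh a b z v) = v"
  unfolding rsv_def using regular_value_bij bij_is_inj inv_f_f by metis

lemma rsv_eqI: "regular_value z \<Longrightarrow> jsh a b z u = v \<Longrightarrow> rsv a b z v = u"
  using rsv_jsh by blast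

lemma rsv_add: "regular_value z \<Longrightarrow> rsv a b z (u + v) = rsv a b z u + rsv a b z v"
  by (rule rsv_eqI) (auto simp: jsh_add jsh_rsv)

lemma rsv_cscale: "regular_value z \<Longrightarrow> rsv a b z (cscale c u) = cscale c (rsv a b z u)"
  by (rule rsv_eqI) (auto simp: jsh_cscale jsh_rsv)

lemma not_in_spectrum_iff: "z \<notin> l2_spectrum (jacobi_operator a b) \<longleftrightarrow> regular_value z"
proof
  assume "z \<notin> l2_spectrum (jacobi_operator a b)"
  then obtain R where R: "l2_bounded_operator R"
    "\<And>u. u \<in> l2 \<Longrightarrow> R (shifted_operator (jacobi_operator a b) z u) = u"
    unfolding l2_spectrum_def by blast
  then obtain C where C: "\<And>u. u \<in> l2 \<Longrightarrow> l2_norm (R u) \<le> C * l2_norm u"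
    unfolding l2_bounded_operator_def by blast
  \<comment> \<open>The bound \<open>C\<close> supplied by \<open>l2_bounded_operator\<close> need
    not be positive; \<open>D\<close> can be inverted.\<close>
  define D where "D = max 1 C"
  have "inverse D * norm u \<le> norm (jsh a b z u)" for u
  proof -
    have "norm u = l2_norm (R (Rep_ell2 (jsh a b z u)))"
      by (simp add: Rep_jsh R l2_norm_Rep_ell2)
    also have "\<dots> \<le> C * norm (jsh a b z u)"
      using C[of "Rep_ell2 (jsh a b z u)"] by (simp add: l2_norm_Rep_ell2)
    also have "\<dots> \<le> D * norm (jsh a b z u)"
      by (intro mult_right_mono) (auto simp: D_def)
    finally show ?thesis by (simp add: D_def divide_simps mult.commute)
  qed
  moreover have "inverse D > 0" by (simp add: D_def)
  ultimately show "regular_value z" unfolding regular_value_def by blast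
next
  assume bb: "regular_value z"
  then obtain c where c: "c > 0" "\<And>u. c * norm u \<le> norm (jsh a b z u)"
    using regular_value_def by blast
  define R where "R v = Rep_ell2 (rsv a b z (Abs_ell2 v))" for v
  have Abs: "Abs_ell2 (\<lambda>n. u n + v n) = Abs_ell2 u + Abs_ell2 v"
    "Abs_ell2 (\<lambda>n. k * u n) = cscale k (Abs_ell2 u)" if "u \<in> l2" "v \<in> l2" for u v k
    using that by (auto intro!: ell2_eqI simp: Abs_ell2_inverse l2_add l2_cmult)
  have "l2_bounded_operator R"
    unfolding l2_bounded_operator_def
  proof (intro conjI ballI allI)
    show "R u \<in> l2" for u by (simp add: R_def)
    show "R (\<lambda>n. u n + v n) = (\<lambda>n. R u n + R v n)" if "u \<in> l2" "v \<in> l2" for u v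
      by (auto simp: R_def Abs[OF that] rsv_add[OF bb])
    show "R (\<lambda>n. k * u n) = (\<lambda>n. k * R u n)" if "u \<in> l2" for u k
      by (auto simp: R_def Abs[OF that that] rsv_cscale[OF bb])
    have "l2_norm (R u) \<le> inverse c * l2_norm u" if "u \<in> l2" for u
    proof -
      have "c * norm (rsv a b z (Abs_ell2 u)) \<le> norm (Abs_ell2 u)"
        using c(2)[of "rsv a b z (Abs_ell2 u)"] by (simp add: jsh_rsv bb)
      moreover have "l2_norm u = norm (Abs_ell2 u)"
        using that l2_norm_Rep_ell2[of "Abs_ell2 u"] by (simp add: Abs_ell2_inverse)
      ultimately show ?thesis using c(1)
        by (simp add: R_def l2_norm_Rep_ell2 field_simps)
    qed
    then show "\<exists>C. \<forall>u\<in>l2. l2_norm (R u) \<le> C * l2_norm u" by blast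
  qed
  moreover have "R (shifted_operator (jacobi_operator a b) z u) = u
      \<and> shifted_operator (jacobi_operator a b) z (R u) = u" if "u \<in> l2" for u
  proof -
    define w where "w = Abs_ell2 u"
    have w: "u = Rep_ell2 w" using that by (simp add: w_def Abs_ell2_inverse)
    show ?thesis unfolding w R_def
      by (simp add: Rep_jsh[symmetric] Rep_ell2_inverse rsv_jsh jsh_rsv bb)
  qed
  ultimately show "z \<notin> l2_spectrum (jacobi_operator a b)"
    unfolding l2_spectrum_def by blast
qed

lemma l2_resolvent_Rep:
  assumes "regular_value z"
  shows "l2_resolvent (jacobi_operator a b) z (Rep_ell2 v) = Rep_ell2 (rsv a b z v)"
  unfolding l2_resolvent_def
proof (rule inv_into_f_eq)
  show "inj_on (shifted_operator (jacobi_operator a b) z) l2"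
  proof (rule inj_onI)
    fix u w assume "u \<in> l2" "w \<in> l2"
      and eq: "shifted_operator (jacobi_operator a b) z u = shifted_operator (jacobi_operator a b) z w"
    then have uw: "Rep_ell2 (Abs_ell2 u) = u" "Rep_ell2 (Abs_ell2 w) = w"
      by (simp_all add: Abs_ell2_inverse)
    have "jsh a b z (Abs_ell2 u) = jsh a b z (Abs_ell2 w)"
      by (rule ell2_eqI) (simp add: Rep_jsh uw eq)
    then have "Abs_ell2 u = Abs_ell2 w" using rsv_jsh[OF assms] by metis
    then show "u = w" using uw by metis
  qed
qed (auto simp: Rep_jsh[symmetric] jsh_rsv assms)

lemma l2_inner_resolvent:
  assumes "regular_value z"
  shows "l2_inner (delta n) (l2_resolvent (jacobi_operator a b) z (delta n)) = green a b n z"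
  using l2_resolvent_Rep[OF assms, of "ket n"] by (simp add: l2_inner_delta green_def ket.rep_eq)

lemma regular_value_nonreal: "Im z \<noteq> 0 \<Longrightarrow> regular_value z"
  unfolding regular_value_def using Im_le_norm_jsh[of z] by (intro exI[of _ "\<bar>Im z\<bar>"]) auto

lemma spectrum_real: "z \<in> l2_spectrum (jacobi_operator a b) \<Longrightarrow> Im z = 0"
  using regular_value_nonreal not_in_spectrum_iff by blast

lemma norm_jsh_large:
  obtains K where "K > 0" "\<And>z u. (cmod z - K) * norm u \<le> norm (jsh a b z u)"
    "\<And>u. norm (jop a b u) \<le> K * norm u"
proof -
  obtain K where K: "K > 0" "\<And>u. norm (jop a b u) \<le> norm u * K"
    using bounded_linear.pos_bounded[OF bounded_linear_jop[OF jp]] by blast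
  have "(cmod z - K) * norm u \<le> norm (jsh a b z u)" for z u
    using norm_triangle_ineq2[of "cscale z u" "jop a b u"] K(2)[of u]
    by (simp add: jsh_def algebra_simps norm_minus_commute)
  with K show ?thesis by (intro that[of K]) (auto simp: mult.commute)
qed

lemma regular_value_near:
  assumes "c > 0" "\<And>u. c * norm u \<le> norm (jsh a b z u)" "cmod (w - z) \<le> c / 2"
  shows "(c / 2) * norm u \<le> norm (jsh a b w u)"
proof -
  have "norm (jsh a b z u) \<le> norm (jsh a b w u) + norm (cscale (w - z) u)"
    unfolding jsh_shift[of z u w] by (rule norm_triangle_ineq)
  moreover have "cmod (w - z) * norm u \<le> (c / 2) * norm u"
    using assms(3) by (intro mult_right_mono) auto
  ultimately show ?thesis using assms(2)[of u] by simp
qed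

lemma rsv_bound:
  assumes "regular_value z" "c > 0" "\<And>u. c * norm u \<le> norm (jsh a b z u)"
  shows "norm (rsv a b z v) \<le> norm v / c"
  using assms(3)[of "rsv a b z v"] assms(1,2) by (simp add: jsh_rsv field_simps)

lemma resolvent_identity:
  assumes "regular_value z" "regular_value w"
  shows "rsv a b z v - rsv a b w v = cscale (z - w) (rsv a b z (rsv a b w v))"
proof -
  have "jsh a b z (rsv a b w v) = v + cscale (w - z) (rsv a b w v)"
    using jsh_shift[of z "rsv a b w v" w] by (simp add: jsh_rsv assms)
  then have "rsv a b z v = rsv a b w v + cscale (z - w) (rsv a b z (rsv a b w v))"
    by (intro rsv_eqI[OF assms(1)]) (simp add: jsh_add jsh_diff jsh_cscale jsh_rsv assms cscale_diff_left)
  then show ?thesis by simp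
qed

section \<open>Diagonal Green functions\<close>

lemma green_bound:
  assumes "c > 0" "\<And>u. c * norm u \<le> norm (jsh a b z u)"
  shows "cmod (green a b n z) \<le> 1 / c"
proof -
  have "regular_value z" using assms regular_value_def by blast
  then have "norm (rsv a b z (ket n)) \<le> 1 / c"
    using rsv_bound[of z c "ket n"] assms by simp
  then show ?thesis unfolding green_def using cmod_Rep_ell2_le_norm order_trans by blast
qed

lemma green_bound_Im: "Im z \<noteq> 0 \<Longrightarrow> cmod (green a b n z) \<le> 1 / \<bar>Im z\<bar>"
  by (rule green_bound) (auto simp: Im_le_norm_jsh)

text \<open>Applying the resolvent identity twice writes the difference quotient minus the claimed
  derivative as w - z times an entry of a product of three resolvents, and these stay bounded for w
  near z.\<close>

lemma green_has_derivative:
  assumes bb: "regular_value z"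
  shows "(green a b n has_field_derivative Rep_ell2 (rsv a b z (rsv a b z (ket n))) n) (at z)"
proof -
  obtain c where c: "c > 0" "\<And>u. c * norm u \<le> norm (jsh a b z u)"
    using assms regular_value_def by blast
  define D where "D = Rep_ell2 (rsv a b z (rsv a b z (ket n))) n"
  define B where "B = (2 / c) * norm (rsv a b z (rsv a b z (ket n)))"
  have ev: "\<forall>\<^sub>F w in at z. cmod ((green a b n w - green a b n z) / (w - z) - D) \<le> B * cmod (w - z)"
    unfolding eventually_at
  proof (intro exI[of _ "c/2"] conjI ballI impI)
    fix w assume w: "w \<noteq> z \<and> dist w z < c / 2"
    then have lb: "(c / 2) * norm u \<le> norm (jsh a b w u)" for u
      by (intro regular_value_near[OF c]) (auto simp: dist_norm)
    then have bbw: "regular_value w" unfolding regular_value_def using c(1) by (intro exI[of _ "c/2"]) auto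
    have 1: "rsv a b w (ket n) - rsv a b z (ket n) = cscale (w - z) (rsv a b w (rsv a b z (ket n)))"
      by (rule resolvent_identity[OF bbw bb])
    have 2: "rsv a b w (rsv a b z (ket n)) - rsv a b z (rsv a b z (ket n)) =
        cscale (w - z) (rsv a b w (rsv a b z (rsv a b z (ket n))))"
      by (rule resolvent_identity[OF bbw bb])
    have "(green a b n w - green a b n z) / (w - z) = Rep_ell2 (rsv a b w (rsv a b z (ket n))) n"
      using arg_cong[OF 1, of "\<lambda>u. Rep_ell2 u n"] w by (simp add: green_def)
    then have "(green a b n w - green a b n z) / (w - z) - D =
        (w - z) * Rep_ell2 (rsv a b w (rsv a b z (rsv a b z (ket n)))) n"
      using arg_cong[OF 2, of "\<lambda>u. Rep_ell2 u n"] by (simp add: D_def)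
    moreover have "cmod (Rep_ell2 (rsv a b w (rsv a b z (rsv a b z (ket n)))) n) \<le> B"
      using order_trans[OF cmod_Rep_ell2_le_norm
        rsv_bound[OF bbw _ lb, of "rsv a b z (rsv a b z (ket n))"]] c(1) by (simp add: B_def field_simps)
    ultimately show "cmod ((green a b n w - green a b n z) / (w - z) - D) \<le> B * cmod (w - z)"
      by (simp add: norm_mult) (metis mult.commute mult_left_mono norm_ge_zero)
  qed (use c in auto)
  have "((\<lambda>w. B * cmod (w - z)) \<longlongrightarrow> B * cmod (z - z)) (at z)" by (intro tendsto_intros)
  then have lim: "((\<lambda>w. B * cmod (w - z)) \<longlongrightarrow> 0) (at z)" by simp
  have "((\<lambda>w. (green a b n w - green a b n z) / (w - z) - D) \<longlongrightarrow> 0) (at z)"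
    by (rule Lim_null_comparison[OF ev lim])
  then show ?thesis
    unfolding has_field_derivative_iff D_def[symmetric] by (rule LIM_zero_cancel)
qed

lemma green_holomorphic:
  "green a b n holomorphic_on - l2_spectrum (jacobi_operator a b)"
proof (rule holomorphic_onI)
  fix z assume "z \<in> - l2_spectrum (jacobi_operator a b)"
  then have "regular_value z" by (simp add: not_in_spectrum_iff[symmetric])
  then have "green a b n field_differentiable at z"
    using green_has_derivative field_differentiable_def by blast
  then show "green a b n field_differentiable at z within - l2_spectrum (jacobi_operator a b)"
    by (rule field_differentiable_at_within)
qed

lemma green_cnj:
  assumes bb: "regular_value z" shows "green a b n (cnj z) = cnj (green a b n z)"
proof -
  have bb': "regular_value (cnj z)" using bb by (simp add: regular_value_cnj)
  define u where "u = rsv a b z (ket n)"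
  define w where "w = rsv a b (cnj z) (ket n)"
  have u: "jsh a b z u = ket n" and w: "jsh a b (cnj z) w = ket n"
    by (auto simp: u_def w_def jsh_rsv bb bb')
  have "ket n \<bullet> w = u \<bullet> ket n" using jsh_adjoint[of z u w] by (simp add: u w)
  moreover have "cscale \<i> (ket n) \<bullet> w = cscale \<i> u \<bullet> ket n"
    using jsh_adjoint[of z "cscale \<i> u" w] by (simp add: u w jsh_cscale)
  moreover have "cscale \<i> u \<bullet> ket n = - (cscale \<i> (ket n) \<bullet> u)"
    using inner_cscale_ii[of u "ket n"] by (simp add: inner_commute)
  ultimately show ?thesis
    unfolding green_def u_def[symmetric] w_def[symmetric] complex_eq_iff
    by (simp add: inner_ket inner_cscale_ket inner_commute[of u "ket n"] inner_commute[of u "cscale \<i> (ket n)"])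
qed

text \<open>Pair \<i> times \<open>ket n\<close> = Ju - zu with u: the term \<i>Ju contributes
  nothing by symmetry, and only Im z survives. For Im z > 0 this is the Herglotz property.\<close>

lemma Im_green:
  assumes bb: "regular_value z"
  shows "Im (green a b n z) = Im z * (norm (rsv a b z (ket n)))\<^sup>2"
proof -
  define u where "u = rsv a b z (ket n)"
  have u: "jsh a b z u = ket n" by (auto simp: u_def jsh_rsv bb)
  have "cscale \<i> (jop a b u) \<bullet> u = - (cscale \<i> (jop a b u) \<bullet> u)"
    using inner_cscale_ii[of "jop a b u" u] jop_symmetric[OF jp, of u "cscale \<i> u"]
    by (simp add: jop_cscale[OF jp] inner_commute)
  then have "cscale \<i> (jop a b u) \<bullet> u = 0" by simp
  moreover have "cscale \<i> (ket n) = cscale \<i> (jop a b u) - cscale (\<i> * z) u"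
    unfolding u[symmetric] jsh_def by (simp add: cscale_diff cscale_cscale)
  ultimately have "cscale \<i> (ket n) \<bullet> u = Im z * (norm u)\<^sup>2"
    by (simp add: inner_diff_left inner_cscale_self)
  then show ?thesis by (simp add: inner_cscale_ket green_def u_def)
qed

lemma Im_green_pos:
  assumes "Im z > 0" shows "Im (green a b n z) > 0"
proof -
  have bb: "regular_value z" using assms by (intro regular_value_nonreal) auto
  have "rsv a b z (ket n) \<noteq> 0"
  proof
    assume "rsv a b z (ket n) = 0"
    then have "jsh a b z 0 = ket n" using jsh_rsv[OF bb] by metis
    then have "ket n = 0" using linear_0[OF bounded_linear.linear[OF bounded_linear_jsh[of z]]] by simp
    then show False using norm_ket[of n] by simp
  qed
  then show ?thesis using Im_green[OF bb] assms by simp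
qed

text \<open>If \<open>c\<close>, the minimum modulus of \<open>J - m\<close>, were at most \<open>r\<close>, both \<open>m \<plusminus> c\<close> would be regular, so
  that \<open>(J - m)\<^sup>2 - c\<^sup>2\<close> would be boundedly invertible as well as nonnegative, hence
  bounded below by a positive constant.\<close>

lemma norm_jsh_gap:
  fixes m r :: real
  assumes "\<And>x::real. \<bar>x - m\<bar> \<le> r \<Longrightarrow> regular_value (of_real x)" "r \<ge> 0"
  obtains \<kappa> where "\<kappa> > 0" "\<And>u. (r\<^sup>2 + \<kappa>) * (norm u)\<^sup>2 \<le> (norm (jsh a b (of_real m) u))\<^sup>2"
proof -
  define S where "S = (\<lambda>u. norm (jsh a b (of_real m) u)) ` {u. norm u = 1}"
  define c where "c = Inf S"
  have S: "S \<noteq> {}" "bdd_below S" by (auto simp: S_def intro!: exI[of _ "ket 0"] bdd_belowI[of _ 0])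
  have c0: "c \<ge> 0" unfolding c_def using S by (intro cInf_greatest) (auto simp: S_def)
  have lower: "c * norm u \<le> norm (jsh a b (of_real m) u)" for u
  proof (cases "u = 0")
    case False
    then have "norm (jsh a b (of_real m) (u /\<^sub>R norm u)) \<in> S" by (auto simp: S_def)
    then have "c \<le> norm (jsh a b (of_real m) (u /\<^sub>R norm u))"
      unfolding c_def using S by (intro cInf_lower) auto
    then show ?thesis using False by (simp add: jsh_scaleR field_simps)
  qed simp
  have "c > r"
  proof (rule ccontr)
    assume "\<not> c > r"
    then have "regular_value (of_real (m + c))" "regular_value (of_real (m - c))"
      using c0 by (intro assms(1); simp)+
    then obtain k1 k2 where k: "k1 > 0" "k2 > 0"
      "\<And>u. k1 * norm u \<le> norm (jsh a b (of_real (m + c)) u)"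
      "\<And>u. k2 * norm u \<le> norm (jsh a b (of_real (m - c)) u)"
      unfolding regular_value_def by blast
    define A where "A u = jsh a b (of_real (m + c)) (jsh a b (of_real (m - c)) u)" for u
    have A_alt: "A u = jsh a b (of_real m) (jsh a b (of_real m) u) - c\<^sup>2 *\<^sub>R u" for u
      unfolding A_def jsh_shift[of "of_real (m + c)" _ "of_real m"] jsh_shift[of "of_real (m - c)" _ "of_real m"]
      by (simp add: jsh_add jsh_cscale flip: of_real_diff)
        (simp add: cscale_of_real scaleR_add_right power2_eq_square jsh_scaleR flip: of_real_minus)
    have blA: "bounded_linear A" unfolding A_def
      by (intro bounded_linear_compose[OF bounded_linear_jsh] bounded_linear_jsh)
    obtain K where K: "K > 0" "\<And>u. norm (A u) \<le> norm u * K"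
      using bounded_linear.pos_bounded[OF blA] by blast
    have quad: "u \<bullet> A u = (norm (jsh a b (of_real m) u))\<^sup>2 - c\<^sup>2 * (norm u)\<^sup>2" for u
      unfolding A_alt inner_diff_right power2_norm_eq_inner by (simp add: jsh_adjoint)
    have pos: "u \<bullet> A u \<ge> 0" for u
      unfolding quad using power_mono[OF lower[of u], of 2] c0 by (simp add: power_mult_distrib)
    have sym: "A u \<bullet> v = u \<bullet> A v" for u v
      unfolding A_alt by (simp add: inner_diff_left inner_diff_right jsh_adjoint)
    have lowA: "(k1 * k2)\<^sup>2 * (norm u)\<^sup>2 \<le> (norm (A u))\<^sup>2" for u
    proof -
      have "(k1 * k2) * norm u \<le> k1 * norm (jsh a b (of_real (m - c)) u)"
        using k(1) k(4)[of u] by simp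
      also have "\<dots> \<le> norm (A u)" unfolding A_def by (rule k(3))
      finally show ?thesis using k power_mono[of "k1 * k2 * norm u" "norm (A u)" 2]
        by (simp add: power_mult_distrib)
    qed
    \<comment> \<open>A nonnegative symmetric operator bounded by \<open>K\<close> satisfies A^2
      \<le> K A: evaluate its form at u - Au/K. With the lower bound for the norm of Au, this turns
      nonnegativity into strict positivity.\<close>
    have key: "(norm (A u))\<^sup>2 / K \<le> u \<bullet> A u" for u
    proof -
      define v where "v = u - (1 / K) *\<^sub>R A u"
      have Av: "A v = A u - (1 / K) *\<^sub>R A (A u)"
        unfolding v_def using blA by (simp add: bounded_linear.linear linear_diff linear_scale)
      have "v \<bullet> A v = u \<bullet> A u - (2 / K) * (norm (A u))\<^sup>2 + (A u \<bullet> A (A u)) / K\<^sup>2"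
        unfolding Av power2_norm_eq_inner unfolding v_def
        by (simp add: inner_diff_left inner_diff_right sym[of u "A u", symmetric] power2_eq_square
            diff_divide_distrib)
      moreover have "0 \<le> v \<bullet> A v" by (rule pos)
      moreover have "(A u \<bullet> A (A u)) / K\<^sup>2 \<le> (K * (norm (A u))\<^sup>2) / K\<^sup>2"
        using order_trans[OF norm_cauchy_schwarz[of "A u" "A (A u)"] mult_left_mono[OF K(2)[of "A u"], of "norm (A u)"]]
        by (intro divide_right_mono) (auto simp: power2_eq_square mult_ac)
      moreover have "(K * (norm (A u))\<^sup>2) / K\<^sup>2 = (norm (A u))\<^sup>2 / K"
        using K(1) by (simp add: power2_eq_square)
      ultimately show ?thesis by simp
    qed
    define e where "e = (k1 * k2)\<^sup>2 / K"
    have e: "e > 0" using k K by (simp add: e_def)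
    \<comment> \<open>The squared norms on unit vectors exceed c^2 by a fixed \<open>e\<close>,
      which contradicts \<open>c\<close> being their infimum.\<close>
    have "sqrt (c\<^sup>2 + e) \<le> y" if "y \<in> S" for y
    proof -
      obtain u where u: "norm u = 1" "y = norm (jsh a b (of_real m) u)" using \<open>y \<in> S\<close> by (auto simp: S_def)
      have "e \<le> (norm (A u))\<^sup>2 / K"
        unfolding e_def using lowA[of u] u K by (intro divide_right_mono) auto
      also have "\<dots> \<le> y\<^sup>2 - c\<^sup>2" using key[of u] quad[of u] u by simp
      finally have "c\<^sup>2 + e \<le> y\<^sup>2" by simp
      then show ?thesis using u by (intro real_le_lsqrt) auto
    qed
    then have "sqrt (c\<^sup>2 + e) \<le> c" unfolding c_def using S by (intro cInf_greatest) auto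
    then have "c\<^sup>2 + e \<le> c\<^sup>2" using c0 sqrt_le_D by blast
    then show False using e by simp
  qed
  show ?thesis
  proof (rule that[of "c\<^sup>2 - r\<^sup>2"])
    show "c\<^sup>2 - r\<^sup>2 > 0" using \<open>c > r\<close> assms(2) by (simp add: power_strict_mono)
    show "(r\<^sup>2 + (c\<^sup>2 - r\<^sup>2)) * (norm u)\<^sup>2 \<le> (norm (jsh a b (of_real m) u))\<^sup>2" for u
      using power_mono[OF lower[of u], of 2] c0 by (simp add: power_mult_distrib)
  qed
qed

lemma approximate_eigenvector:
  assumes "z \<in> l2_spectrum (jacobi_operator a b)" "e > 0"
  obtains u where "norm u = 1" "norm (jsh a b z u) < e"
proof -
  have "\<not> regular_value z" using assms not_in_spectrum_iff by blast
  then obtain u where u: "norm (jsh a b z u) < e * norm u"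
    using assms(2) unfolding regular_value_def by (meson not_le)
  have "u \<noteq> 0" using u by auto
  show ?thesis
  proof (rule that[of "u /\<^sub>R norm u"])
    show "norm (jsh a b z (u /\<^sub>R norm u)) < e"
      using u \<open>u \<noteq> 0\<close> by (simp add: jsh_scaleR field_simps)
  qed (use \<open>u \<noteq> 0\<close> in simp)
qed

end

subsection \<open>Analytic continuation of reflectionless Herglotz functions\<close>

text \<open>A bounded derivative on a convex set makes the primitive Lipschitz, hence uniformly
  continuous, so it extends to the closed half-plane even at points where \<open>f\<close> has no
  boundary value.\<close>

lemma upper_half_plane_primitive:
  assumes hol: "f holomorphic_on {z. 0 < Im z}" and bd: "\<And>z. 0 < Im z \<Longrightarrow> cmod (f z) \<le> 1"
  obtains P where "\<And>z. 0 < Im z \<Longrightarrow> (P has_field_derivative f z) (at z)"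
    "continuous_on {z. 0 \<le> Im z} P"
proof -
  define U where "U = {z. 0 < Im z}"
  have U: "convex U" "open U" unfolding U_def
    by (rule convex_halfspace_Im_gt, rule open_halfspace_Im_gt)
  obtain P where P: "\<And>z. z \<in> U \<Longrightarrow> (P has_field_derivative f z) (at z within U)"
    using holomorphic_convex_primitive'[OF U] hol U_def by blast
  have "1-lipschitz_on U P"
    by (rule lipschitz_onI)
      (use field_differentiable_bound[OF U(1) P, of 1] bd in \<open>auto simp: dist_norm U_def\<close>)
  then have "uniformly_continuous_on U P" by (rule lipschitz_on_uniformly_continuous)
  then obtain g where g: "uniformly_continuous_on (closure U) g" "\<And>x. x \<in> U \<Longrightarrow> P x = g x"
    using uniformly_continuous_on_extension_on_closure by metis
  have cl: "closure U = {z. 0 \<le> Im z}"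
    using closure_halfspace_gt[of \<i> 0] by (simp add: U_def)
  show ?thesis
  proof
    show "continuous_on {z. 0 \<le> Im z} g"
      using uniformly_continuous_imp_continuous[OF g(1)] cl by simp
    show "(g has_field_derivative f z) (at z)" if "0 < Im z" for z
    proof (rule has_field_derivative_transform_within_open)
      show "(P has_field_derivative f z) (at z)"
        using P[of z] at_within_open[of z U] that U(2) by (simp add: U_def)
      show "P w = g w" if "w \<in> U" for w by (rule g(2)[OF that])
    qed (use U that in \<open>auto simp: U_def\<close>)
  qed
qed

text \<open>The integral of Im f over the segment at height y is an increment of Im P. As y
  decreases to 0 it tends to 0 by dominated convergence, since |f| is bounded by 1, while the
  increment tends to the one on the real line.\<close>

lemma Im_primitive_constant:
  assumes P: "\<And>z. 0 < Im z \<Longrightarrow> (P has_field_derivative f z) (at z)"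
    and contP: "continuous_on {z. 0 \<le> Im z} P"
    and hol: "f holomorphic_on {z. 0 < Im z}" and bd: "\<And>z. 0 < Im z \<Longrightarrow> cmod (f z) \<le> 1"
    and lim: "AE x in lebesgue. x \<in> {p..q} \<longrightarrow>
       ((\<lambda>y. Im (f (of_real x + \<i> * of_real y))) \<longlongrightarrow> 0) (at_right 0)"
    and x: "p \<le> x1" "x1 \<le> x2" "x2 \<le> q"
  shows "Im (P (of_real x2)) = Im (P (of_real x1))"
proof -
  define y :: "nat \<Rightarrow> real" where "y n = inverse (real (Suc n))" for n
  have ypos: "y n > 0" for n by (simp add: y_def)
  have y0: "y \<longlonglongrightarrow> 0" unfolding y_def by (rule LIMSEQ_inverse_real_of_nat)
  have yr: "filterlim y (at_right 0) sequentially"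
    by (rule tendsto_imp_filterlim_at_right[OF y0]) (simp add: ypos)
  define s where "s n x = indicat_real {x1..x2} x * Im (f (of_real x + \<i> * of_real (y n)))" for n x
  have contf: "continuous_on {x1..x2} (\<lambda>x. Im (f (of_real x + \<i> * of_real (y n))))" for n
    by (intro continuous_on_Im continuous_on_compose2[OF holomorphic_on_imp_continuous_on[OF hol]]
        continuous_intros) (auto simp: ypos)
  have "(\<lambda>x. indicat_real {x1..x2} x *\<^sub>R Im (f (of_real x + \<i> * of_real (y n)))) \<in> borel_measurable borel" for n
    by (rule borel_measurable_continuous_on_indicator[OF _ contf]) simp
  then have meas: "s n \<in> borel_measurable lebesgue" for n
    unfolding s_def by (intro measurable_completion) simp
  have w: "integrable lebesgue (indicat_real {x1..x2})"
    by (intro integrable_real_indicator) (auto simp: emeasure_lborel_Icc_eq)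
  have bound: "norm (s n x) \<le> indicat_real {x1..x2} x" for n x
  proof -
    have "\<bar>Im (f (of_real x + \<i> * of_real (y n)))\<bar> \<le> 1"
      using bd[of "of_real x + \<i> * of_real (y n)"] ypos[of n] abs_Im_le_cmod order_trans by fastforce
    then show ?thesis by (auto simp: s_def indicator_def)
  qed
  have "(\<lambda>n. integral\<^sup>L lebesgue (s n)) \<longlonglongrightarrow> integral\<^sup>L lebesgue (\<lambda>x::real. 0::real)"
  proof (rule integral_dominated_convergence)
    show "AE x in lebesgue. (\<lambda>n. s n x) \<longlonglongrightarrow> 0"
      using lim
    proof eventually_elim
      case (elim x)
      show ?case
      proof (cases "x \<in> {x1..x2}")
        case True
        then have "((\<lambda>y. Im (f (of_real x + \<i> * of_real y))) \<longlongrightarrow> 0) (at_right 0)" using elim x by auto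
        from filterlim_compose[OF this yr] True show ?thesis by (simp add: s_def)
      qed (simp add: s_def)
    qed
  qed (use meas w bound in auto)
  \<comment> \<open>The fundamental theorem yields a gauge integral, dominated convergence concerns
    the Lebesgue integral; integrability of \<open>s n\<close> identifies the two.\<close>
  moreover have "integral\<^sup>L lebesgue (s n) =
      Im (P (of_real x2 + \<i> * of_real (y n))) - Im (P (of_real x1 + \<i> * of_real (y n)))" for n
  proof -
    have "((\<lambda>x. f (of_real x + \<i> * of_real (y n))) has_integral
        (P (of_real x2 + \<i> * of_real (y n)) - P (of_real x1 + \<i> * of_real (y n)))) {x1..x2}"
    proof (rule fundamental_theorem_of_calculus[OF x(2)])
      fix x
      have "((\<lambda>x. of_real x + \<i> * of_real (y n)) has_vector_derivative 1) (at x)"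
        unfolding has_vector_derivative_def
        by (auto intro!: derivative_eq_intros simp: scaleR_conv_of_real)
      from field_vector_diff_chain_at[OF this P] ypos[of n]
      show "((\<lambda>x. P (of_real x + \<i> * of_real (y n))) has_vector_derivative
          f (of_real x + \<i> * of_real (y n))) (at x within {x1..x2})"
        by (auto simp: o_def intro: has_vector_derivative_at_within)
    qed
    from has_integral_linear[OF this bounded_linear_Im]
    have "((\<lambda>x. Im (f (of_real x + \<i> * of_real (y n)))) has_integral
      (Im (P (of_real x2 + \<i> * of_real (y n))) - Im (P (of_real x1 + \<i> * of_real (y n))))) {x1..x2}"
      by (simp add: o_def)
    moreover have "s n = (\<lambda>x. if x \<in> {x1..x2} then Im (f (of_real x + \<i> * of_real (y n))) else 0)"
      by (auto simp: s_def indicator_def)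
    ultimately have "(s n has_integral
      (Im (P (of_real x2 + \<i> * of_real (y n))) - Im (P (of_real x1 + \<i> * of_real (y n))))) UNIV"
      by (simp only: has_integral_restrict_UNIV)
    moreover have "integrable lebesgue (s n)"
      by (rule Bochner_Integration.integrable_bound[OF w meas]) (use bound in auto)
    then have "(s n has_integral integral\<^sup>L lebesgue (s n)) UNIV" by (rule has_integral_integral_lebesgue)
    ultimately show ?thesis using has_integral_unique by blast
  qed
  moreover have "(\<lambda>n. Im (P (of_real x2 + \<i> * of_real (y n))) - Im (P (of_real x1 + \<i> * of_real (y n))))
      \<longlonglongrightarrow> Im (P (of_real x2)) - Im (P (of_real x1))"
  proof -
    have "(\<lambda>n. P (of_real x + \<i> * of_real (y n))) \<longlonglongrightarrow> P (of_real x)" for x :: real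
    proof (rule continuous_on_tendsto_compose[OF contP])
      have "(\<lambda>n. of_real x + \<i> * of_real (y n)) \<longlonglongrightarrow> of_real x + \<i> * of_real 0"
        by (intro tendsto_intros y0)
      then show "(\<lambda>n. of_real x + \<i> * of_real (y n)) \<longlonglongrightarrow> of_real x" by simp
    qed (auto simp: ypos less_imp_le)
    then show ?thesis by (intro tendsto_intros)
  qed
  ultimately have "Im (P (of_real x2)) - Im (P (of_real x1)) = 0"
    using LIMSEQ_unique by fastforce
  then show ?thesis by simp
qed

text \<open>A primitive of \<open>f\<close> is Lipschitz, hence continuous up to the real line, where its imaginary part is
  constant on \<open>[p, q]\<close>; unlike \<open>f\<close> itself it can be reflected. The bound \<open>|f| < 1\<close> survives at the boundary
  by the maximum principle, since the reflected function is also bounded by \<open>1\<close>.\<close>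

lemma boundary_real_extension:
  fixes p q x0 :: real
  assumes hol: "f holomorphic_on {z. 0 < Im z}" and bd: "\<And>z. 0 < Im z \<Longrightarrow> cmod (f z) < 1"
    and lim: "AE x in lebesgue. x \<in> {p..q} \<longrightarrow>
       ((\<lambda>y. Im (f (of_real x + \<i> * of_real y))) \<longlongrightarrow> 0) (at_right 0)"
    and x0: "p < x0" "x0 < q"
  obtains r h where "r > 0" "h holomorphic_on ball (of_real x0) r"
    "\<And>z. z \<in> ball (of_real x0) r \<Longrightarrow> 0 < Im z \<Longrightarrow> h z = f z"
    "\<And>z. z \<in> ball (of_real x0) r \<Longrightarrow> cmod (h z) < 1"
    "\<And>x::real. complex_of_real x \<in> ball (of_real x0) r \<Longrightarrow> Im (h (of_real x)) = 0"
proof -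
  obtain P where P: "\<And>z. 0 < Im z \<Longrightarrow> (P has_field_derivative f z) (at z)"
    and contP: "continuous_on {z. 0 \<le> Im z} P"
    using upper_half_plane_primitive[OF hol] bd less_imp_le by metis
  have const: "Im (P (of_real x)) = Im (P (of_real p))" if "p \<le> x" "x \<le> q" for x
    by (rule Im_primitive_constant[OF P contP hol _ lim]) (use that bd less_imp_le in auto)
  \<comment> \<open>The subtracted constant makes the primitive real on [p, q], as Schwarz
    reflection requires.\<close>
  define F where "F z = P z - \<i> * of_real (Im (P (of_real p)))" for z
  have DF: "(F has_field_derivative f z) (at z)" if "0 < Im z" for z
    unfolding F_def using P[OF that] by (auto intro!: derivative_eq_intros)
  have contF: "continuous_on {z. 0 \<le> Im z} F"
    unfolding F_def by (intro continuous_intros contP)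
  define r where "r = min (x0 - p) (q - x0)"
  define S where "S = ball (complex_of_real x0) r"
  have r: "r > 0" using x0 by (simp add: r_def)
  have cnjS: "cnj z \<in> S" if "z \<in> S" for z
  proof -
    have "of_real x0 - cnj z = cnj (of_real x0 - z)" by simp
    then show ?thesis using that by (simp only: S_def mem_ball dist_norm complex_mod_cnj)
  qed
  have Sreal: "p \<le> x \<and> x \<le> q" if "of_real x \<in> S" for x :: real
  proof -
    have "\<bar>x0 - x\<bar> < r" using that unfolding S_def mem_ball dist_norm
      by (metis norm_of_real of_real_diff)
    then show ?thesis by (auto simp: r_def)
  qed
  define \<phi> where "\<phi> z = (if 0 \<le> Im z then F z else cnj (F (cnj z)))" for z
  have holphi: "\<phi> holomorphic_on S"
    unfolding \<phi>_def
  proof (rule Schwarz_reflection)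
    show "F holomorphic_on S \<inter> {z. 0 < Im z}"
      by (rule holomorphic_onI) (use DF field_differentiable_at_within field_differentiable_def in blast)
    show "continuous_on (S \<inter> {z. 0 \<le> Im z}) F" by (rule continuous_on_subset[OF contF]) auto
    show "F z \<in> \<real>" if "z \<in> S" "z \<in> \<real>" for z
    proof -
      obtain x where x: "z = of_real x" using \<open>z \<in> \<real>\<close> Reals_cases by blast
      then have "Im (F z) = 0" using const[of x] Sreal[of x] that by (simp add: F_def)
      then show ?thesis by (simp add: complex_is_Real_iff)
    qed
  qed (use cnjS in \<open>auto simp: S_def\<close>)
  define h where "h = deriv \<phi>"
  have S: "open S" by (simp add: S_def)
  have holh: "h holomorphic_on S" unfolding h_def by (rule holomorphic_deriv[OF holphi S])
  have up: "h z = f z" if "z \<in> S" "0 < Im z" for z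
    unfolding h_def
  proof (rule DERIV_imp_deriv, rule has_field_derivative_transform_within_open[OF DF])
    show "open {z. 0 < Im z}" by (rule open_halfspace_Im_gt)
  qed (use that in \<open>auto simp: \<phi>_def\<close>)
  have low: "h z = cnj (f (cnj z))" if "z \<in> S" "Im z < 0" for z
    unfolding h_def
  proof (rule DERIV_imp_deriv, rule has_field_derivative_transform_within_open)
    show "(cnj \<circ> F \<circ> cnj has_field_derivative cnj (f (cnj z))) (at z)"
      using has_field_derivative_cnj_cnj[of F "f (cnj z)" z] DF[of "cnj z"] that
      by simp
    show "open {z. Im z < 0}" by (rule open_halfspace_Im_lt)
  qed (use that in \<open>auto simp: \<phi>_def\<close>)
  have real: "Im (h (of_real x)) = 0 \<and> cmod (h (of_real x)) \<le> 1" if xS: "of_real x \<in> S" for x :: real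
  proof
    define y :: "nat \<Rightarrow> real" where "y n = inverse (real (Suc n))" for n
    have ypos: "y n > 0" for n by (simp add: y_def)
    have y0: "y \<longlonglongrightarrow> 0" unfolding y_def by (rule LIMSEQ_inverse_real_of_nat)
    have conv1: "(\<lambda>n. of_real x + c * complex_of_real (y n)) \<longlonglongrightarrow> of_real x" for c
    proof -
      have "(\<lambda>n. of_real x + c * of_real (y n)) \<longlonglongrightarrow> of_real x + c * complex_of_real 0"
        by (intro tendsto_intros y0)
      then show ?thesis by simp
    qed
    have evS: "\<forall>\<^sub>F n in sequentially. of_real x + c * complex_of_real (y n) \<in> S" for c
      using topological_tendstoD[OF conv1 S xS] .
    have "isCont h (of_real x)"
      using holomorphic_on_imp_continuous_on[OF holh] S xS continuous_on_eq_continuous_at by blast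
    then have "(\<lambda>n. h (of_real x + \<i> * of_real (y n))) \<longlonglongrightarrow> h (of_real x)"
      using conv1 by (rule isCont_tendsto_compose)
    moreover have "\<forall>\<^sub>F n in sequentially. norm (h (of_real x + \<i> * of_real (y n))) \<le> 1"
      using evS[of \<i>] by eventually_elim (auto simp: up ypos intro!: less_imp_le[OF bd])
    ultimately show "cmod (h (of_real x)) \<le> 1"
      by (rule Lim_norm_ubound[OF sequentially_bot])
    \<comment> \<open>Reality of \<open>h\<close>: the complex derivative may be computed along real
      increments, for which the difference quotients of \<phi> are real.\<close>
    have "(\<phi> has_field_derivative h (of_real x)) (at (of_real x))"
      unfolding h_def using holomorphic_derivI[OF holphi S xS] .
    then have quot: "((\<lambda>w. (\<phi> w - \<phi> (of_real x)) / (w - of_real x)) \<longlongrightarrow> h (of_real x)) (at (of_real x))"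
      by (simp add: has_field_derivative_iff)
    have "filterlim (\<lambda>n. of_real x + 1 * complex_of_real (y n)) (at (of_real x)) sequentially"
      unfolding filterlim_at using conv1[of 1] ypos by (auto simp: less_imp_neq[symmetric])
    from filterlim_compose[OF quot this]
    have lim1: "(\<lambda>n. (\<phi> (of_real x + of_real (y n)) - \<phi> (of_real x)) / of_real (y n)) \<longlonglongrightarrow> h (of_real x)"
      by simp
    have phireal: "\<phi> (of_real t) \<in> \<real>" if "of_real t \<in> S" for t :: real
      using const[of t] Sreal[OF that] by (simp add: \<phi>_def F_def complex_is_Real_iff)
    have "\<forall>\<^sub>F n in sequentially. (\<phi> (of_real x + of_real (y n)) - \<phi> (of_real x)) / of_real (y n) \<in> \<real>"
      using evS[of 1]
    proof eventually_elim
      case (elim n)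
      then have "\<phi> (of_real (x + y n)) \<in> \<real>" by (intro phireal) simp
      then show ?case using phireal[OF xS] by (simp add: Reals_diff Reals_divide)
    qed
    then have "h (of_real x) \<in> \<real>"
      using lim1 by (intro Lim_in_closed_set[OF closed_complex_Reals _ sequentially_bot lim1]) auto
    then show "Im (h (of_real x)) = 0" by (simp add: complex_is_Real_iff)
  qed
  have le1: "cmod (h z) \<le> 1" if "z \<in> S" for z
  proof (cases "Im z = 0")
    case True
    then have "z = of_real (Re z)" by (simp add: complex_eq_iff)
    then show ?thesis using real[of "Re z"] that by simp
  next
    case False
    then show ?thesis using up[OF that] low[OF that] bd[of z] bd[of "cnj z"]
      by (cases "Im z > 0") auto
  qed
  \<comment> \<open>Strictness is what allows division by 1 - h when the Cayley transform is
    inverted. A value of modulus 1 would make \<open>h\<close> constant on the ball, but in the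
    upper half of the ball \<open>h\<close> equals \<open>f\<close>, whose modulus is below
    1.\<close>
  have lt1: "cmod (h z) < 1" if "z \<in> S" for z
  proof (rule ccontr)
    assume "\<not> cmod (h z) < 1"
    then have eq1: "cmod (h z) = 1" using le1[OF that] by simp
    have "h constant_on S"
      by (rule maximum_modulus_principle[OF holh S _ S subset_refl that])
        (use le1 eq1 in \<open>auto simp: S_def\<close>)
    moreover have w: "of_real x0 + \<i> * of_real (r/2) \<in> S"
      using r by (simp add: S_def dist_norm norm_mult)
    ultimately have "h (of_real x0 + \<i> * of_real (r/2)) = h z" using that
      by (auto simp: constant_on_def)
    then show False using up[OF w] bd[of "of_real x0 + \<i> * of_real (r/2)"] r eq1 by simp
  qed
  show ?thesis
    by (rule that[of r h]) (use r holh up lt1 real in \<open>auto simp: S_def\<close>)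
qed

text \<open>The Cayley transform (G - \<i>)/(G + \<i>) makes the Herglotz function bounded and sends
  the imaginary axis into the real line, so that Re G tending to 0 becomes Im f tending to 0. The
  extension \<open>h\<close> of the transform is carried back by \<i>(1 + h)/(1 - h).\<close>

lemma reflectionless_extension:
  fixes p q x0 :: real
  assumes hol: "G holomorphic_on {z. 0 < Im z}" and pos: "\<And>z. 0 < Im z \<Longrightarrow> 0 < Im (G z)"
    and lim: "AE x in lebesgue. x \<in> {p..q} \<longrightarrow>
       ((\<lambda>y. Re (G (of_real x + \<i> * of_real y))) \<longlongrightarrow> 0) (at_right 0)"
    and x0: "p < x0" "x0 < q"
  obtains r g where "r > 0" "g holomorphic_on ball (of_real x0) r"
    "\<And>z. z \<in> ball (of_real x0) r \<Longrightarrow> 0 < Im z \<Longrightarrow> g z = G z"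
    "\<And>x::real. complex_of_real x \<in> ball (of_real x0) r \<Longrightarrow> Re (g (of_real x)) = 0"
proof -
  define f where "f z = (G z - \<i>) / (G z + \<i>)" for z
  have nz: "G z + \<i> \<noteq> 0" if "0 < Im z" for z
    using pos[OF that] by (auto simp: complex_eq_iff)
  have n1: "1 \<le> cmod (G z + \<i>)" if "0 < Im z" for z
    using pos[OF that] abs_Im_le_cmod[of "G z + \<i>"] by simp
  have holf: "f holomorphic_on {z. 0 < Im z}"
    unfolding f_def using nz by (intro holomorphic_intros hol) auto
  have bdf: "cmod (f z) < 1" if "0 < Im z" for z
  proof -
    have "(cmod (G z - \<i>))\<^sup>2 < (cmod (G z + \<i>))\<^sup>2"
      unfolding cmod_power2 using pos[OF that] by (simp add: power2_eq_square algebra_simps)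
    then have "cmod (G z - \<i>) < cmod (G z + \<i>)" by (rule power2_less_imp_less) simp
    then show ?thesis unfolding f_def norm_divide using n1[OF that] by (simp add: divide_less_eq)
  qed
  have Imf: "\<bar>Im (f z)\<bar> \<le> 2 * \<bar>Re (G z)\<bar>" if "0 < Im z" for z
  proof -
    have "f z = ((G z - \<i>) * cnj (G z + \<i>)) / of_real ((cmod (G z + \<i>))\<^sup>2)"
      unfolding f_def using nz[OF that]
      by (simp add: complex_div_cnj[of "G z - \<i>" "G z + \<i>"] flip: of_real_power)
    then have "Im (f z) = - 2 * Re (G z) / (cmod (G z + \<i>))\<^sup>2"
      by (simp add: Im_divide_of_real algebra_simps del: of_real_power)
    then have "\<bar>Im (f z)\<bar> = 2 * \<bar>Re (G z)\<bar> / (cmod (G z + \<i>))\<^sup>2" by (simp add: abs_divide abs_mult)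
    also have "\<dots> \<le> 2 * \<bar>Re (G z)\<bar> / 1"
      using n1[OF that] by (intro divide_left_mono) (auto simp: one_le_power)
    finally show ?thesis by simp
  qed
  have ae: "AE x in lebesgue. x \<in> {p..q} \<longrightarrow>
       ((\<lambda>y. Im (f (of_real x + \<i> * of_real y))) \<longlongrightarrow> 0) (at_right 0)"
    using lim
  proof (eventually_elim, intro impI)
    fix x assume "x \<in> {p..q} \<longrightarrow> ((\<lambda>y. Re (G (of_real x + \<i> * of_real y))) \<longlongrightarrow> 0) (at_right 0)" "x \<in> {p..q}"
    then have "((\<lambda>y. 2 * \<bar>Re (G (of_real x + \<i> * of_real y))\<bar>) \<longlongrightarrow> 2 * \<bar>0\<bar>) (at_right 0)"
      by (intro tendsto_intros) auto
    then have bnd: "((\<lambda>y. 2 * \<bar>Re (G (of_real x + \<i> * of_real y))\<bar>) \<longlongrightarrow> 0) (at_right 0)" by simp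
    have "\<forall>\<^sub>F y in at_right 0. norm (Im (f (of_real x + \<i> * of_real y))) \<le>
        2 * \<bar>Re (G (of_real x + \<i> * of_real y))\<bar>"
      using eventually_at_right_less[of "0::real"]
    proof eventually_elim
      case (elim y)
      then show ?case using Imf[of "of_real x + \<i> * of_real y"] by simp
    qed
    then show "((\<lambda>y. Im (f (of_real x + \<i> * of_real y))) \<longlongrightarrow> 0) (at_right 0)"
      using bnd by (rule Lim_null_comparison)
  qed
  obtain r h where h: "r > 0"
    "h holomorphic_on ball (of_real x0) r"
    "\<And>z. z \<in> ball (of_real x0) r \<Longrightarrow> 0 < Im z \<Longrightarrow> h z = f z"
    "\<And>z. z \<in> ball (of_real x0) r \<Longrightarrow> cmod (h z) < 1"
    "\<And>x::real. complex_of_real x \<in> ball (of_real x0) r \<Longrightarrow> Im (h (of_real x)) = 0"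
  proof (rule boundary_real_extension[OF holf bdf ae x0])
    fix r h assume "r > 0" "h holomorphic_on ball (of_real x0) r"
      "\<And>z. z \<in> ball (of_real x0) r \<Longrightarrow> 0 < Im z \<Longrightarrow> h z = f z"
      "\<And>z. z \<in> ball (of_real x0) r \<Longrightarrow> cmod (h z) < 1"
      "\<And>x::real. complex_of_real x \<in> ball (of_real x0) r \<Longrightarrow> Im (h (of_real x)) = 0"
    then show thesis by (rule that)
  qed
  have h1: "1 - h z \<noteq> 0" if "z \<in> ball (of_real x0) r" for z
    using h(4)[OF that] by auto
  show ?thesis
  proof (rule that[of r "\<lambda>z. \<i> * (1 + h z) / (1 - h z)"])
    show "(\<lambda>z. \<i> * (1 + h z) / (1 - h z)) holomorphic_on ball (of_real x0) r"
      using h1 by (intro holomorphic_intros h(2)) auto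
    show "\<i> * (1 + h z) / (1 - h z) = G z" if "z \<in> ball (of_real x0) r" "0 < Im z" for z
    proof -
      have eq: "1 - h z = 2 * \<i> / (G z + \<i>)" "1 + h z = 2 * G z / (G z + \<i>)"
        using nz[OF that(2)] by (simp_all add: h(3)[OF that] f_def field_simps)
      show ?thesis unfolding eq using nz[OF that(2)] by simp
    qed
    show "Re (\<i> * (1 + h (of_real x)) / (1 - h (of_real x))) = 0"
      if "complex_of_real x \<in> ball (of_real x0) r" for x :: real
      using h(5)[OF that] by (simp add: Re_divide)
  qed (rule h(1))
qed

subsection \<open>Square-root singularities at the band edges\<close>

text \<open>The principal root jumps across the negative axis but is continuous from above,
  including on the axis: there both its coordinates are nonnegative and given by the half-angle
  formula.\<close>

lemma continuous_on_csqrt_upper: "continuous_on {z. 0 \<le> Im z} csqrt"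
proof (rule continuous_on_eq)
  show "continuous_on {z. 0 \<le> Im z}
      (\<lambda>z. Complex (sqrt ((cmod z + Re z) / 2)) (sqrt ((cmod z - Re z) / 2)))"
    by (intro continuous_intros) auto
qed (auto simp: complex_eq_iff)

text \<open>One point is filled in at a time; the limit condition at the others survives because the
  extension agrees with \<open>f\<close> near them.\<close>

lemma holomorphic_finite_removable:
  assumes "finite K" "f holomorphic_on - K"
    and "\<And>k. k \<in> K \<Longrightarrow> ((\<lambda>z. (z - k) * f z) \<longlongrightarrow> 0) (at k)"
  shows "\<exists>g. g holomorphic_on UNIV \<and> (\<forall>z. z \<notin> K \<longrightarrow> g z = f z)"
  using assms
proof (induction K arbitrary: f)
  case empty
  then show ?case by auto
next
  case (insert k K)
  have op: "open (- K)" using insert.hyps(1) by (simp add: finite_imp_closed open_Compl)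
  have eq: "- insert k K = - K - {k}" by auto
  have "k \<in> interior (- K)" using op insert.hyps(2) by (simp add: interior_open)
  then obtain g where g: "g holomorphic_on - K" "\<And>z. z \<in> - K - {k} \<Longrightarrow> g z = f z"
    using holomorphic_on_extend_lim[of f "- K" k] insert.prems unfolding eq by blast
  have "((\<lambda>z. (z - k') * g z) \<longlongrightarrow> 0) (at k')" if "k' \<in> K" for k'
  proof (rule Lim_transform_eventually)
    show "((\<lambda>z. (z - k') * f z) \<longlongrightarrow> 0) (at k')" using insert.prems that by blast
    have "open (- ((K - {k'}) \<union> {k}))"
      using insert.hyps(1) by (simp add: finite_imp_closed open_Compl)
    moreover have "k' \<in> - ((K - {k'}) \<union> {k})" using that insert.hyps(2) by auto
    ultimately have "\<forall>\<^sub>F z in at k'. z \<in> - ((K - {k'}) \<union> {k})"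
      by (rule eventually_at_in_open')
    moreover have "\<forall>\<^sub>F z in at k'. z \<noteq> k'" by (simp add: eventually_at_filter)
    ultimately show "\<forall>\<^sub>F z in at k'. (z - k') * f z = (z - k') * g z"
      by eventually_elim (use g(2) in auto)
  qed
  from insert.IH[OF g(1) this] obtain h where "h holomorphic_on UNIV" "\<And>z. z \<notin> K \<Longrightarrow> h z = g z"
    by blast
  then show ?case using g(2) by (intro exI[of _ h]) auto
qed

text \<open>On the circle \<open>|w| = \<rho>\<close> one has \<open>w\<^sup>2 - \<rho>\<^sup>2 = 2\<i> w Im w\<close>, so that multiplying by this factor
  cancels the singularity of the bound on the real axis.\<close>

lemma circle_factor_bound:
  fixes f :: "complex \<Rightarrow> complex" and \<rho> :: real
  assumes "\<And>w. 0 < cmod w \<Longrightarrow> cmod w < r \<Longrightarrow> Im w \<noteq> 0 \<Longrightarrow> cmod (f w) \<le> C * sqrt (cmod w) / \<bar>Im w\<bar>"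
    and "cmod w = \<rho>" "0 < \<rho>" "\<rho> < r" "C \<ge> 0"
  shows "cmod (f w * (w\<^sup>2 - of_real (\<rho>\<^sup>2))) \<le> 2 * C * \<rho> * sqrt \<rho>"
proof (cases "Im w = 0")
  case True
  then have "w\<^sup>2 = of_real (\<rho>\<^sup>2)"
    using assms(2) by (metis cmod_eq_Re complex_eq_iff complex_of_real_def of_real_power power2_abs
        Re_complex_of_real Im_complex_of_real)
  then show ?thesis using assms by simp
next
  case False
  have "w\<^sup>2 - of_real (\<rho>\<^sup>2) = 2 * \<i> * w * of_real (Im w)"
    unfolding assms(2)[symmetric] cmod_power2
    by (simp add: complex_eq_iff power2_eq_square algebra_simps)
  then have "cmod (w\<^sup>2 - of_real (\<rho>\<^sup>2)) = 2 * \<rho> * \<bar>Im w\<bar>"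
    using assms(2) by (simp add: norm_mult)
  moreover have "cmod (f w) \<le> C * sqrt \<rho> / \<bar>Im w\<bar>" using assms(1)[of w] assms False by simp
  ultimately have "cmod (f w * (w\<^sup>2 - of_real (\<rho>\<^sup>2))) \<le> C * sqrt \<rho> / \<bar>Im w\<bar> * (2 * \<rho> * \<bar>Im w\<bar>)"
    unfolding norm_mult by (metis abs_ge_zero mult_right_mono norm_ge_zero)
  also have "\<dots> = 2 * C * \<rho> * sqrt \<rho>" using False by simp
  finally show ?thesis .
qed

lemma cmod_square_diff:
  fixes s :: real
  shows "cmod (z\<^sup>2 - of_real (s\<^sup>2)) \<le> (cmod z)\<^sup>2 + s\<^sup>2"
    and "\<bar>(cmod z)\<^sup>2 - s\<^sup>2\<bar> \<le> cmod (z\<^sup>2 - of_real (s\<^sup>2))"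
  using norm_triangle_ineq4[of "z\<^sup>2" "of_real (s\<^sup>2)"] norm_triangle_ineq3[of "z\<^sup>2" "of_real (s\<^sup>2)"]
  by (simp_all add: norm_power)

text \<open>The hypothesis is void on the real axis. Around w take the annulus t/2 \<le> |z| \<le>
  2t with t = |w| and multiply \<open>f\<close> by the factors of \<open>circle_factor_bound\<close>
  for both radii. The product is bounded on both circles, hence at w, where the two factors are
  bounded below.\<close>

lemma edge_growth_bound:
  fixes f :: "complex \<Rightarrow> complex"
  assumes hol: "f holomorphic_on ball 0 r - {0}" and C: "C \<ge> 0"
    and bd: "\<And>w. 0 < cmod w \<Longrightarrow> cmod w < r \<Longrightarrow> Im w \<noteq> 0 \<Longrightarrow> cmod (f w) \<le> C * sqrt (cmod w) / \<bar>Im w\<bar>"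
    and w: "0 < cmod w" "2 * cmod w < r"
  shows "cmod (w * f w) \<le> 15 * C * sqrt (2 * cmod w)"
proof -
  define t where "t = cmod w"
  have t: "t > 0" "2 * t < r" using w by (auto simp: t_def)
  define A where "A = cball (0::complex) (2 * t) - ball 0 (t / 2)"
  define F where "F z = f z * (z\<^sup>2 - of_real ((t/2)\<^sup>2)) * (z\<^sup>2 - of_real ((2*t)\<^sup>2))" for z
  have Asub: "A \<subseteq> ball 0 r - {0}" using t by (auto simp: A_def)
  have clA: "closed A" unfolding A_def by (intro closed_Diff) auto
  have holF: "F holomorphic_on ball 0 r - {0}" unfolding F_def by (intro holomorphic_intros hol)
  \<comment> \<open>The product of 2 C (2t) sqrt(2t), from \<open>circle_factor_bound\<close>, and
    the generous bound 8 t^2 for the factor belonging to the other circle.\<close>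
  have "cmod (F w) \<le> 32 * C * t ^ 3 * sqrt (2 * t)"
  proof (rule maximum_modulus_frontier[of F A])
    show "F holomorphic_on interior A"
      using holF Asub interior_subset holomorphic_on_subset by (metis order_trans)
    show "continuous_on (closure A) F"
      using holF Asub clA by (metis closure_closed continuous_on_subset holomorphic_on_imp_continuous_on)
    show "bounded A" unfolding A_def by (rule bounded_diff) simp
    show "w \<in> A" using t by (simp add: A_def t_def)
    fix z assume z: "z \<in> frontier A"
    have "ball 0 (2 * t) - cball 0 (t / 2) \<subseteq> interior A"
      by (rule interior_maximal) (auto simp: A_def intro!: open_Diff)
    then have "z \<in> A" "z \<notin> ball 0 (2 * t) - cball 0 (t / 2)"
      using z clA by (auto simp: frontier_def)
    then have "cmod z = 2 * t \<or> cmod z = t / 2" by (auto simp: A_def)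
    then show "cmod (F z) \<le> 32 * C * t ^ 3 * sqrt (2 * t)"
    proof
      assume zt: "cmod z = 2 * t"
      have "cmod (f z * (z\<^sup>2 - of_real ((2*t)\<^sup>2))) \<le> 2 * C * (2*t) * sqrt (2*t)"
        by (rule circle_factor_bound[OF bd zt]) (use t C in auto)
      moreover have "cmod (z\<^sup>2 - of_real ((t/2)\<^sup>2)) \<le> 8 * t\<^sup>2"
        using cmod_square_diff(1)[of z "t/2"]
        unfolding zt power_mult_distrib power_divide by (simp, (insert zero_le_power2[of t], linarith)?)
      ultimately have "cmod (f z * (z\<^sup>2 - of_real ((2*t)\<^sup>2))) * cmod (z\<^sup>2 - of_real ((t/2)\<^sup>2))
          \<le> (2 * C * (2*t) * sqrt (2*t)) * (8 * t\<^sup>2)"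
        using C t by (intro mult_mono) auto
      moreover have "F z = (f z * (z\<^sup>2 - of_real ((2*t)\<^sup>2))) * (z\<^sup>2 - of_real ((t/2)\<^sup>2))"
        by (simp add: F_def mult_ac)
      ultimately show ?thesis by (simp add: norm_mult power2_eq_square power3_eq_cube mult_ac)
    next
      assume zt: "cmod z = t / 2"
      have "cmod (f z * (z\<^sup>2 - of_real ((t/2)\<^sup>2))) \<le> 2 * C * (t/2) * sqrt (t/2)"
        by (rule circle_factor_bound[OF bd zt]) (use t C in auto)
      also have "\<dots> \<le> 2 * C * (2*t) * sqrt (2*t)"
        using C t by (intro mult_mono) auto
      finally have "cmod (f z * (z\<^sup>2 - of_real ((t/2)\<^sup>2))) \<le> 2 * C * (2*t) * sqrt (2*t)" .
      moreover have "cmod (z\<^sup>2 - of_real ((2*t)\<^sup>2)) \<le> 8 * t\<^sup>2"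
        using cmod_square_diff(1)[of z "2*t"]
        unfolding zt power_mult_distrib power_divide by (simp, (insert zero_le_power2[of t], linarith)?)
      ultimately have "cmod (f z * (z\<^sup>2 - of_real ((t/2)\<^sup>2))) * cmod (z\<^sup>2 - of_real ((2*t)\<^sup>2))
          \<le> (2 * C * (2*t) * sqrt (2*t)) * (8 * t\<^sup>2)"
        using C t by (intro mult_mono) auto
      moreover have "F z = (f z * (z\<^sup>2 - of_real ((t/2)\<^sup>2))) * (z\<^sup>2 - of_real ((2*t)\<^sup>2))"
        by (simp add: F_def)
      ultimately show ?thesis by (simp add: norm_mult power2_eq_square power3_eq_cube mult_ac)
    qed
  qed
  moreover have "cmod (w\<^sup>2 - of_real ((t/2)\<^sup>2)) \<ge> 3/4 * t\<^sup>2"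
    using cmod_square_diff(2)[of w "t/2"]
    unfolding t_def[symmetric] power_mult_distrib power_divide by (simp, (insert zero_le_power2[of t], linarith)?)
  moreover have "cmod (w\<^sup>2 - of_real ((2*t)\<^sup>2)) \<ge> 3 * t\<^sup>2"
    using cmod_square_diff(2)[of w "2*t"]
    unfolding t_def[symmetric] power_mult_distrib power_divide by (simp, (insert zero_le_power2[of t], linarith)?)
  \<comment> \<open>Dividing by 3/4 t^2 times 3 t^2 leaves the constant 32 / (9/4) = 128/9, which is
    rounded up to 15.\<close>
  ultimately have "cmod (f w) * (3/4 * t\<^sup>2) * (3 * t\<^sup>2) \<le> 32 * C * t ^ 3 * sqrt (2 * t)"
    unfolding F_def norm_mult
    by (elim order_trans[rotated]) (intro mult_mono, auto)
  then have "(t ^ 3 * (9 / 4)) * (t * cmod (f w)) \<le> (t ^ 3 * (9/4)) * (128 / 9 * C * sqrt (2 * t))"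
    by (simp add: power2_eq_square power3_eq_cube mult_ac)
  then have "t * cmod (f w) \<le> 128 / 9 * C * sqrt (2 * t)"
    using t by (subst (asm) mult_le_cancel_left_pos) auto
  also have "\<dots> \<le> 15 * C * sqrt (2 * t)" using C t by (intro mult_right_mono) auto
  finally show ?thesis by (simp add: norm_mult t_def)
qed

lemma edge_removable:
  fixes f :: "complex \<Rightarrow> complex" and e :: real
  assumes hol: "f holomorphic_on ball (of_real e) r - {of_real e}" and C: "C \<ge> 0" and r: "r > 0"
    and bd: "\<And>z. z \<in> ball (of_real e) r \<Longrightarrow> Im z \<noteq> 0 \<Longrightarrow>
      cmod (f z) \<le> C * sqrt (cmod (z - of_real e)) / \<bar>Im z\<bar>"
  shows "((\<lambda>z. (z - of_real e) * f z) \<longlongrightarrow> 0) (at (of_real e))"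
proof (rule Lim_null_comparison)
  define f' where "f' w = f (w + of_real e)" for w
  have hol': "f' holomorphic_on ball 0 r - {0}"
    unfolding f'_def
    by (rule holomorphic_on_compose_gen[OF _ hol, unfolded o_def])
      (auto intro!: holomorphic_intros simp: dist_norm)
  have "((\<lambda>z. 15 * C * sqrt (2 * cmod (z - of_real e))) \<longlongrightarrow> 15 * C * sqrt (2 * cmod (of_real e - of_real e :: complex)))
      (at (of_real e))"
    by (intro tendsto_intros)
  then show "((\<lambda>z. 15 * C * sqrt (2 * cmod (z - of_real e))) \<longlongrightarrow> 0) (at (of_real e))" by simp
  have "cmod ((z - of_real e) * f z) \<le> 15 * C * sqrt (2 * cmod (z - of_real e))"
    if "z \<noteq> of_real e" "dist z (of_real e) < r / 2" for z
  proof -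
    have "cmod ((z - of_real e) * f' (z - of_real e)) \<le> 15 * C * sqrt (2 * cmod (z - of_real e))"
    proof (rule edge_growth_bound[OF hol' C])
      show "cmod (f' w) \<le> C * sqrt (cmod w) / \<bar>Im w\<bar>" if "0 < cmod w" "cmod w < r" "Im w \<noteq> 0" for w
        using bd[of "w + of_real e"] that by (simp add: f'_def dist_norm)
    qed (use that in \<open>auto simp: dist_norm\<close>)
    then show ?thesis by (simp add: f'_def)
  qed
  then show "\<forall>\<^sub>F z in at (of_real e). cmod ((z - of_real e) * f z) \<le> 15 * C * sqrt (2 * cmod (z - of_real e))"
    unfolding eventually_at using r by (intro exI[of _ "r/2"]) auto
qed

text \<open>With principal branches this is continuous on the closed upper half-plane; from the
  lower half-plane only its modulus will be used. The roots are paired by bands because the reality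
  statements hold pair by pair.\<close>

definition edge_root :: "nat set \<Rightarrow> (nat \<Rightarrow> real) \<Rightarrow> (nat \<Rightarrow> real) \<Rightarrow> complex \<Rightarrow> complex" where
  "edge_root I lo hi z = (\<Prod>j\<in>I. csqrt (z - of_real (lo j)) * csqrt (z - of_real (hi j)))"

lemma continuous_on_edge_root: "continuous_on {z. 0 \<le> Im z} (edge_root I lo hi)"
  unfolding edge_root_def
  by (intro continuous_intros continuous_on_compose2[OF continuous_on_csqrt_upper]) auto

lemma holomorphic_edge_root: "edge_root I lo hi holomorphic_on {z. 0 < Im z}"
  unfolding edge_root_def
  by (intro holomorphic_intros) (auto simp: complex_nonpos_Reals_iff)

lemma norm_edge_root:
  "cmod (edge_root I lo hi z) =
    (\<Prod>j\<in>I. sqrt (cmod (z - of_real (lo j))) * sqrt (cmod (z - of_real (hi j))))"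
  unfolding edge_root_def by (simp add: norm_mult flip: prod_norm)

lemma norm_edge_root_cnj: "cmod (edge_root I lo hi (cnj z)) = cmod (edge_root I lo hi z)"
proof -
  have "cmod (cnj z - of_real r) = cmod (z - of_real r)" for r
    by (metis complex_cnj_complex_of_real complex_cnj_diff complex_mod_cnj)
  then show ?thesis by (simp add: norm_edge_root)
qed

lemma csqrt_real_diff:
  fixes x e :: real
  shows "csqrt (of_real x - of_real e) =
    (if x \<ge> e then of_real (sqrt (x - e)) else \<i> * of_real (sqrt (e - x)))"
proof (cases "x \<ge> e")
  case True
  then show ?thesis using of_real_sqrt[of "x - e"] by simp
next
  case False
  then have "csqrt (of_real (x - e)) = \<i> * sqrt \<bar>x - e\<bar>" by (subst csqrt_of_real_nonpos) auto
  then show ?thesis using False by simp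
qed

text \<open>To the right of the band both roots are real, to the left both are imaginary.\<close>

lemma edge_factor_real:
  fixes x :: real
  assumes "l < h" "x \<notin> {l..h}"
  shows "csqrt (of_real x - of_real l) * csqrt (of_real x - of_real h) \<in> \<real>"
  using assms by (auto simp: csqrt_real_diff complex_is_Real_iff)

locale band_edges =
  fixes I :: "nat set" and lo hi :: "nat \<Rightarrow> real" and E :: "real set"
  assumes fin: "finite I" and lohi: "\<And>j. j \<in> I \<Longrightarrow> lo j < hi j"
    and disj: "disjoint_family_on (\<lambda>j. {lo j..hi j}) I"
    and E: "E = (\<Union>j\<in>I. {lo j..hi j})"
begin

abbreviation S where "S \<equiv> edge_root I lo hi"

definition V :: "real set" where "V = lo ` I \<union> hi ` I"

lemma finite_V: "finite V" using fin by (simp add: V_def)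

lemma V_subset_E: "V \<subseteq> E"
proof -
  have "lo j \<in> E" "hi j \<in> E" if "j \<in> I" for j
    unfolding E using lohi[OF that] by (intro UN_I[OF that]; simp)+
  then show ?thesis by (auto simp: V_def)
qed

lemma compact_E: "compact E"
  unfolding E using fin by (intro compact_UN) auto

lemma closed_E_image: "closed (complex_of_real ` E)"
  by (intro compact_imp_closed compact_continuous_image continuous_intros compact_E)

lemma band_unique: "j \<in> I \<Longrightarrow> k \<in> I \<Longrightarrow> x \<in> {lo j..hi j} \<Longrightarrow> x \<in> {lo k..hi k} \<Longrightarrow> j = k"
  using disj unfolding disjoint_family_on_def by blast

lemma edge_root_real_gap: assumes "x \<notin> E" shows "S (of_real x) \<in> \<real>"
  unfolding edge_root_def
  using assms by (intro prod_in_Reals edge_factor_real lohi) (auto simp: E)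

text \<open>Inside band j the j-th pair has one real and one imaginary root, while x lies outside
  every other band, so the remaining pairs are real.\<close>

lemma edge_root_imag_band:
  assumes "j \<in> I" "lo j < x" "x < hi j"
  shows "Re (S (of_real x)) = 0"
proof -
  have 1: "(\<Prod>k\<in>I - {j}. csqrt (of_real x - of_real (lo k)) * csqrt (of_real x - of_real (hi k))) \<in> \<real>"
  proof (intro prod_in_Reals edge_factor_real lohi)
    fix k assume k: "k \<in> I - {j}"
    then show "x \<notin> {lo k..hi k}" using band_unique[OF assms(1), of k x] assms by auto
  qed auto
  have 2: "csqrt (of_real x - of_real (lo j)) * csqrt (of_real x - of_real (hi j)) =
      \<i> * of_real (sqrt (x - lo j) * sqrt (hi j - x))"
    using assms by (simp add: csqrt_real_diff)
  show ?thesis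
    unfolding edge_root_def prod.remove[OF fin assms(1)] 2
    using 1 by (auto simp: complex_is_Real_iff)
qed

text \<open>Disjoint bands of positive length have pairwise distinct endpoints, so passing from
  bands to the set \<open>V\<close> of edges loses no multiplicity.\<close>

lemma prod_edges: "(\<Prod>j\<in>I. f (lo j) * f (hi j)) = (\<Prod>v\<in>V. f v)" for f :: "real \<Rightarrow> real"
proof -
  have injlo: "inj_on lo I" and injhi: "inj_on hi I"
    using band_unique lohi by (auto intro!: inj_onI) (metis atLeastAtMost_iff less_imp_le order_refl)+
  have "lo ` I \<inter> hi ` I = {}"
  proof (rule ccontr)
    assume "lo ` I \<inter> hi ` I \<noteq> {}"
    then obtain j k where jk: "j \<in> I" "k \<in> I" "lo j = hi k" by auto
    then have "j = k" using band_unique[of j k "lo j"] lohi[of j] lohi[of k] by auto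
    then show False using jk lohi[of j] by simp
  qed
  then have "(\<Prod>v\<in>V. f v) = (\<Prod>v\<in>lo ` I. f v) * (\<Prod>v\<in>hi ` I. f v)"
    unfolding V_def using fin by (intro prod.union_disjoint) auto
  then show ?thesis by (simp add: prod.reindex[OF injlo] prod.reindex[OF injhi] prod.distrib)
qed

lemma norm_S: "cmod (S z) = (\<Prod>v\<in>V. sqrt (cmod (z - of_real v)))"
  unfolding norm_edge_root by (rule prod_edges)

lemma norm_S_near_edge:
  assumes "e \<in> V" obtains C where "C \<ge> 0"
    "\<And>z. dist (of_real e) z < 1 \<Longrightarrow> cmod (S z) \<le> C * sqrt (cmod (z - of_real e))"
proof
  define C where "C = (\<Prod>v\<in>V - {e}. sqrt (1 + \<bar>e - v\<bar>))"
  show "C \<ge> 0" unfolding C_def by (intro prod_nonneg) auto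
  fix z assume z: "dist (complex_of_real e) z < 1"
  have "(\<Prod>v\<in>V - {e}. sqrt (cmod (z - of_real v))) \<le> C"
    unfolding C_def
  proof (intro prod_mono conjI real_sqrt_le_mono)
    fix v
    have "cmod (z - of_real v) \<le> cmod (z - of_real e) + cmod (of_real e - of_real v)"
      using norm_triangle_ineq[of "z - of_real e" "of_real e - of_real v"] by simp
    also have "\<dots> \<le> 1 + \<bar>e - v\<bar>"
      using z by (simp add: dist_norm norm_minus_commute flip: of_real_diff)
    finally show "cmod (z - of_real v) \<le> 1 + \<bar>e - v\<bar>" .
  qed auto
  then have "sqrt (cmod (z - of_real e)) * (\<Prod>v\<in>V - {e}. sqrt (cmod (z - of_real v)))
      \<le> sqrt (cmod (z - of_real e)) * C"
    by (intro mult_left_mono) auto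
  then show "cmod (S z) \<le> C * sqrt (cmod (z - of_real e))"
    unfolding norm_S prod.remove[OF finite_V assms] by (simp add: mult.commute)
qed

lemma norm_S_large:
  assumes "cmod z \<le> K" "E \<subseteq> {-K..K}"
  shows "cmod (S z) \<le> sqrt (2 * K) ^ card V"
proof -
  have "cmod (S z) \<le> (\<Prod>v\<in>V. sqrt (2 * K))"
    unfolding norm_S
  proof (intro prod_mono conjI real_sqrt_le_mono)
    fix v assume "v \<in> V"
    then have "\<bar>v\<bar> \<le> K" using V_subset_E assms(2) by fastforce
    then show "cmod (z - of_real v) \<le> 2 * K"
      using norm_triangle_ineq4[of z "of_real v"] assms(1) by simp
  qed auto
  then show ?thesis by simp
qed

text \<open>\<open>G\<close> enters the bound only through \<open>M\<close>, its bound on the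
  circle; this makes the estimate uniform over all Green functions. The hypothesis \<open>bd\<close>
  acts only at the edges, as a growth condition, and its constant does not reach the
  conclusion.\<close>

theorem edge_bound:
  fixes G :: "complex \<Rightarrow> complex" and K M x :: real
  assumes hol: "G holomorphic_on - complex_of_real ` E"
    and pos: "\<And>z. 0 < Im z \<Longrightarrow> 0 < Im (G z)"
    and cnjG: "\<And>z. z \<notin> complex_of_real ` E \<Longrightarrow> G (cnj z) = cnj (G z)"
    and bd: "\<And>z. Im z \<noteq> 0 \<Longrightarrow> cmod (G z) \<le> 1 / \<bar>Im z\<bar>"
    and lim: "AE x in lebesgue. x \<in> E \<longrightarrow>
       ((\<lambda>y. Re (G (of_real x + \<i> * of_real y))) \<longlongrightarrow> 0) (at_right 0)"
    and K: "E \<subseteq> {-K<..<K}" and M: "\<And>z. cmod z = K \<Longrightarrow> cmod (G z) \<le> M"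
    and x: "x \<notin> E" "\<bar>x\<bar> \<le> K"
  shows "cmod (G (of_real x)) * cmod (S (of_real x)) \<le> M * sqrt (2 * K) ^ card V"
proof -
  have upE: "z \<notin> complex_of_real ` E" if "Im z \<noteq> 0" for z using that by auto
  have holU: "G holomorphic_on {z. 0 < Im z}"
    by (rule holomorphic_on_subset[OF hol]) auto
  have opE: "open (- complex_of_real ` E)" using closed_E_image by (simp add: open_Compl)
  \<comment> \<open>\<open>Lim\<close> is meaningful only off the edges, where the limit exists by reflectionlessness.\<close>
  define Gb where "Gb z = (if z \<in> complex_of_real ` E then Lim (at z within {w. 0 < Im w}) G else G z)" for z
  have loc: "\<exists>r>0. \<exists>g. g holomorphic_on ball (of_real x0) r \<and>
      (\<forall>z\<in>ball (of_real x0) r. 0 \<le> Im z \<longrightarrow> Gb z = g z) \<and> Re (g (of_real x0)) = 0"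
    if j: "j \<in> I" "lo j < x0" "x0 < hi j" for j x0
  proof -
    have lim': "AE x in lebesgue. x \<in> {lo j..hi j} \<longrightarrow>
       ((\<lambda>y. Re (G (of_real x + \<i> * of_real y))) \<longlongrightarrow> 0) (at_right 0)"
      using lim by eventually_elim (use j(1) in \<open>auto simp: E\<close>)
    obtain r g where rg: "r > 0" "g holomorphic_on ball (of_real x0) r"
      "\<And>z. z \<in> ball (of_real x0) r \<Longrightarrow> 0 < Im z \<Longrightarrow> g z = G z"
      "\<And>x::real. complex_of_real x \<in> ball (of_real x0) r \<Longrightarrow> Re (g (of_real x)) = 0"
    proof (rule reflectionless_extension[OF holU pos lim' j(2,3)])
      fix r g assume "r > 0" "g holomorphic_on ball (of_real x0) r"
        "\<And>z. z \<in> ball (of_real x0) r \<Longrightarrow> 0 < Im z \<Longrightarrow> g z = G z"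
        "\<And>x::real. complex_of_real x \<in> ball (of_real x0) r \<Longrightarrow> Re (g (of_real x)) = 0"
      then show thesis by (rule that)
    qed
    \<comment> \<open>Shrunk until the real points of the ball lie in band j, where
      \<open>Gb\<close> is defined as the boundary limit.\<close>
    define r' where "r' = min r (min (x0 - lo j) (hi j - x0))"
    have r': "r' > 0" "r' \<le> r" using rg(1) j by (auto simp: r'_def)
    have "Gb z = g z" if z: "z \<in> ball (of_real x0) r'" "0 \<le> Im z" for z
    proof (cases "Im z = 0")
      case False
      then show ?thesis using rg(3)[of z] z r' upE[of z] by (auto simp: Gb_def)
    next
      case True
      then have zr: "z = of_real (Re z)" by (simp add: complex_eq_iff)
      have "\<bar>x0 - Re z\<bar> < r'"
        using z(1) zr unfolding mem_ball dist_norm by (metis norm_of_real of_real_diff)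
      then have "Re z \<in> E" using j(1) by (auto simp: r'_def E intro!: bexI[of _ j])
      then have zE: "z \<in> complex_of_real ` E" using zr by blast
      have zb: "z \<in> ball (of_real x0) r" using z r' by auto
      have "isCont g z"
        using holomorphic_on_imp_continuous_on[OF rg(2)] zb continuous_on_eq_continuous_at open_ball by blast
      then have "(g \<longlongrightarrow> g z) (at z within {w. 0 < Im w})"
        unfolding isCont_def by (rule tendsto_within_subset) auto
      moreover have "\<forall>\<^sub>F w in at z within {w. 0 < Im w}. g w = G w"
        unfolding eventually_at_topological
        by (intro exI[of _ "ball (of_real x0) r"]) (use zb rg(3) in auto)
      ultimately have "(G \<longlongrightarrow> g z) (at z within {w. 0 < Im w})"
        by (rule Lim_transform_eventually)
      moreover have "at z within {w. 0 < Im w} \<noteq> bot"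
      proof -
        have "z \<in> closure {w. 0 < Im w}"
          using closure_halfspace_gt[of \<i> 0] True by simp
        then show ?thesis using True by (simp add: trivial_limit_within islimpt_in_closure)
      qed
      ultimately have "Lim (at z within {w. 0 < Im w}) G = g z" by (intro tendsto_Lim)
      then show ?thesis by (simp add: Gb_def zE)
    qed
    moreover have "g holomorphic_on ball (of_real x0) r'"
      by (rule holomorphic_on_subset[OF rg(2)]) (use r' in auto)
    moreover have "Re (g (of_real x0)) = 0" using rg(1,4) by simp
    ultimately show ?thesis using r' by blast
  qed
  have band: "\<exists>j\<in>I. lo j < x0 \<and> x0 < hi j" if "x0 \<in> E" "x0 \<notin> V" for x0
  proof -
    obtain j where j: "j \<in> I" "lo j \<le> x0" "x0 \<le> hi j" using \<open>x0 \<in> E\<close> by (auto simp: E)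
    moreover have "x0 \<noteq> lo j" "x0 \<noteq> hi j" using j(1) \<open>x0 \<notin> V\<close> by (auto simp: V_def)
    ultimately show ?thesis by force
  qed
  define V' where "V' = complex_of_real ` V"
  have finV': "finite V'" using finite_V by (simp add: V'_def)
  have opV': "open (- V')" using finV' by (simp add: finite_imp_closed open_Compl)
  define Q where "Q z = Gb z * S z" for z
  define D where "D = - V' \<inter> {z. 0 \<le> Im z}"
  have contGb: "continuous (at z within D) Gb" if z: "z \<in> D" for z
  proof (cases "z \<in> complex_of_real ` E")
    case False
    have "continuous (at z within D) G"
      using holomorphic_on_imp_continuous_on[OF hol] False opE
      by (meson ComplI continuous_at_imp_continuous_within continuous_on_eq_continuous_at)
    moreover obtain d where d: "d > 0" "ball z d \<subseteq> - complex_of_real ` E"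
      using False opE openE[of "- complex_of_real ` E" z] by blast
    ultimately show ?thesis
    proof (rule_tac continuous_transform_within[of z D G d])
      show "G w = Gb w" if "w \<in> D" "dist w z < d" for w
        using that d(2) by (auto simp: Gb_def dist_commute subset_iff)
    qed (use z in auto)
  next
    case True
    then obtain x0 where x0: "z = of_real x0" "x0 \<in> E" by blast
    then have "x0 \<notin> V" using z by (auto simp: D_def V'_def)
    then obtain j where j: "j \<in> I" "lo j < x0" "x0 < hi j" using band x0 by blast
    obtain r g where rg: "r > 0" "g holomorphic_on ball (of_real x0) r"
      "\<And>z. z \<in> ball (of_real x0) r \<Longrightarrow> 0 \<le> Im z \<Longrightarrow> Gb z = g z"
      using loc[OF j] by blast
    have "continuous (at z) g"
      using holomorphic_on_imp_continuous_on[OF rg(2)] x0 rg(1)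
      by (simp add: continuous_on_eq_continuous_at)
    then have "continuous (at z within D) g" by (rule continuous_at_imp_continuous_within)
    then show ?thesis
      by (rule continuous_transform_within[OF _ rg(1) z])
        (use rg(3) x0 in \<open>auto simp: D_def dist_commute\<close>)
  qed
  have contQ: "continuous_on D Q"
    unfolding Q_def
  proof (intro continuous_on_mult)
    show "continuous_on D Gb" using contGb continuous_on_eq_continuous_within by blast
    show "continuous_on D S" by (rule continuous_on_subset[OF continuous_on_edge_root]) (auto simp: D_def)
  qed
  have realQ: "Q z \<in> \<real>" if z: "z \<in> - V'" "z \<in> \<real>" for z
  proof -
    obtain t where t: "z = of_real t" using z(2) Reals_cases by blast
    have tV: "t \<notin> V" using z t by (auto simp: V'_def)
    show ?thesis
    proof (cases "t \<in> E")
      case False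
      then have "z \<notin> complex_of_real ` E" using t by auto
      then have "G z \<in> \<real>" using cnjG[of z] t by (simp add: Reals_cnj_iff)
      then show ?thesis
        using edge_root_real_gap[OF False] False t \<open>z \<notin> _\<close> by (simp add: Q_def Gb_def Reals_mult)
    next
      case True
      then obtain j where j: "j \<in> I" "lo j < t" "t < hi j" using band tV by blast
      obtain r g where rg: "r > 0" "\<And>z. z \<in> ball (of_real t) r \<Longrightarrow> 0 \<le> Im z \<Longrightarrow> Gb z = g z"
        "Re (g (of_real t)) = 0"
        using loc[OF j] by blast
      have "Re (Gb z) = 0" using rg t by simp
      moreover have "Re (S z) = 0" using edge_root_imag_band[OF j] t by simp
      ultimately show ?thesis by (simp add: Q_def complex_is_Real_iff)
    qed
  qed
  define Qs where "Qs z = (if 0 \<le> Im z then Q z else cnj (Q (cnj z)))" for z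
  have holQs: "Qs holomorphic_on - V'"
    unfolding Qs_def
  proof (rule Schwarz_reflection[OF opV'])
    show "cnj ` (- V') \<subseteq> - V'" by (auto simp: V'_def) (metis complex_cnj_cnj complex_cnj_complex_of_real imageI)
    show "Q holomorphic_on - V' \<inter> {z. 0 < Im z}"
    proof (rule holomorphic_transform[of "\<lambda>z. G z * S z"])
      show "(\<lambda>z. G z * S z) holomorphic_on - V' \<inter> {z. 0 < Im z}"
        by (intro holomorphic_on_mult holomorphic_on_subset[OF holU]
            holomorphic_on_subset[OF holomorphic_edge_root]) auto
    qed (use upE in \<open>auto simp: Q_def Gb_def\<close>)
    show "continuous_on (- V' \<inter> {z. 0 \<le> Im z}) Q" using contQ by (simp add: D_def)
  qed (rule realQ)
  have bdQs: "cmod (Qs z) \<le> cmod (S z) / \<bar>Im z\<bar>" if "Im z \<noteq> 0" for z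
  proof -
    have "cmod (Qs z) = cmod (G (if 0 \<le> Im z then z else cnj z)) * cmod (S z)"
      using that upE[of z] upE[of "cnj z"]
      by (simp add: Qs_def Q_def Gb_def norm_mult norm_edge_root_cnj)
    also have "\<dots> \<le> 1 / \<bar>Im z\<bar> * cmod (S z)"
      using bd[of z] bd[of "cnj z"] that by (intro mult_right_mono) auto
    finally show ?thesis by simp
  qed
  \<comment> \<open>Near an edge, |G| \<le> 1/|Im z| and \<open>S\<close> is O(sqrt|z - e|), which
    is the growth condition of \<open>edge_removable\<close>.\<close>
  have rem: "((\<lambda>z. (z - k) * Qs z) \<longlongrightarrow> 0) (at k)" if kV: "k \<in> V'" for k
  proof -
    obtain e where e: "k = of_real e" "e \<in> V" using kV by (auto simp: V'_def)
    obtain C where C: "C \<ge> 0"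
      "\<And>z. dist (of_real e) z < 1 \<Longrightarrow> cmod (S z) \<le> C * sqrt (cmod (z - of_real e))"
      using norm_S_near_edge[OF e(2)] by blast
    have "open (- (V' - {k}))" by (intro open_Compl finite_imp_closed finite_Diff finV')
    then obtain d where d: "d > 0" "ball k d \<subseteq> - (V' - {k})"
      using openE[of "- (V' - {k})" k] by blast
    define r where "r = min d 1"
    show ?thesis unfolding e(1)
    proof (rule edge_removable[of _ _ r C])
      show "Qs holomorphic_on ball (of_real e) r - {of_real e}"
        by (rule holomorphic_on_subset[OF holQs]) (use d e in \<open>auto simp: r_def subset_iff\<close>)
      show "cmod (Qs z) \<le> C * sqrt (cmod (z - of_real e)) / \<bar>Im z\<bar>"
        if "z \<in> ball (of_real e) r" "Im z \<noteq> 0" for z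
      proof -
        have "cmod (Qs z) \<le> cmod (S z) / \<bar>Im z\<bar>" by (rule bdQs[OF that(2)])
        also have "\<dots> \<le> C * sqrt (cmod (z - of_real e)) / \<bar>Im z\<bar>"
          using C(2)[of z] that by (intro divide_right_mono) (auto simp: r_def)
        finally show ?thesis .
      qed
    qed (use C d in \<open>auto simp: r_def\<close>)
  qed
  obtain H where H: "H holomorphic_on UNIV" "\<And>z. z \<notin> V' \<Longrightarrow> H z = Qs z"
    using holomorphic_finite_removable[OF finV' holQs rem] by blast
  have VE: "V' \<subseteq> complex_of_real ` E" using V_subset_E by (auto simp: V'_def)
  \<comment> \<open>Since \<open>E\<close> lies in the open interval (-K, K), the circle misses it
    even at its two real points, so only genuine values of \<open>G\<close> occur here.\<close>
  have sphere: "cmod (H z) \<le> M * sqrt (2 * K) ^ card V" if z: "cmod z = K" for z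
  proof -
    define w where "w = (if 0 \<le> Im z then z else cnj z)"
    have w: "cmod w = K" "0 \<le> Im w" using z by (auto simp: w_def)
    have notE: "w \<notin> complex_of_real ` E" "z \<notin> complex_of_real ` E"
      using K w(1) z by (auto, force+)
    have "cmod (H z) = cmod (Q w)"
      using H(2)[OF contra_subsetD[OF VE notE(2)]] by (auto simp: Qs_def w_def)
    also have "\<dots> = cmod (G w) * cmod (S w)" using notE by (simp add: Q_def Gb_def norm_mult)
    also have "\<dots> \<le> M * sqrt (2 * K) ^ card V"
      using M[OF w(1)] norm_S_large[of w K] w order_trans[OF K greaterThanLessThan_subseteq_atLeastAtMost_iff[THEN iffD2]]
      by (intro mult_mono) (auto intro: order_trans[OF norm_ge_zero])
    finally show ?thesis .
  qed
  have "cmod (H (of_real x)) \<le> M * sqrt (2 * K) ^ card V"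
  proof (rule maximum_modulus_frontier[of H "cball 0 K"])
    show "H holomorphic_on interior (cball 0 K)" using H(1) holomorphic_on_subset by blast
    show "continuous_on (closure (cball 0 K)) H"
      using holomorphic_on_imp_continuous_on[OF H(1)] continuous_on_subset by blast
    show "cmod (H z) \<le> M * sqrt (2 * K) ^ card V" if "z \<in> frontier (cball 0 K)" for z
      using sphere[of z] that frontier_cball[of "0::complex" K] by simp
  qed (use x in auto)
  moreover have notE: "complex_of_real x \<notin> complex_of_real ` E" using x by auto
  then have "H (of_real x) = G (of_real x) * S (of_real x)"
    using H(2)[OF contra_subsetD[OF VE notE]] notE by (simp add: Qs_def Q_def Gb_def)
  ultimately show ?thesis by (simp add: norm_mult)
qed

end

subsection \<open>Counting spectral points in a gap\<close>

text \<open>Orthonormality will be needed for the form of \<open>B\<close>, which is not the inner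
  product of the type; hence Bessel and Gram-Schmidt for an arbitrary form. Definiteness is asked
  for only in \<open>gram_schmidt\<close>, and only on the span.\<close>

locale inner_form =
  fixes \<beta> :: "'a::real_vector \<Rightarrow> 'a \<Rightarrow> real"
  assumes sym: "\<beta> u v = \<beta> v u" and lin: "linear (\<beta> u)" and nonneg: "0 \<le> \<beta> u u"
begin

lemma form_simps:
  "\<beta> u (v + w) = \<beta> u v + \<beta> u w" "\<beta> u (v - w) = \<beta> u v - \<beta> u w"
  "\<beta> u (r *\<^sub>R v) = r * \<beta> u v" "\<beta> u (\<Sum>x\<in>X. f x) = (\<Sum>x\<in>X. \<beta> u (f x))"
  "\<beta> (v + w) u = \<beta> v u + \<beta> w u" "\<beta> (v - w) u = \<beta> v u - \<beta> w u"
  "\<beta> (r *\<^sub>R v) u = r * \<beta> v u" "\<beta> (\<Sum>x\<in>X. f x) u = (\<Sum>x\<in>X. \<beta> (f x) u)"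
  using linear_add[OF lin] linear_diff[OF lin] linear_scale[OF lin] linear_sum[OF lin]
  by (simp_all add: sym[of _ u])

definition orthonormal :: "'a set \<Rightarrow> bool" where
  "orthonormal T \<longleftrightarrow> (\<forall>s\<in>T. \<forall>t\<in>T. \<beta> s t = (if s = t then 1 else 0))"

lemma form_orthogonal_residual:
  assumes "finite T" "orthonormal T" "t \<in> T"
  shows "\<beta> t (w - (\<Sum>s\<in>T. \<beta> s w *\<^sub>R s)) = 0"
proof -
  have "\<beta> t (\<Sum>s\<in>T. \<beta> s w *\<^sub>R s) = (\<Sum>s\<in>T. if t = s then \<beta> s w else 0)"
    unfolding form_simps using assms(2,3) by (intro sum.cong) (auto simp: orthonormal_def)
  then show ?thesis using assms by (simp add: form_simps)
qed

lemma bessel: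
  assumes "finite T" "orthonormal T"
  shows "(\<Sum>t\<in>T. (\<beta> t w)\<^sup>2) \<le> \<beta> w w"
proof -
  define z where "z = w - (\<Sum>s\<in>T. \<beta> s w *\<^sub>R s)"
  have "\<beta> (\<Sum>s\<in>T. \<beta> s w *\<^sub>R s) z = 0"
    unfolding form_simps using form_orthogonal_residual[OF assms] by (simp add: z_def)
  \<comment> \<open>Only the first argument is expanded: the second stays \<open>z\<close>, to which
    the span of \<open>T\<close> is orthogonal.\<close>
  then have "\<beta> z z = \<beta> w z" unfolding z_def[THEN arg_cong[of _ _ "\<lambda>v. \<beta> v z"]]
    by (simp add: form_simps)
  also have "\<dots> = \<beta> w w - (\<Sum>t\<in>T. \<beta> t w * \<beta> w t)"
    unfolding z_def by (simp add: form_simps)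
  also have "(\<Sum>t\<in>T. \<beta> t w * \<beta> w t) = (\<Sum>t\<in>T. (\<beta> t w)\<^sup>2)"
    unfolding power2_eq_square using sym by (intro sum.cong) auto
  finally show ?thesis using nonneg[of z] by simp
qed

lemma gram_schmidt:
  assumes "finite S" "independent S" "\<And>v. v \<in> span S \<Longrightarrow> v \<noteq> 0 \<Longrightarrow> 0 < \<beta> v v"
  shows "\<exists>T. finite T \<and> card T = card S \<and> T \<subseteq> span S \<and> orthonormal T"
  using assms
proof (induction S rule: finite_induct)
  case empty
  then show ?case by (intro exI[of _ "{}"]) (auto simp: orthonormal_def)
next
  case (insert u S)
  have sub: "span S \<subseteq> span (insert u S)" by (rule span_mono) auto
  have indS: "independent S" using insert.prems(1) independent_mono by blast
  with insert.IH insert.prems sub obtain T where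
    T: "finite T" "card T = card S" "T \<subseteq> span S" "orthonormal T" by blast
  define w where "w = u - (\<Sum>s\<in>T. \<beta> s u *\<^sub>R s)"
  have sumS: "(\<Sum>s\<in>T. \<beta> s u *\<^sub>R s) \<in> span S"
    using T(3) by (intro span_sum span_scale) auto
  have wspan: "w \<in> span (insert u S)"
    unfolding w_def using sumS sub by (intro span_diff) (auto intro: span_base)
  have "w \<noteq> 0"
  proof
    assume "w = 0"
    then have "u \<in> span S" using sumS by (simp add: w_def)
    then show False using insert.prems(1) insert.hyps(2) independent_insert[of u S] by auto
  qed
  then have pos: "0 < \<beta> w w" using insert.prems(2) wspan by blast
  define e where "e = (1 / sqrt (\<beta> w w)) *\<^sub>R w"
  have ee: "\<beta> e e = 1" using pos by (simp add: e_def form_simps)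
  have te: "\<beta> t e = 0" if "t \<in> T" for t
    using form_orthogonal_residual[OF T(1,4) that, of u] by (simp add: e_def form_simps w_def)
  have "e \<notin> T" using te[of e] ee by auto
  moreover have "orthonormal (insert e T)"
    using T(4) ee te te[unfolded sym[of _ e]] \<open>e \<notin> T\<close> by (auto simp: orthonormal_def)
  moreover have "insert e T \<subseteq> span (insert u S)"
    using T(3) sub wspan by (auto simp: e_def intro: span_scale)
  ultimately show ?case
    using T insert.hyps by (intro exI[of _ "insert e T"]) auto
qed

end

lemma norm_almost_orthonormal:
  fixes u :: "'i \<Rightarrow> 'a::real_inner"
  assumes "finite L" "\<And>i j. i \<in> L \<Longrightarrow> j \<in> L \<Longrightarrow> \<bar>u i \<bullet> u j - (if i = j then 1 else 0)\<bar> \<le> \<tau>"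
  shows "\<bar>(norm (\<Sum>i\<in>L. d i *\<^sub>R u i))\<^sup>2 - (\<Sum>i\<in>L. (d i)\<^sup>2)\<bar> \<le> \<tau> * (\<Sum>i\<in>L. \<bar>d i\<bar>)\<^sup>2"
proof -
  have diag: "(\<Sum>i\<in>L. (d i)\<^sup>2) = (\<Sum>i\<in>L. \<Sum>j\<in>L. d i * d j * (if i = j then 1 else 0))"
    using assms(1) by (simp add: if_distrib power2_eq_square cong: if_cong)
  have "(norm (\<Sum>i\<in>L. d i *\<^sub>R u i))\<^sup>2 = (\<Sum>i\<in>L. \<Sum>j\<in>L. d i * d j * (u i \<bullet> u j))"
    unfolding power2_norm_eq_inner
    by (simp add: inner_sum_left inner_sum_right sum_distrib_left inner_commute mult_ac)
  then have "(norm (\<Sum>i\<in>L. d i *\<^sub>R u i))\<^sup>2 - (\<Sum>i\<in>L. (d i)\<^sup>2) =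
      (\<Sum>i\<in>L. \<Sum>j\<in>L. d i * d j * (u i \<bullet> u j - (if i = j then 1 else 0)))"
    unfolding diag by (simp only: right_diff_distrib sum_subtractf)
  also have "\<bar>\<dots>\<bar> \<le> (\<Sum>i\<in>L. \<Sum>j\<in>L. \<bar>d i\<bar> * \<bar>d j\<bar> * \<tau>)"
  proof (intro order_trans[OF sum_abs] sum_mono)
    fix i j assume "i \<in> L" "j \<in> L"
    then show "\<bar>d i * d j * (u i \<bullet> u j - (if i = j then 1 else 0))\<bar> \<le> \<bar>d i\<bar> * \<bar>d j\<bar> * \<tau>"
      unfolding abs_mult by (intro mult_left_mono assms(2)) auto
  qed
  also have "\<dots> = \<tau> * (\<Sum>i\<in>L. \<bar>d i\<bar>)\<^sup>2"
    by (simp add: power2_eq_square sum_distrib_left sum_distrib_right mult_ac)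
  finally show ?thesis .
qed

lemma sum_abs_square_le:
  fixes c :: "'i \<Rightarrow> real"
  shows "(\<Sum>i\<in>L. \<bar>c i\<bar>)\<^sup>2 \<le> real (card L) * (\<Sum>i\<in>L. (c i)\<^sup>2)"
  using sum_squared_le_sum_of_squares[of "\<lambda>i. \<bar>c i\<bar>" L] by (simp add: mult.commute)

text \<open>At \<epsilon> = 0 the inequalities read 0 < 1 and r^2 < r^2 + \<eta>, so they persist
  for small \<epsilon>. In the application 2\<epsilon>/\<delta> bounds the deviation of a Gram
  matrix from the identity.\<close>

lemma small_epsilon:
  fixes r \<eta> \<delta> N :: real
  assumes "\<eta> > 0"
  obtains \<epsilon> where "\<epsilon> > 0" "(2 * \<epsilon> / \<delta>) * N < 1"
    "(r * sqrt (1 + (2 * \<epsilon> / \<delta>) * N) + \<epsilon> * N)\<^sup>2 < (r\<^sup>2 + \<eta>) * (1 - (2 * \<epsilon> / \<delta>) * N)"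
proof -
  have "((\<lambda>\<epsilon>. (2 * \<epsilon> / \<delta>) * N) \<longlongrightarrow> (2 * 0 / \<delta>) * N) (at_right 0)"
    unfolding divide_inverse by (intro tendsto_intros)
  then have 1: "\<forall>\<^sub>F \<epsilon> in at_right 0. (2 * \<epsilon> / \<delta>) * N < 1" by (rule order_tendstoD) simp
  have "((\<lambda>\<epsilon>. (r\<^sup>2 + \<eta>) * (1 - (2 * \<epsilon> / \<delta>) * N) - (r * sqrt (1 + (2 * \<epsilon> / \<delta>) * N) + \<epsilon> * N)\<^sup>2) \<longlongrightarrow>
     (r\<^sup>2 + \<eta>) * (1 - (2 * 0 / \<delta>) * N) - (r * sqrt (1 + (2 * 0 / \<delta>) * N) + 0 * N)\<^sup>2) (at_right 0)"
    unfolding divide_inverse by (intro tendsto_intros)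
  then have "\<forall>\<^sub>F \<epsilon> in at_right 0.
     0 < (r\<^sup>2 + \<eta>) * (1 - (2 * \<epsilon> / \<delta>) * N) - (r * sqrt (1 + (2 * \<epsilon> / \<delta>) * N) + \<epsilon> * N)\<^sup>2"
    by (rule order_tendstoD) (use assms in simp)
  with 1 eventually_at_right_less[of "0::real"]
  have "\<forall>\<^sub>F \<epsilon> in at_right 0. \<epsilon> > 0 \<and> (2 * \<epsilon> / \<delta>) * N < 1 \<and>
     (r * sqrt (1 + (2 * \<epsilon> / \<delta>) * N) + \<epsilon> * N)\<^sup>2 < (r\<^sup>2 + \<eta>) * (1 - (2 * \<epsilon> / \<delta>) * N)"
    by eventually_elim auto
  then show ?thesis using that eventually_happens[of _ "at_right (0::real)"] by auto
qed

text \<open>Orthonormal eigenvectors would give the bound r^2. Symmetry of J makes approximate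
  eigenvectors at separated points almost orthogonal, so the same computation works up to an
  arbitrarily small \<eta>, whatever the type of the spectrum.\<close>

lemma approximate_spectral_subspace:
  fixes L :: "real set" and m r \<eta> :: real
  assumes jp: "jacobi_parameters a b" and L: "finite L" "\<And>x. x \<in> L \<Longrightarrow> \<bar>x - m\<bar> \<le> r"
    and spec: "\<And>x. x \<in> L \<Longrightarrow> complex_of_real x \<in> l2_spectrum (jacobi_operator a b)"
    and "\<eta> > 0" "r > 0"
  obtains S where "finite S" "card S = card L" "independent S"
    "\<And>v. v \<in> span S \<Longrightarrow> (norm (jsh a b (of_real m) v))\<^sup>2 \<le> (r\<^sup>2 + \<eta>) * (norm v)\<^sup>2"
proof -
  define N where "N = real (card L)"
  \<comment> \<open>The least distance between points of \<open>L\<close>, capped at 1; the inserted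
    1 also covers sets with fewer than two points.\<close>
  define \<delta> where "\<delta> = Min (insert 1 {\<bar>x - y\<bar> | x y. x \<in> L \<and> y \<in> L \<and> x \<noteq> y})"
  have "{\<bar>x - y\<bar> | x y. x \<in> L \<and> y \<in> L \<and> x \<noteq> y} \<subseteq> (\<lambda>(x, y). \<bar>x - y\<bar>) ` (L \<times> L)" by auto
  then have finD: "finite {\<bar>x - y\<bar> | x y. x \<in> L \<and> y \<in> L \<and> x \<noteq> y}"
    by (rule finite_subset) (use L(1) in auto)
  have \<delta>: "\<delta> > 0" unfolding \<delta>_def using finD by (subst Min_gr_iff) auto
  have \<delta>le: "\<delta> \<le> \<bar>x - y\<bar>" if "x \<in> L" "y \<in> L" "x \<noteq> y" for x y
    unfolding \<delta>_def using finD that by (intro Min_le) auto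
  obtain \<epsilon> where \<epsilon>: "\<epsilon> > 0" "(2 * \<epsilon> / \<delta>) * N < 1"
    "(r * sqrt (1 + (2 * \<epsilon> / \<delta>) * N) + \<epsilon> * N)\<^sup>2 < (r\<^sup>2 + \<eta>) * (1 - (2 * \<epsilon> / \<delta>) * N)"
    by (rule small_epsilon[OF \<open>\<eta> > 0\<close>])
  define \<tau> where "\<tau> = 2 * \<epsilon> / \<delta>"
  have \<tau>: "\<tau> > 0" using \<epsilon> \<delta> by (simp add: \<tau>_def)
  have "\<exists>u. norm u = 1 \<and> norm (jsh a b (of_real x) u) < \<epsilon>" if "x \<in> L" for x
    using approximate_eigenvector[OF jp spec[OF that] \<epsilon>(1)] by metis
  then obtain u where u: "\<And>x. x \<in> L \<Longrightarrow> norm (u x) = 1" "\<And>x. x \<in> L \<Longrightarrow> norm (jsh a b (of_real x) (u x)) < \<epsilon>"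
    by metis
  have near: "\<bar>u x \<bullet> u y - (if x = y then 1 else 0)\<bar> \<le> \<tau>" if xy: "x \<in> L" "y \<in> L" for x y
  proof (cases "x = y")
    case True
    then show ?thesis using u(1)[OF xy(1)] \<tau> by (simp flip: power2_norm_eq_inner)
  next
    case False
    have "(y - x) * (u x \<bullet> u y) = jsh a b (of_real x) (u x) \<bullet> u y - u x \<bullet> jsh a b (of_real y) (u y)"
      by (simp add: jsh_def inner_diff_left inner_diff_right jop_symmetric[OF jp] cscale_of_real algebra_simps)
    also have "\<bar>\<dots>\<bar> \<le> norm (jsh a b (of_real x) (u x)) * norm (u y) + norm (u x) * norm (jsh a b (of_real y) (u y))"
      by (intro order_trans[OF abs_triangle_ineq4] add_mono Cauchy_Schwarz_ineq2)
    also have "\<dots> \<le> 2 * \<epsilon>" using u[OF xy(1)] u[OF xy(2)] by simp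
    finally have "\<bar>y - x\<bar> * \<bar>u x \<bullet> u y\<bar> \<le> 2 * \<epsilon>" by (simp add: abs_mult)
    moreover have "\<delta> * \<bar>u x \<bullet> u y\<bar> \<le> \<bar>y - x\<bar> * \<bar>u x \<bullet> u y\<bar>"
      using \<delta>le[OF xy(2,1)] False by (intro mult_right_mono) auto
    ultimately have "\<delta> * \<bar>u x \<bullet> u y\<bar> \<le> 2 * \<epsilon>" by linarith
    then show ?thesis using False \<delta> by (simp add: \<tau>_def field_simps)
  qed
  have lower: "(1 - \<tau> * N) * (\<Sum>x\<in>L. (c x)\<^sup>2) \<le> (norm (\<Sum>x\<in>L. c x *\<^sub>R u x))\<^sup>2" for c
  proof -
    have "\<tau> * (\<Sum>x\<in>L. \<bar>c x\<bar>)\<^sup>2 \<le> \<tau> * (N * (\<Sum>x\<in>L. (c x)\<^sup>2))"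
      unfolding N_def using \<tau> by (intro mult_left_mono sum_abs_square_le) auto
    then show ?thesis
      using norm_almost_orthonormal[where d=c and L=L and u=u and \<tau>=\<tau>, OF L(1) near] by (simp add: algebra_simps abs_le_iff)
  qed
  have upper: "norm (jsh a b (of_real m) (\<Sum>x\<in>L. c x *\<^sub>R u x)) \<le>
      (r * sqrt (1 + \<tau> * N) + \<epsilon> * N) * sqrt (\<Sum>x\<in>L. (c x)\<^sup>2)" for c
  proof -
    define C2 where "C2 = (\<Sum>x\<in>L. (c x)\<^sup>2)"
    have C2: "C2 \<ge> 0" by (simp add: C2_def sum_nonneg)
    have lin: "linear (jsh a b (of_real m))" using bounded_linear_jsh[OF jp] by (rule bounded_linear.linear)
    \<comment> \<open>Splitting J - m as (x - m) + (J - x) separates the main part, of size at most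
      \<open>r\<close>, from the error \<epsilon>.\<close>
    have shift: "jsh a b (of_real m) (u x) = (x - m) *\<^sub>R u x + jsh a b (of_real x) (u x)" for x
      using jsh_shift[OF jp, of "of_real m" "u x" "of_real x"] by (simp add: cscale_of_real flip: of_real_diff)
    have eq: "jsh a b (of_real m) (\<Sum>x\<in>L. c x *\<^sub>R u x) =
        (\<Sum>x\<in>L. (c x * (x - m)) *\<^sub>R u x) + (\<Sum>x\<in>L. c x *\<^sub>R jsh a b (of_real x) (u x))"
      by (simp add: linear_sum[OF lin] linear_scale[OF lin] shift scaleR_add_right sum.distrib)
    have cm: "(c x * (x - m))\<^sup>2 \<le> r\<^sup>2 * (c x)\<^sup>2" if "x \<in> L" for x
      using mult_left_mono[OF power_mono[OF L(2)[OF that], of 2], of "(c x)\<^sup>2"]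
      by (simp add: power_mult_distrib mult.commute)
    have s1: "(\<Sum>x\<in>L. (c x * (x - m))\<^sup>2) \<le> r\<^sup>2 * C2"
      unfolding C2_def sum_distrib_left by (intro sum_mono cm)
    have "(norm (\<Sum>x\<in>L. (c x * (x - m)) *\<^sub>R u x))\<^sup>2 \<le>
        (\<Sum>x\<in>L. (c x * (x - m))\<^sup>2) + \<tau> * (\<Sum>x\<in>L. \<bar>c x * (x - m)\<bar>)\<^sup>2"
      using norm_almost_orthonormal[where d="\<lambda>x. c x * (x - m)" and L=L and u=u and \<tau>=\<tau>, OF L(1) near] by (simp add: abs_le_iff)
    also have "\<dots> \<le> r\<^sup>2 * C2 + \<tau> * (N * (r\<^sup>2 * C2))"
      using \<tau> s1 by (intro add_mono mult_left_mono order_trans[OF sum_abs_square_le])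
        (auto simp: N_def intro: mult_left_mono)
    also have "\<dots> = (r * sqrt (1 + \<tau> * N) * sqrt C2)\<^sup>2"
      using C2 \<tau> by (simp add: power_mult_distrib algebra_simps N_def)
    finally have sq: "(norm (\<Sum>x\<in>L. (c x * (x - m)) *\<^sub>R u x))\<^sup>2 \<le> (r * sqrt (1 + \<tau> * N) * sqrt C2)\<^sup>2" .
    have "0 \<le> 1 + \<tau> * N" using \<tau> by (simp add: N_def)
    then have n1: "norm (\<Sum>x\<in>L. (c x * (x - m)) *\<^sub>R u x) \<le> r * sqrt (1 + \<tau> * N) * sqrt C2"
      using C2 \<open>r > 0\<close>
      by (intro power2_le_imp_le[OF sq] mult_nonneg_nonneg real_sqrt_ge_zero) auto
    have "norm (\<Sum>x\<in>L. c x *\<^sub>R jsh a b (of_real x) (u x)) \<le> (\<Sum>x\<in>L. \<bar>c x\<bar> * \<epsilon>)"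
      using less_imp_le[OF u(2)] by (intro order_trans[OF norm_sum] sum_mono) (auto intro: mult_left_mono)
    also have "\<dots> \<le> (\<Sum>x\<in>L. sqrt C2 * \<epsilon>)"
    proof (intro sum_mono mult_right_mono)
      fix x assume "x \<in> L"
      then have "(c x)\<^sup>2 \<le> C2" unfolding C2_def using L(1) by (intro member_le_sum) auto
      then show "\<bar>c x\<bar> \<le> sqrt C2" by (simp add: real_le_rsqrt)
    qed (use \<epsilon> in auto)
    also have "\<dots> = \<epsilon> * N * sqrt C2" by (simp add: N_def)
    finally show ?thesis
      unfolding eq C2_def[symmetric] using n1
      by (intro order_trans[OF norm_triangle_ineq]) (simp add: algebra_simps)
  qed
  have \<tau>N: "1 - \<tau> * N > 0" using \<epsilon>(2) by (simp add: \<tau>_def)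
  have zero: "\<forall>x\<in>L. c x = 0" if "(\<Sum>x\<in>L. c x *\<^sub>R u x) = 0" for c
  proof -
    have "(\<Sum>x\<in>L. (c x)\<^sup>2) \<le> 0" using lower[of c] that \<tau>N by (simp add: mult_le_0_iff)
    then have "(\<Sum>x\<in>L. (c x)\<^sup>2) = 0" by (simp add: antisym sum_nonneg)
    then show ?thesis using L(1) by (subst (asm) sum_nonneg_eq_0_iff) auto
  qed
  \<comment> \<open>A repeated vector would lower the cardinality of the spanning set; it would give
    the relation u x - u y = 0, which \<open>zero\<close> excludes.\<close>
  have inj: "inj_on u L"
  proof (rule inj_onI, rule ccontr)
    fix x y assume xy: "x \<in> L" "y \<in> L" "u x = u y" "x \<noteq> y"
    define c where "c t = (if t = x then 1 else if t = y then -1 else 0 :: real)" for t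
    have "(\<Sum>t\<in>L. c t *\<^sub>R u t) = (\<Sum>t\<in>{x, y}. c t *\<^sub>R u t)"
      using xy L(1) by (intro sum.mono_neutral_right) (auto simp: c_def)
    also have "\<dots> = 0" using xy by (simp add: c_def)
    finally show False using zero[of c] xy by (auto simp: c_def)
  qed
  show ?thesis
  proof (rule that[of "u ` L"])
    show "finite (u ` L)" using L by simp
    show "card (u ` L) = card L" by (rule card_image[OF inj])
    show "independent (u ` L)"
    proof (rule independent_if_scalars_zero)
      fix f v assume s: "(\<Sum>v\<in>u ` L. f v *\<^sub>R v) = 0" and v: "v \<in> u ` L"
      have "(\<Sum>x\<in>L. f (u x) *\<^sub>R u x) = 0" using s by (simp add: sum.reindex[OF inj])
      then show "f v = 0" using zero[of "\<lambda>x. f (u x)"] v by auto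
    qed (use L in simp)
    fix v assume "v \<in> span (u ` L)"
    then obtain f where "v = (\<Sum>v\<in>u ` L. f v *\<^sub>R v)" using span_finite[of "u ` L"] L(1) by auto
    then have v: "v = (\<Sum>x\<in>L. f (u x) *\<^sub>R u x)" by (simp add: sum.reindex[OF inj])
    define C2 where "C2 = (\<Sum>x\<in>L. (f (u x))\<^sup>2)"
    have C2: "C2 \<ge> 0" by (simp add: C2_def sum_nonneg)
    have "(norm (jsh a b (of_real m) v))\<^sup>2 \<le> ((r * sqrt (1 + \<tau> * N) + \<epsilon> * N) * sqrt C2)\<^sup>2"
      using upper[of "\<lambda>x. f (u x)"] by (intro power_mono) (simp_all add: v C2_def)
    also have "\<dots> = (r * sqrt (1 + \<tau> * N) + \<epsilon> * N)\<^sup>2 * C2" using C2 by (simp add: power_mult_distrib)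
    also have "\<dots> \<le> ((r\<^sup>2 + \<eta>) * (1 - \<tau> * N)) * C2"
      using \<epsilon>(3) C2 by (intro mult_right_mono) (auto simp: \<tau>_def)
    also have "\<dots> \<le> (r\<^sup>2 + \<eta>) * (norm v)\<^sup>2"
      using mult_left_mono[OF lower[of "\<lambda>x. f (u x)"], of "r\<^sup>2 + \<eta>"] \<open>\<eta> > 0\<close>
      by (simp add: v C2_def mult.assoc)
    finally show "(norm (jsh a b (of_real m) v))\<^sup>2 \<le> (r\<^sup>2 + \<eta>) * (norm v)\<^sup>2" .
  qed
qed

section \<open>Effect of the perturbation on the quadratic form\<close>

lemma infsum_sum_swap:
  fixes f :: "'i \<Rightarrow> 'k \<Rightarrow> real"
  assumes "finite T" "\<And>t. t \<in> T \<Longrightarrow> f t summable_on UNIV"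
  shows "(\<lambda>k. \<Sum>t\<in>T. f t k) summable_on UNIV \<and> (\<Sum>t\<in>T. infsum (f t) UNIV) = (\<Sum>\<^sub>\<infinity>k. \<Sum>t\<in>T. f t k)"
  using assms by (induction T) (auto simp: infsum_add summable_on_add)

text \<open>These are the entries of \<open>v\<close> met by row \<open>k\<close> of a Jacobi
  matrix.\<close>

definition local_weight :: "ell2 \<Rightarrow> int \<Rightarrow> real" where
  "local_weight v k =
    (cmod (Rep_ell2 v (k-1)))\<^sup>2 + (cmod (Rep_ell2 v k))\<^sup>2 + (cmod (Rep_ell2 v (k+1)))\<^sup>2"

lemma local_weight_nonneg: "0 \<le> local_weight v k" by (simp add: local_weight_def)

lemma local_weight_le: "local_weight v k \<le> 3 * (norm v)\<^sup>2"
proof -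
  have "(cmod (Rep_ell2 v n))\<^sup>2 \<le> (norm v)\<^sup>2" for n
    by (intro power_mono cmod_Rep_ell2_le_norm) auto
  from this[of "k-1"] this[of k] this[of "k+1"] show ?thesis
    unfolding local_weight_def by linarith
qed

lemma summable_shifted_pair:
  fixes d :: "int \<Rightarrow> real"
  assumes "d summable_on UNIV"
  shows "(\<lambda>k. d (k - 1) + d k) summable_on UNIV" "(\<Sum>\<^sub>\<infinity>k. d (k - 1) + d k) = 2 * (\<Sum>\<^sub>\<infinity>k. d k)"
proof -
  have s: "(\<lambda>k. d (k - 1)) summable_on UNIV" "(\<Sum>\<^sub>\<infinity>k. d (k - 1)) = (\<Sum>\<^sub>\<infinity>k. d k)"
    using summable_on_reindex_bij_betw[OF bij_int_shift[of "-1"], of d]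
      infsum_reindex_bij_betw[OF bij_int_shift[of "-1"], of d] assms by simp_all
  show "(\<lambda>k. d (k - 1) + d k) summable_on UNIV" using s(1) assms by (rule summable_on_add)
  show "(\<Sum>\<^sub>\<infinity>k. d (k - 1) + d k) = 2 * (\<Sum>\<^sub>\<infinity>k. d k)" using s assms by (simp add: infsum_add)
qed

lemma three_term_bound:
  fixes x y z :: complex and p q r :: real
  assumes "\<bar>p\<bar> \<le> c" "\<bar>q\<bar> \<le> c" "\<bar>r\<bar> \<le> c"
  shows "cmod (of_real p * x + of_real q * y + of_real r * z) \<le> c * (cmod x + cmod y + cmod z)"
proof -
  have "cmod (of_real p * x + of_real q * y + of_real r * z) \<le>
      \<bar>p\<bar> * cmod x + \<bar>q\<bar> * cmod y + \<bar>r\<bar> * cmod z"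
    using norm_triangle_ineq[of "of_real p * x + of_real q * y" "of_real r * z"]
      norm_triangle_ineq[of "of_real p * x" "of_real q * y"] by (simp add: norm_mult)
  also have "\<dots> \<le> c * cmod x + c * cmod y + c * cmod z"
    using assms by (intro add_mono mult_right_mono) auto
  finally show ?thesis by (simp add: algebra_simps)
qed

text \<open>The difference of squares is <X - Y, X + Y>. In row k the first factor carries the
  differences of a(k-1), b(k) and a(k), hence d(k-1) + d(k); the coefficients of the second are at
  most 4C. The remaining 3 in 12 comes from squaring a sum of three terms.\<close>

lemma perturbation_bound:
  fixes m C :: real and a b a0 b0 :: "int \<Rightarrow> real"
  defines "d \<equiv> \<lambda>n. \<bar>a n - a0 n\<bar> + \<bar>b n - b0 n\<bar>"
  assumes jp0: "jacobi_parameters a0 b0" and jp: "jacobi_parameters a b"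
    and sm: "d summable_on UNIV" and m: "\<bar>m\<bar> \<le> C"
    and C: "\<And>n. \<bar>a n\<bar> \<le> C" "\<And>n. \<bar>b n\<bar> \<le> C" "\<And>n. \<bar>a0 n\<bar> \<le> C" "\<And>n. \<bar>b0 n\<bar> \<le> C"
  shows "(\<lambda>k. (d (k-1) + d k) * local_weight v k) summable_on UNIV"
    and "(norm (jsh a0 b0 (of_real m) v))\<^sup>2 - (norm (jsh a b (of_real m) v))\<^sup>2
      \<le> 12 * C * (\<Sum>\<^sub>\<infinity>k. (d (k-1) + d k) * local_weight v k)"
proof -
  have d0: "0 \<le> d n" for n by (simp add: d_def)
  have C0: "0 \<le> C" using m by linarith
  show sum: "(\<lambda>k. (d (k-1) + d k) * local_weight v k) summable_on UNIV"
  proof (rule summable_on_comparison_test)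
    show "(\<lambda>k. (d (k-1) + d k) * (3 * (norm v)\<^sup>2)) summable_on UNIV"
      by (intro summable_on_cmult_left summable_shifted_pair(1) sm)
    show "(d (k-1) + d k) * local_weight v k \<le> (d (k-1) + d k) * (3 * (norm v)\<^sup>2)" for k
      using d0 by (intro mult_left_mono local_weight_le) auto
  qed (use d0 local_weight_nonneg in auto)
  define X where "X = jsh a0 b0 (of_real m) v"
  define Y where "Y = jsh a b (of_real m) v"
  have term_le: "Rep_ell2 (X - Y) k \<bullet> Rep_ell2 (X + Y) k \<le> 12 * C * ((d (k-1) + d k) * local_weight v k)" for k
  proof -
    define s where "s = cmod (Rep_ell2 v (k-1)) + cmod (Rep_ell2 v k) + cmod (Rep_ell2 v (k+1))"
    have XY: "Rep_ell2 X k = of_real (a0 (k-1)) * Rep_ell2 v (k-1) + of_real (b0 k - m) * Rep_ell2 v k + of_real (a0 k) * Rep_ell2 v (k+1)"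
      "Rep_ell2 Y k = of_real (a (k-1)) * Rep_ell2 v (k-1) + of_real (b k - m) * Rep_ell2 v k + of_real (a k) * Rep_ell2 v (k+1)"
      by (simp_all add: X_def Y_def Rep_jsh jp jp0 shifted_operator_def jacobi_operator_apply algebra_simps)
    have "Rep_ell2 (X - Y) k = of_real (a0 (k-1) - a (k-1)) * Rep_ell2 v (k-1) + of_real (b0 k - b k) * Rep_ell2 v k
        + of_real (a0 k - a k) * Rep_ell2 v (k+1)"
      by (simp add: XY algebra_simps)
    then have n1: "cmod (Rep_ell2 (X - Y) k) \<le> (d (k-1) + d k) * s"
      unfolding s_def by (simp only:) (rule three_term_bound, auto simp: d_def)
    have "Rep_ell2 (X + Y) k = of_real (a0 (k-1) + a (k-1)) * Rep_ell2 v (k-1) + of_real (b0 k - m + (b k - m)) * Rep_ell2 v k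
        + of_real (a0 k + a k) * Rep_ell2 v (k+1)"
      by (simp add: XY algebra_simps)
    moreover have "\<bar>a0 (k-1) + a (k-1)\<bar> \<le> 4 * C" "\<bar>b0 k - m + (b k - m)\<bar> \<le> 4 * C" "\<bar>a0 k + a k\<bar> \<le> 4 * C"
      using C(1,3)[of "k-1"] C[of k] m C0 by linarith+
    ultimately have n2: "cmod (Rep_ell2 (X + Y) k) \<le> 4 * C * s"
      unfolding s_def by (simp only:) (rule three_term_bound)
    have s2: "s\<^sup>2 \<le> 3 * local_weight v k"
    proof -
      have "(p + q + t)\<^sup>2 \<le> 3 * (p\<^sup>2 + q\<^sup>2 + t\<^sup>2)" for p q t :: real
        using zero_le_power2[of "p - q"] zero_le_power2[of "q - t"] zero_le_power2[of "p - t"]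
        by (simp add: power2_eq_square algebra_simps)
      then show ?thesis by (simp add: s_def local_weight_def)
    qed
    have "Rep_ell2 (X - Y) k \<bullet> Rep_ell2 (X + Y) k \<le> cmod (Rep_ell2 (X - Y) k) * cmod (Rep_ell2 (X + Y) k)"
      by (rule norm_cauchy_schwarz)
    also have "\<dots> \<le> ((d (k-1) + d k) * s) * (4 * C * s)"
      using n1 n2 d0 by (intro mult_mono) (auto simp: s_def)
    also have "\<dots> = 4 * C * (d (k-1) + d k) * s\<^sup>2" by (simp add: power2_eq_square)
    also have "\<dots> \<le> 4 * C * (d (k-1) + d k) * (3 * local_weight v k)"
      using s2 C0 d0 by (intro mult_left_mono) auto
    also have "\<dots> = 12 * C * ((d (k-1) + d k) * local_weight v k)" by simp
    finally show ?thesis .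
  qed
  have "(norm X)\<^sup>2 - (norm Y)\<^sup>2 = (X - Y) \<bullet> (X + Y)"
    by (simp add: power2_norm_eq_inner inner_diff_left inner_add_right inner_commute[of Y X])
  also have "\<dots> = (\<Sum>\<^sub>\<infinity>k. Rep_ell2 (X - Y) k \<bullet> Rep_ell2 (X + Y) k)" by (rule inner_ell2.rep_eq)
  also have "\<dots> \<le> (\<Sum>\<^sub>\<infinity>k. 12 * C * ((d (k-1) + d k) * local_weight v k))"
    by (intro infsum_mono l2_inner_summable summable_on_cmult_right sum term_le Rep_ell2)
  also have "\<dots> = 12 * C * (\<Sum>\<^sub>\<infinity>k. (d (k-1) + d k) * local_weight v k)" by (rule infsum_cmult_right')
  finally show "(norm (jsh a0 b0 (of_real m) v))\<^sup>2 - (norm (jsh a b (of_real m) v))\<^sup>2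
      \<le> 12 * C * (\<Sum>\<^sub>\<infinity>k. (d (k-1) + d k) * local_weight v k)" by (simp add: X_def Y_def)
qed

text \<open>The constant is 2 * 12 * 2 * 6: each basis vector contributes 1/2,
  \<open>perturbation_bound\<close> gives 12 C, each d(n) occurs in two rows, and three entries of
  weight 2g make 6g.\<close>

theorem card_spectrum_in_gap:
  fixes x1 x2 C g :: real and L :: "real set" and a b a0 b0 :: "int \<Rightarrow> real"
  defines "d \<equiv> \<lambda>n. \<bar>a n - a0 n\<bar> + \<bar>b n - b0 n\<bar>"
  assumes jp0: "jacobi_parameters a0 b0" and jp: "jacobi_parameters a b"
    and sm: "d summable_on UNIV"
    and C: "\<And>n. \<bar>a n\<bar> \<le> C" "\<And>n. \<bar>b n\<bar> \<le> C" "\<And>n. \<bar>a0 n\<bar> \<le> C" "\<And>n. \<bar>b0 n\<bar> \<le> C"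
    and x12: "x1 < x2" "\<bar>x1\<bar> \<le> C" "\<bar>x2\<bar> \<le> C"
    and reg: "\<And>x. x1 \<le> x \<Longrightarrow> x \<le> x2 \<Longrightarrow> regular_value a0 b0 (of_real x)"
    and L: "finite L" "L \<subseteq> {x1..x2}" "of_real ` L \<subseteq> l2_spectrum (jacobi_operator a b)"
    and g: "\<And>n. Re (green a0 b0 n (of_real x2)) - Re (green a0 b0 n (of_real x1)) \<le> g * (x2 - x1)"
  shows "real (card L) \<le> 288 * C * (\<Sum>\<^sub>\<infinity>n. d n) * g"
proof -
  define m where "m = (x1 + x2) / 2"
  define r where "r = (x2 - x1) / 2"
  have r: "r > 0" using x12 by (simp add: r_def)
  have mr: "m - r = x1" "m + r = x2" by (simp_all add: m_def r_def field_simps)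
  have m: "\<bar>m\<bar> \<le> C" using x12 by (simp add: m_def)
  have "regular_value a0 b0 (of_real x)" if "\<bar>x - m\<bar> \<le> r" for x
    using reg[of x] that mr by (simp add: abs_le_iff)
  then obtain \<kappa> where \<kappa>: "\<kappa> > 0"
    "\<And>u. (r\<^sup>2 + \<kappa>) * (norm u)\<^sup>2 \<le> (norm (jsh a0 b0 (of_real m) u))\<^sup>2"
    using norm_jsh_gap[OF jp0, of m r] r by auto
  \<comment> \<open>Written around the midpoint so that \<open>norm_jsh_gap\<close> gives
    positivity; \<open>\<beta>fact\<close> shows that it is the form of (J0 - x1)(J0 - x2).\<close>
  define \<beta> where "\<beta> u v = jsh a0 b0 (of_real m) u \<bullet> jsh a0 b0 (of_real m) v - r\<^sup>2 * (u \<bullet> v)" for u v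
  have \<beta>diag: "\<beta> u u = (norm (jsh a0 b0 (of_real m) u))\<^sup>2 - r\<^sup>2 * (norm u)\<^sup>2" for u
    by (simp add: \<beta>_def power2_norm_eq_inner)
  have \<beta>low: "\<kappa> * (norm u)\<^sup>2 \<le> \<beta> u u" for u using \<kappa>(2)[of u] by (simp add: \<beta>diag algebra_simps)
  interpret inner_form \<beta>
  proof (rule inner_form.intro)
    show "\<beta> u v = \<beta> v u" for u v by (simp add: \<beta>_def inner_commute)
    show "linear (\<beta> u)" for u
      by (rule linearI) (simp_all add: \<beta>_def jsh_add[OF jp0] jsh_scaleR[OF jp0] inner_add_right algebra_simps)
    show "0 \<le> \<beta> u u" for u
      using order_trans[OF _ \<beta>low[of u], of 0] \<kappa>(1) by simp
  qed
  have \<beta>fact: "\<beta> u v = u \<bullet> jsh a0 b0 (of_real x1) (jsh a0 b0 (of_real x2) v)" for u v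
  proof -
    have e12: "jsh a0 b0 (of_real x1) u = jsh a0 b0 (of_real m) u + r *\<^sub>R u"
      "jsh a0 b0 (of_real x2) v = jsh a0 b0 (of_real m) v - r *\<^sub>R v"
      using jsh_shift[OF jp0, of "of_real x1" u "of_real m"] jsh_shift[OF jp0, of "of_real x2" v "of_real m"] mr
      by (simp_all add: cscale_of_real scaleR_minus_left[symmetric] del: scaleR_minus_left flip: of_real_diff)
    have e3: "u \<bullet> jsh a0 b0 (of_real x1) (jsh a0 b0 (of_real x2) v) =
        jsh a0 b0 (of_real x1) u \<bullet> jsh a0 b0 (of_real x2) v"
      using jsh_adjoint[OF jp0, of "of_real x1" u] by simp
    have e4: "u \<bullet> jsh a0 b0 (of_real m) v = jsh a0 b0 (of_real m) u \<bullet> v"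
      using jsh_adjoint[OF jp0, of "of_real m" u] by simp
    show ?thesis
      unfolding \<beta>_def e3 unfolding e12
      by (simp add: e4 inner_add_left inner_diff_right power2_eq_square algebra_simps)
  qed
  have reg12: "regular_value a0 b0 (of_real x1)" "regular_value a0 b0 (of_real x2)"
    using reg x12 by auto
  \<comment> \<open>By the resolvent identity this is the inverse of \<open>B\<close> applied to
    \<open>ket n\<close>. It thus represents, with respect to \<beta>, the real part of the n-th
    coordinate, and \<i> times it the imaginary part.\<close>
  define w where "w n = (1 / (x2 - x1)) *\<^sub>R (rsv a0 b0 (of_real x2) (ket n) - rsv a0 b0 (of_real x1) (ket n))" for n
  have Bw: "jsh a0 b0 (of_real x1) (jsh a0 b0 (of_real x2) (w n)) = ket n" for n
  proof -
    have "w n = rsv a0 b0 (of_real x2) (rsv a0 b0 (of_real x1) (ket n))"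
      using resolvent_identity[OF jp0 reg12(2,1), of "ket n"] x12(1)
      by (simp add: w_def cscale_of_real flip: of_real_diff)
    then show ?thesis using jsh_rsv[OF jp0] reg12 by simp
  qed
  have \<beta>w: "\<beta> t (w n) = Re (Rep_ell2 t n)" "\<beta> t (cscale \<i> (w n)) = Im (Rep_ell2 t n)" for t n
    unfolding \<beta>fact jsh_cscale[OF jp0] Bw
    using inner_ket[of n t] inner_cscale_ket[of n t] by (simp_all add: inner_commute)
  have wg: "Re (Rep_ell2 (w n) n) \<le> g" for n
  proof -
    have "Re (Rep_ell2 (w n) n) =
        (Re (green a0 b0 n (of_real x2)) - Re (green a0 b0 n (of_real x1))) / (x2 - x1)"
      by (simp add: w_def green_def diff_divide_distrib)
    then show ?thesis using g[of n] x12(1) by (simp add: pos_divide_le_eq)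
  qed
  \<comment> \<open>On vectors with \<beta>(v, v) = 1 the squared norm is at most 1/\<kappa>, so
    this loss costs at most 1/2 of the form.\<close>
  define \<eta> where "\<eta> = \<kappa> / 2"
  have "\<And>x. x \<in> L \<Longrightarrow> \<bar>x - m\<bar> \<le> r" using L(2) mr by (auto simp: abs_le_iff)
  moreover have "\<And>x. x \<in> L \<Longrightarrow> complex_of_real x \<in> l2_spectrum (jacobi_operator a b)" using L(3) by auto
  moreover have "\<eta> > 0" using \<kappa> by (simp add: \<eta>_def)
  ultimately obtain S where S: "finite S" "card S = card L" "independent S"
    "\<And>v. v \<in> span S \<Longrightarrow> (norm (jsh a b (of_real m) v))\<^sup>2 \<le> (r\<^sup>2 + \<eta>) * (norm v)\<^sup>2"
    using approximate_spectral_subspace[OF jp L(1), of m r \<eta>] r by metis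
  have "0 < \<beta> v v" if "v \<noteq> 0" for v
    using \<beta>low[of v] mult_pos_pos[OF \<kappa>(1), of "(norm v)\<^sup>2"] that by simp
  then obtain T where T: "finite T" "card T = card L" "T \<subseteq> span S" "orthonormal T"
    using gram_schmidt[OF S(1,3)] S(2) by auto
  have half: "1 / 2 \<le> (norm (jsh a0 b0 (of_real m) v))\<^sup>2 - (norm (jsh a b (of_real m) v))\<^sup>2"
    if "v \<in> T" for v
  proof -
    have "\<beta> v v = 1" using T(4) that by (simp add: orthonormal_def)
    then show ?thesis
      using \<beta>low[of v] \<beta>diag[of v] S(4)[of v] T(3) that by (auto simp: \<eta>_def algebra_simps)
  qed
  \<comment> \<open>Bessel for \<open>w n\<close> and for \<i> times it: \<beta>(w, w) is the n-th
    coordinate of w, that is, the diagonal entry bounded by \<open>g\<close>.\<close>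
  have comp: "(\<Sum>v\<in>T. (cmod (Rep_ell2 v n))\<^sup>2) \<le> 2 * g" for n
  proof -
    have "(\<Sum>v\<in>T. (Re (Rep_ell2 v n))\<^sup>2) \<le> g"
      using bessel[OF T(1,4), of "w n"] wg[of n] by (simp add: \<beta>w)
    moreover have "(\<Sum>v\<in>T. (Im (Rep_ell2 v n))\<^sup>2) \<le> g"
      using bessel[OF T(1,4), of "cscale \<i> (w n)"] wg[of n] by (simp add: \<beta>w)
    ultimately show ?thesis by (simp add: cmod_power2 sum.distrib)
  qed
  have d0: "0 \<le> d n" for n by (simp add: d_def)
  have C0: "0 \<le> C" using m by linarith
  have lw: "(\<Sum>v\<in>T. local_weight v k) \<le> 6 * g" for k
    using comp[of "k-1"] comp[of k] comp[of "k+1"] by (simp add: local_weight_def sum.distrib)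
  have pb: "(\<lambda>k. (d (k-1) + d k) * local_weight v k) summable_on UNIV"
    "(norm (jsh a0 b0 (of_real m) v))\<^sup>2 - (norm (jsh a b (of_real m) v))\<^sup>2
      \<le> 12 * C * (\<Sum>\<^sub>\<infinity>k. (d (k-1) + d k) * local_weight v k)" for v
    unfolding d_def by (rule perturbation_bound[OF jp0 jp sm[unfolded d_def] m C])+
  have sw: "(\<lambda>k. \<Sum>v\<in>T. (d (k-1) + d k) * local_weight v k) summable_on UNIV"
    "(\<Sum>v\<in>T. \<Sum>\<^sub>\<infinity>k. (d (k-1) + d k) * local_weight v k) = (\<Sum>\<^sub>\<infinity>k. \<Sum>v\<in>T. (d (k-1) + d k) * local_weight v k)"
    using infsum_sum_swap[OF T(1), of "\<lambda>v k. (d (k-1) + d k) * local_weight v k"] pb(1) by blast+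
  have "real (card L) / 2 = (\<Sum>v\<in>T. 1 / 2)" using T(2) by simp
  also have "\<dots> \<le> (\<Sum>v\<in>T. 12 * C * (\<Sum>\<^sub>\<infinity>k. (d (k-1) + d k) * local_weight v k))"
    using half pb(2) by (intro sum_mono) (meson order_trans)
  also have "\<dots> = 12 * C * (\<Sum>\<^sub>\<infinity>k. \<Sum>v\<in>T. (d (k-1) + d k) * local_weight v k)"
    by (simp add: sum_distrib_left[symmetric] sw(2))
  also have "\<dots> \<le> 12 * C * (\<Sum>\<^sub>\<infinity>k. (d (k-1) + d k) * (6 * g))"
  proof (intro mult_left_mono infsum_mono sw(1))
    show "(\<lambda>k. (d (k-1) + d k) * (6 * g)) summable_on UNIV"
      by (intro summable_on_cmult_left summable_shifted_pair(1) sm)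
    show "(\<Sum>v\<in>T. (d (k-1) + d k) * local_weight v k) \<le> (d (k-1) + d k) * (6 * g)" for k
      unfolding sum_distrib_left[symmetric] using d0 by (intro mult_left_mono lw) auto
  qed (use C0 in auto)
  also have "\<dots> = 144 * C * (\<Sum>\<^sub>\<infinity>n. d n) * g"
    by (simp add: infsum_cmult_left' summable_shifted_pair(2)[OF sm])
  finally show ?thesis by simp
qed

subsection \<open>Summation\<close>

text \<open>Remove the smallest value first. If N + 1 points are left, all of them are counted at
  that value, so its square root is at most C/(N + 1).\<close>

lemma sum_powr_of_count:
  fixes t :: "'a \<Rightarrow> real" and C \<alpha> :: real
  assumes "finite F" "\<And>z. z \<in> F \<Longrightarrow> 0 < t z" "\<alpha> > 0"
    and "\<And>z. z \<in> F \<Longrightarrow> real (card {w \<in> F. t z \<le> t w}) \<le> C / sqrt (t z)"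
  shows "(\<Sum>z\<in>F. t z powr \<alpha>) \<le> (\<Sum>j=1..card F. (C / real j) powr (2 * \<alpha>))"
  using assms
proof (induction "card F" arbitrary: F)
  case 0
  then show ?case by simp
next
  case (Suc N)
  have "F \<noteq> {}" using Suc.hyps(2) by auto
  then have "Min (t ` F) \<in> t ` F" using Suc.prems(1) by (intro Min_in) auto
  then obtain z where z: "z \<in> F" "t z = Min (t ` F)" by auto
  have zmin: "t z \<le> t w" if "w \<in> F" for w using z(2) Suc.prems(1) that by simp
  have N: "card F = Suc N" using Suc.hyps(2) by simp
  have "{w \<in> F. t z \<le> t w} = F" using zmin by auto
  then have "real (Suc N) \<le> C / sqrt (t z)" using Suc.prems(4)[OF z(1)] N by simp
  then have le: "sqrt (t z) \<le> C / real (Suc N)"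
    using Suc.prems(2)[OF z(1)] by (simp add: field_simps)
  have "t z powr \<alpha> = sqrt (t z) powr (2 * \<alpha>)"
    using Suc.prems(2)[OF z(1)] by (simp add: powr_half_sqrt[symmetric] powr_powr)
  also have "\<dots> \<le> (C / real (Suc N)) powr (2 * \<alpha>)"
    using le Suc.prems(2)[OF z(1)] \<open>\<alpha> > 0\<close> by (intro powr_mono2) auto
  finally have tz: "t z powr \<alpha> \<le> (C / real (Suc N)) powr (2 * \<alpha>)" .
  have cF: "card (F - {z}) = N" using N z(1) Suc.prems(1) by simp
  have "(\<Sum>w\<in>F - {z}. t w powr \<alpha>) \<le> (\<Sum>j=1..card (F - {z}). (C / real j) powr (2 * \<alpha>))"
  proof (rule Suc.hyps(1))
    show "real (card {w' \<in> F - {z}. t w \<le> t w'}) \<le> C / sqrt (t w)" if "w \<in> F - {z}" for w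
    proof -
      have "card {w' \<in> F - {z}. t w \<le> t w'} \<le> card {w' \<in> F. t w \<le> t w'}"
        using Suc.prems(1) by (intro card_mono) auto
      then show ?thesis using Suc.prems(4)[of w] that by simp
    qed
  qed (use cF Suc.prems in auto)
  moreover have "(\<Sum>w\<in>F. t w powr \<alpha>) = t z powr \<alpha> + (\<Sum>w\<in>F - {z}. t w powr \<alpha>)"
    using Suc.prems(1) z(1) by (rule sum.remove)
  ultimately show ?case using tz unfolding cF N by simp
qed

text \<open>The bound no longer depends on \<open>F\<close>. The condition \<alpha> > 1/2 enters
  here, as convergence of the sum of j to the power -2\<alpha>.\<close>

lemma sum_powr_bounded:
  fixes t :: "'a \<Rightarrow> real" and C \<alpha> :: real
  assumes "finite F" "\<And>z. z \<in> F \<Longrightarrow> 0 < t z" "\<alpha> > 1/2" "C \<ge> 0"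
    and "\<And>z. z \<in> F \<Longrightarrow> real (card {w \<in> F. t z \<le> t w}) \<le> C / sqrt (t z)"
  shows "(\<Sum>z\<in>F. t z powr \<alpha>) \<le> C powr (2 * \<alpha>) * (\<Sum>j. real j powr (- 2 * \<alpha>))"
proof -
  have "(\<Sum>z\<in>F. t z powr \<alpha>) \<le> (\<Sum>j=1..card F. (C / real j) powr (2 * \<alpha>))"
    using assms by (intro sum_powr_of_count) auto
  also have "\<dots> = C powr (2 * \<alpha>) * (\<Sum>j=1..card F. real j powr (- 2 * \<alpha>))"
    unfolding sum_distrib_left using assms(4)
    by (intro sum.cong) (auto simp: powr_divide powr_minus_divide)
  \<comment> \<open>The term j = 0 of the series is harmless, since \<open>0 powr x\<close> is
    0.\<close>
  also have "(\<Sum>j=1..card F. real j powr (- 2 * \<alpha>)) \<le> (\<Sum>j. real j powr (- 2 * \<alpha>))"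
    using assms(3) by (intro sum_le_suminf) (auto simp: summable_real_powr_iff)
  finally show ?thesis using assms(4) by (simp add: mult_left_mono)
qed

context band_edges
begin

text \<open>At most one edge is closer to x than half the least edge distance. It contributes at
  least sqrt s; every other edge contributes at least a constant.\<close>

lemma norm_S_lower:
  obtains c where "c > 0"
    "\<And>x s. 0 < s \<Longrightarrow> s \<le> 1 \<Longrightarrow> (\<And>v. v \<in> V \<Longrightarrow> s \<le> \<bar>x - v\<bar>) \<Longrightarrow> c * sqrt s \<le> cmod (S (of_real x))"
proof -
  define D where "D = (\<lambda>(v, w). \<bar>v - w\<bar>) ` {(v, w) \<in> V \<times> V. v \<noteq> w}"
  have finD: "finite D" 
    unfolding D_def
  proof (rule finite_imageI)
    show "finite {(v, w) \<in> V \<times> V. v \<noteq> w}"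
      by (rule finite_subset[of _ "V \<times> V"]) (use finite_V in auto)
  qed
  \<comment> \<open>The inserted 2 ensures that \<open>k\<close> is at most 1, so a missing or
    additional factor \<open>k\<close> only weakens the bound.\<close>
  define \<mu> where "\<mu> = Min (insert 2 D)"
  have \<mu>: "\<mu> > 0" "\<mu> \<le> 2" unfolding \<mu>_def using finD by (auto simp: D_def)
  have sep: "\<mu> \<le> \<bar>v - w\<bar>" if "v \<in> V" "w \<in> V" "v \<noteq> w" for v w
    unfolding \<mu>_def using finD that by (intro Min_le) (auto simp: D_def image_iff)
  define k where "k = sqrt (\<mu> / 2)"
  have k: "k > 0" "k \<le> 1" using \<mu> by (auto simp: k_def)
  show ?thesis
  proof (rule that[of "k ^ card V"])
    show "k ^ card V > 0" using k by simp
    fix x s :: real assume s: "0 < s" "s \<le> 1" "\<And>v. v \<in> V \<Longrightarrow> s \<le> \<bar>x - v\<bar>"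
    have S: "cmod (S (of_real x)) = (\<Prod>v\<in>V. sqrt \<bar>x - v\<bar>)"
      unfolding norm_S by (simp flip: of_real_diff)
    show "k ^ card V * sqrt s \<le> cmod (S (of_real x))"
    proof (cases "\<exists>e\<in>V. \<bar>x - e\<bar> < \<mu> / 2")
      case False
      then have "(\<Prod>v\<in>V. k) \<le> (\<Prod>v\<in>V. sqrt \<bar>x - v\<bar>)"
        unfolding k_def using \<mu> by (intro prod_mono) (auto simp: not_less)
      moreover have "k ^ card V * sqrt s \<le> k ^ card V * 1"
        using k s by (intro mult_left_mono) auto
      ultimately show ?thesis by (simp add: S)
    next
      case True
      then obtain e where e: "e \<in> V" "\<bar>x - e\<bar> < \<mu> / 2" by blast
      have "(\<Prod>v\<in>V - {e}. k) \<le> (\<Prod>v\<in>V - {e}. sqrt \<bar>x - v\<bar>)"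
      proof (intro prod_mono conjI)
        fix v assume "v \<in> V - {e}"
        then have "\<mu> \<le> \<bar>v - e\<bar>" using sep e(1) by auto
        then have "\<mu> / 2 \<le> \<bar>x - v\<bar>" using e(2) by linarith
        then show "k \<le> sqrt \<bar>x - v\<bar>" unfolding k_def by simp
      qed (use k in auto)
      then have "sqrt s * k ^ (card V - 1) \<le> sqrt \<bar>x - e\<bar> * (\<Prod>v\<in>V - {e}. sqrt \<bar>x - v\<bar>)"
        using s e(1) k finite_V by (intro mult_mono) auto
      moreover have "k ^ card V \<le> k ^ (card V - 1)" using k by (intro power_decreasing) auto
      then have "k ^ card V * sqrt s \<le> k ^ (card V - 1) * sqrt s" using s by (intro mult_right_mono) auto
      ultimately show ?thesis
        unfolding S prod.remove[OF finite_V e(1)] by (simp add: mult.commute)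
    qed
  qed
qed

text \<open>The two unbounded gaps are cut off at \<open>\<plusminus>K\<close>.\<close>

definition gaps :: "real \<Rightarrow> (real \<times> real) set" where
  "gaps K = {(p, q) \<in> insert (- K) (hi ` I) \<times> insert K (lo ` I). p < q \<and> {p<..<q} \<inter> E = {}}"

lemma finite_gaps: "finite (gaps K)"
  unfolding gaps_def
  by (rule finite_subset[of _ "insert (- K) (hi ` I) \<times> insert K (lo ` I)"]) (use fin in auto)

text \<open>Take the nearest right end below x and the nearest left end above x, with -K and K as
  substitutes. A band meeting the interval between them would have an end closer to x on one
  side.\<close>

lemma gap_containing:
  assumes "x \<notin> E" "\<bar>x\<bar> < K"
  obtains p q where "(p, q) \<in> gaps K" "p < x" "x < q"
proof -
  define P where "P = {p \<in> insert (- K) (hi ` I). p < x}"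
  define Q where "Q = {q \<in> insert K (lo ` I). x < q}"
  have P: "finite P" "P \<noteq> {}" and Q: "finite Q" "Q \<noteq> {}"
    using fin assms(2) by (auto simp: P_def Q_def)
  define p where "p = Max P"
  define q where "q = Min Q"
  have pP: "p \<in> P" and qQ: "q \<in> Q" unfolding p_def q_def using P Q by (auto intro: Max_in Min_in)
  have "y \<notin> E" if y: "p < y" "y < q" for y
  proof
    assume "y \<in> E"
    then obtain j where j: "j \<in> I" "lo j \<le> y" "y \<le> hi j" by (auto simp: E)
    consider "x < lo j" | "hi j < x" using assms(1) j(1) by (fastforce simp: E)
    then show False
    proof cases
      case 1
      then have "q \<le> lo j" unfolding q_def using Q j(1) by (intro Min_le) (auto simp: Q_def)
      then show False using j y by simp
    next
      case 2
      then have "hi j \<le> p" unfolding p_def using P j(1) by (intro Max_ge) (auto simp: P_def)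
      then show False using j y by simp
    qed
  qed
  then have "(p, q) \<in> gaps K" using pP qQ by (auto simp: gaps_def P_def Q_def)
  then show thesis using that pP qQ by (auto simp: P_def Q_def)
qed

end

theorem theorem1p3:
  fixes l :: nat and lo hi :: "nat \<Rightarrow> real" and E :: "real set"
    and a0 b0 a b :: "int \<Rightarrow> real" and \<alpha> :: real
  assumes "\<And>j. j \<in> {1..l+1} \<Longrightarrow> lo j < hi j"
    and "disjoint_family_on (\<lambda>j. {lo j..hi j}) {1..l+1}"
    and "E = (\<Union>j\<in>{1..l+1}. {lo j..hi j})"
    and "(a0, b0) \<in> isospectral_torus E"
    and "jacobi_parameters a b"
    and "(\<lambda>n. \<bar>a n - a0 n\<bar> + \<bar>b n - b0 n\<bar>) summable_on UNIV"
    and "\<alpha> > 1/2"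
  shows "(\<lambda>z. infdist z (complex_of_real ` E) powr \<alpha>) summable_on
           (l2_spectrum (jacobi_operator a b) - complex_of_real ` E)"
proof -
  define I where "I = {1..l+1}"
  interpret band_edges I lo hi E
    by (rule band_edges.intro) (use assms(1-3) in \<open>auto simp: I_def\<close>)
  note jp = assms(5)
  have jp0: "jacobi_parameters a0 b0"
    and spec0: "l2_spectrum (jacobi_operator a0 b0) = complex_of_real ` E"
    and refl: "reflectionless_on a0 b0 E"
    using assms(4) by (auto simp: isospectral_torus_def)
  have reg0: "regular_value a0 b0 z \<longleftrightarrow> z \<notin> complex_of_real ` E" for z
    using not_in_spectrum_iff[OF jp0, of z] by (simp add: spec0)
  obtain K0 where K0: "K0 > 0" "\<And>z u. (cmod z - K0) * norm u \<le> norm (jsh a0 b0 z u)"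
    using norm_jsh_large[OF jp0] by metis
  obtain K1 where K1: "K1 > 0" "\<And>z u. (cmod z - K1) * norm u \<le> norm (jsh a b z u)"
    using norm_jsh_large[OF jp] by metis
  \<comment> \<open>Exceeding \<open>K0\<close> by 1 gives |G| \<le> 1 on the circle |z| = K;
    exceeding \<open>K1\<close> by 1 keeps the spectrum of J at distance 1 from the artificial gap
    ends.\<close>
  define K where "K = max K0 K1 + 1"
  have K: "K \<ge> 1" "K0 + 1 \<le> K" "K1 + 1 \<le> K" using K0(1) by (auto simp: K_def)
  have bound_E: "E \<subseteq> {-K<..<K}"
  proof
    fix x assume x: "x \<in> E"
    have "\<bar>x\<bar> \<le> K0"
    proof (rule ccontr)
      assume "\<not> \<bar>x\<bar> \<le> K0"
      then have "regular_value a0 b0 (of_real x)"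
        unfolding regular_value_def[OF jp0] using K0(2)[of "of_real x"]
        by (intro exI[of _ "\<bar>x\<bar> - K0"]) auto
      then show False using reg0 x by blast
    qed
    then show "x \<in> {-K<..<K}" using K by auto
  qed
  have bound_spec: "cmod z \<le> K1" if "z \<in> l2_spectrum (jacobi_operator a b)" for z
  proof (rule ccontr)
    assume "\<not> cmod z \<le> K1"
    then have "regular_value a b z"
      unfolding regular_value_def[OF jp] using K1(2)[of z] by (intro exI[of _ "cmod z - K1"]) auto
    then show False using not_in_spectrum_iff[OF jp] that by blast
  qed
  define M where "M = sqrt (2 * K) ^ card V"
  have M: "M > 0" using K by (simp add: M_def)
  have green_S: "cmod (green a0 b0 n (of_real x)) * cmod (S (of_real x)) \<le> M"
    if x: "x \<notin> E" "\<bar>x\<bar> \<le> K" for n x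
  proof -
    have "cmod (green a0 b0 n (of_real x)) * cmod (S (of_real x)) \<le> 1 * sqrt (2 * K) ^ card V"
    proof (rule edge_bound[OF _ _ _ _ _ bound_E _ x])
      show "green a0 b0 n holomorphic_on - complex_of_real ` E"
        using green_holomorphic[OF jp0] by (simp add: spec0)
      show "0 < Im (green a0 b0 n z)" if "0 < Im z" for z by (rule Im_green_pos[OF jp0 that])
      show "green a0 b0 n (cnj z) = cnj (green a0 b0 n z)" if "z \<notin> complex_of_real ` E" for z
        using green_cnj[OF jp0] that reg0 by blast
      show "cmod (green a0 b0 n z) \<le> 1 / \<bar>Im z\<bar>" if "Im z \<noteq> 0" for z
        by (rule green_bound_Im[OF jp0 that])
      show "cmod (green a0 b0 n z) \<le> 1" if "cmod z = K" for z
      proof -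
        have "1 * norm u \<le> norm (jsh a0 b0 z u)" for u
          using order_trans[OF mult_right_mono[of 1 "cmod z - K0" "norm u"] K0(2)[of z u]] K that by simp
        from green_bound[OF jp0 _ this] show ?thesis by simp
      qed
      have "AE x in lebesgue. x \<in> E \<longrightarrow>
        ((\<lambda>y. Re (l2_inner (delta n)
                 (l2_resolvent (jacobi_operator a0 b0) (of_real x + \<i> * of_real y) (delta n))))
          \<longlongrightarrow> 0) (at_right 0)"
        using refl by (simp add: reflectionless_on_def)
      then show "AE x in lebesgue. x \<in> E \<longrightarrow>
        ((\<lambda>y. Re (green a0 b0 n (of_real x + \<i> * of_real y))) \<longlongrightarrow> 0) (at_right 0)"
      proof (eventually_elim, intro impI)
        fix x assume lim: "x \<in> E \<longrightarrow> ((\<lambda>y. Re (l2_inner (delta n)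
                 (l2_resolvent (jacobi_operator a0 b0) (of_real x + \<i> * of_real y) (delta n))))
          \<longlongrightarrow> 0) (at_right 0)" and "x \<in> E"
        have eq: "\<forall>\<^sub>F y in at_right 0. Re (l2_inner (delta n)
                 (l2_resolvent (jacobi_operator a0 b0) (of_real x + \<i> * of_real y) (delta n)))
            = Re (green a0 b0 n (of_real x + \<i> * of_real y))"
          using eventually_at_right_less[of "0::real"]
        proof eventually_elim
          case (elim y)
          then have "regular_value a0 b0 (of_real x + \<i> * of_real y)"
            by (intro regular_value_nonreal[OF jp0]) simp
          then show ?case by (simp add: l2_inner_resolvent[OF jp0])
        qed
        show "((\<lambda>y. Re (green a0 b0 n (of_real x + \<i> * of_real y))) \<longlongrightarrow> 0) (at_right 0)"
          by (rule Lim_transform_eventually[OF mp[OF lim \<open>x \<in> E\<close>] eq])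
      qed
    qed
    then show ?thesis by (simp add: M_def)
  qed
  obtain c where c: "c > 0"
    "\<And>x s. 0 < s \<Longrightarrow> s \<le> 1 \<Longrightarrow> (\<And>v. v \<in> V \<Longrightarrow> s \<le> \<bar>x - v\<bar>) \<Longrightarrow> c * sqrt s \<le> cmod (S (of_real x))"
    using norm_S_lower by metis
  have green_le: "\<bar>Re (green a0 b0 n (of_real x))\<bar> \<le> M / (c * sqrt s)"
    if x: "x \<notin> E" "\<bar>x\<bar> \<le> K" and s: "0 < s" "s \<le> 1" "\<And>v. v \<in> V \<Longrightarrow> s \<le> \<bar>x - v\<bar>" for n x s
  proof -
    have "cmod (green a0 b0 n (of_real x)) * (c * sqrt s) \<le> M"
      using order_trans[OF mult_left_mono[OF c(2)[OF s]] green_S[OF x]] by simp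
    then have "cmod (green a0 b0 n (of_real x)) \<le> M / (c * sqrt s)"
      using c(1) s(1) by (simp add: pos_le_divide_eq)
    then show ?thesis using abs_Re_le_cmod order_trans by blast
  qed
  \<comment> \<open>A quarter of the shortest gap, capped at 1: removing \<delta> at both ends
    leaves length at least 2\<delta>.\<close>
  define \<delta> where "\<delta> = Min (insert 1 ((\<lambda>(p, q). (q - p) / 4) ` gaps K))"
  have \<delta>: "\<delta> > 0" "\<delta> \<le> 1" unfolding \<delta>_def using finite_gaps by (auto simp: gaps_def)
  have \<delta>gap: "4 * \<delta> \<le> q - p" if "(p, q) \<in> gaps K" for p q
  proof -
    have "\<delta> \<le> (q - p) / 4"
      unfolding \<delta>_def using finite_gaps that by (intro Min_le) (auto intro: rev_image_eqI)
    then show ?thesis by simp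
  qed
  \<comment> \<open>Distances \<open>s\<close> range up to 2K, and this scaling keeps \<theta>s
    \<le> \<delta>, so the trimmed gap never degenerates. The price is a constant factor 1/sqrt
    \<theta>.\<close>
  define \<theta> where "\<theta> = \<delta> / (2 * K)"
  have \<theta>: "0 < \<theta>" "\<theta> \<le> 1" using \<delta> K by (auto simp: \<theta>_def)
  obtain C1 where C1: "\<And>n. \<bar>a n\<bar> \<le> C1" "\<And>n. \<bar>b n\<bar> \<le> C1"
    using jacobi_parametersD[OF jp] by metis
  obtain C2 where C2: "\<And>n. \<bar>a0 n\<bar> \<le> C2" "\<And>n. \<bar>b0 n\<bar> \<le> C2"
    using jacobi_parametersD[OF jp0] by metis
  define C where "C = max K (max C1 C2)"
  have C: "K \<le> C" "C1 \<le> C" "C2 \<le> C" by (auto simp: C_def)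
  define D where "D = (\<Sum>\<^sub>\<infinity>n. \<bar>a n - a0 n\<bar> + \<bar>b n - b0 n\<bar>)"
  have D: "D \<ge> 0" unfolding D_def by (intro infsum_nonneg) auto
  define B where "B = 288 * C * D * (M / (c * \<delta>))"
  have B: "B \<ge> 0" using C K D M c(1) \<delta> by (simp add: B_def)
  have gap_count: "real (card L) \<le> B / sqrt (\<theta> * s)"
    if pq: "(p, q) \<in> gaps K" and s: "0 < s" "s \<le> 2 * K"
      and L: "finite L" "L \<subseteq> {p + \<theta> * s..q - \<theta> * s}" "of_real ` L \<subseteq> l2_spectrum (jacobi_operator a b)"
    for p q s and L :: "real set"
  proof -
    define s' where "s' = \<theta> * s"
    have s': "0 < s'" "s' \<le> \<delta>"
      using s \<theta> \<delta> K by (auto simp: s'_def \<theta>_def field_simps)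
    have gap: "p < q" "\<And>y. p < y \<Longrightarrow> y < q \<Longrightarrow> y \<notin> E" using pq by (auto simp: gaps_def)
    have "p = -K \<or> p \<in> E" "q = K \<or> q \<in> E"
      using pq V_subset_E by (auto simp: gaps_def V_def)
    then have pqK: "-K \<le> p" "q \<le> K"
      using subsetD[OF bound_E, of p] subsetD[OF bound_E, of q] by auto
    define x1 where "x1 = p + s'"
    define x2 where "x2 = q - s'"
    have x12: "p < x1" "x2 < q" "2 * \<delta> \<le> x2 - x1"
      using s' \<delta>gap[OF pq] by (auto simp: x1_def x2_def)
    have le: "x1 < x2" using x12 \<delta> by linarith
    have abs: "\<bar>x1\<bar> \<le> K" "\<bar>x2\<bar> \<le> K" using x12 le pqK by auto
    have Vout: "v \<le> p \<or> q \<le> v" if "v \<in> V" for v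
      using gap(2)[of v] V_subset_E that by force
    have sep: "s' \<le> \<bar>x1 - v\<bar>" "s' \<le> \<bar>x2 - v\<bar>" if "v \<in> V" for v
      using Vout[OF that] s' x12 le by (auto simp: x1_def x2_def abs_le_iff)
    have s1: "s' \<le> 1" using s' \<delta> by linarith
    \<comment> \<open>Twice the bound for the Green function at distance \<open>s'\<close> from the
      edges, divided by the minimal length 2\<delta> of the interval.\<close>
    define g where "g = M / (c * \<delta>) / sqrt s'"
    have g: "Re (green a0 b0 n (of_real x2)) - Re (green a0 b0 n (of_real x1)) \<le> g * (x2 - x1)" for n
    proof -
      have "Re (green a0 b0 n (of_real x2)) - Re (green a0 b0 n (of_real x1)) \<le> 2 * (M / (c * sqrt s'))"
        using green_le[of x1 s' n] green_le[of x2 s' n] sep gap(2) x12 le abs s'(1) s1 by fastforce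
      also have "\<dots> = g * (2 * \<delta>)" using \<delta> by (simp add: g_def)
      also have "\<dots> \<le> g * (x2 - x1)"
        using x12(3) M c(1) \<delta> s'(1) by (intro mult_left_mono) (auto simp: g_def)
      finally show ?thesis .
    qed
    have "real (card L) \<le> 288 * C * (\<Sum>\<^sub>\<infinity>n. \<bar>a n - a0 n\<bar> + \<bar>b n - b0 n\<bar>) * g"
    proof (rule card_spectrum_in_gap[OF jp0 jp assms(6) _ _ _ _ le _ _ _ L(1) _ L(3) g])
      show "\<bar>a n\<bar> \<le> C" "\<bar>b n\<bar> \<le> C" "\<bar>a0 n\<bar> \<le> C" "\<bar>b0 n\<bar> \<le> C" for n
        using C1[of n] C2[of n] C by linarith+
      show "\<bar>x1\<bar> \<le> C" "\<bar>x2\<bar> \<le> C" using abs C by linarith+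
      show "regular_value a0 b0 (of_real x)" if "x1 \<le> x" "x \<le> x2" for x
        using gap(2)[of x] that x12 reg0[of "of_real x"] by auto
      show "L \<subseteq> {x1..x2}" using L(2) by (simp add: x1_def x2_def s'_def)
    qed
    then show ?thesis by (simp add: B_def D_def g_def s'_def mult.assoc)
  qed
  define t where "t z = infdist z (complex_of_real ` E)" for z
  define C0 where "C0 = real (card (gaps K)) * (B / sqrt \<theta>)"
  have C0: "C0 \<ge> 0" using B \<theta> by (simp add: C0_def)
  define \<Sigma> where "\<Sigma> = l2_spectrum (jacobi_operator a b) - complex_of_real ` E"
  have "1 \<in> I" by (simp add: I_def)
  then have E0: "lo 1 \<in> E" using V_subset_E by (auto simp: V_def)
  have tpos: "0 < t z" if "z \<in> \<Sigma>" for z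
    unfolding t_def using that E0 by (intro infdist_pos_not_in_closed closed_E_image) (auto simp: \<Sigma>_def)
  have real_spec: "z = of_real (Re z) \<and> \<bar>Re z\<bar> \<le> K1 \<and> Re z \<notin> E" if "z \<in> \<Sigma>" for z
  proof -
    have "z = of_real (Re z)"
      using spectrum_real[OF jp, of z] that by (simp add: \<Sigma>_def complex_eq_iff)
    moreover have "\<bar>Re z\<bar> \<le> K1"
      using bound_spec[of z] that abs_Re_le_cmod[of z] by (auto simp: \<Sigma>_def)
    moreover have "Re z \<notin> E" using that \<open>z = of_real (Re z)\<close> unfolding \<Sigma>_def by (metis DiffD2 imageI)
    ultimately show ?thesis by blast
  qed
  have tle: "t z \<le> \<bar>Re z - e\<bar>" if z: "z \<in> \<Sigma>" and e: "e \<in> E" for z e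
  proof -
    have "t z \<le> dist z (of_real e)" unfolding t_def using e by (intro infdist_le) auto
    also have "\<dots> = \<bar>Re z - e\<bar>"
      using real_spec[OF z] by (metis dist_norm norm_of_real of_real_diff)
    finally show ?thesis .
  qed
  \<comment> \<open>A point at distance at least \<open>s\<close> from \<open>E\<close> is at least
    \<theta>s away from both ends of its gap, so \<open>gap_count\<close> applies in each of the
    finitely many gaps; \<open>C0\<close> does not depend on \<open>F\<close>.\<close>
  have count: "real (card {w \<in> F. t z \<le> t w}) \<le> C0 / sqrt (t z)"
    if F: "finite F" "F \<subseteq> \<Sigma>" and z: "z \<in> F" for F z
  proof -
    define s where "s = t z"
    define W where "W = {w \<in> F. s \<le> t w}"
    have zS: "z \<in> \<Sigma>" using F z by auto
    have s: "0 < s" "s \<le> 2 * K"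
    proof -
      show "0 < s" unfolding s_def by (rule tpos[OF zS])
      have "s \<le> \<bar>Re z - lo 1\<bar>" unfolding s_def by (rule tle[OF zS E0])
      also have "\<dots> \<le> 2 * K"
        using real_spec[OF zS] K(3) subsetD[OF bound_E E0] unfolding greaterThanLessThan_iff by linarith
      finally show "s \<le> 2 * K" .
    qed
    have \<theta>s: "\<theta> * s \<le> s" using \<theta> s by simp
    have \<theta>s1: "\<theta> * s \<le> 1"
    proof -
      have "\<theta> * s \<le> \<theta> * (2 * K)" using s \<theta> by (intro mult_left_mono) auto
      also have "\<dots> = \<delta>" using K by (simp add: \<theta>_def)
      finally show ?thesis using \<delta> by linarith
    qed
    define L where "L g = {x \<in> Re ` W. fst g + \<theta> * s \<le> x \<and> x \<le> snd g - \<theta> * s}" for g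
    have finW: "finite W" using F by (simp add: W_def)
    have cover: "W \<subseteq> (\<Union>g\<in>gaps K. of_real ` L g)"
    proof
      fix w assume w: "w \<in> W"
      then have wS: "w \<in> \<Sigma>" and ws: "s \<le> t w" using F by (auto simp: W_def)
      note rw = real_spec[OF wS]
      obtain p q where pq: "(p, q) \<in> gaps K" "p < Re w" "Re w < q"
        using gap_containing[of "Re w" K] rw K by auto
      have "p + \<theta> * s \<le> Re w"
      \<comment> \<open>The cut-off end is not a band edge, so \<open>tle\<close> gives nothing
        there; instead Re w is at least 1 away from it, and \<theta>s \<le> 1.\<close>
      proof (cases "p = -K")
        case True
        then show ?thesis using rw K \<theta>s1 by auto
      next
        case False
        then have "p \<in> E" using pq(1) V_subset_E by (auto simp: gaps_def V_def)
        then show ?thesis using tle[OF wS, of p] ws \<theta>s pq(2) by simp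
      qed
      moreover have "Re w \<le> q - \<theta> * s"
      proof (cases "q = K")
        case True
        then show ?thesis using rw K \<theta>s1 by auto
      next
        case False
        then have "q \<in> E" using pq(1) V_subset_E by (auto simp: gaps_def V_def)
        then show ?thesis using tle[OF wS, of q] ws \<theta>s pq(3) by simp
      qed
      ultimately have "Re w \<in> L (p, q)" using w by (simp add: L_def)
      then have "w \<in> of_real ` L (p, q)" using rw by (metis imageI)
      then show "w \<in> (\<Union>g\<in>gaps K. of_real ` L g)" using pq(1) by blast
    qed
    have finL: "finite (L g)" for g unfolding L_def using finW by simp
    have "card W \<le> card (\<Union>g\<in>gaps K. complex_of_real ` L g)"
      by (rule card_mono[OF _ cover]) (use finite_gaps finL in auto)
    also have "\<dots> \<le> (\<Sum>g\<in>gaps K. card (complex_of_real ` L g))"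
      by (rule card_UN_le[OF finite_gaps])
    also have "\<dots> \<le> (\<Sum>g\<in>gaps K. card (L g))" by (intro sum_mono card_image_le finL)
    finally have "real (card W) \<le> (\<Sum>g\<in>gaps K. real (card (L g)))"
      by (metis of_nat_le_iff of_nat_sum)
    also have "\<dots> \<le> (\<Sum>g\<in>gaps K. B / sqrt (\<theta> * s))"
    proof (rule sum_mono)
      fix g assume g: "g \<in> gaps K"
      have spec: "of_real ` L g \<subseteq> l2_spectrum (jacobi_operator a b)"
      proof
        fix y assume "y \<in> complex_of_real ` L g"
        then obtain w where w: "w \<in> W" "y = of_real (Re w)" by (auto simp: L_def)
        then have "w \<in> \<Sigma>" using F by (auto simp: W_def)
        then show "y \<in> l2_spectrum (jacobi_operator a b)"
          using real_spec[of w] w(2) by (metis DiffD1 \<Sigma>_def)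
      qed
      have "L g \<subseteq> {fst g + \<theta> * s..snd g - \<theta> * s}" by (auto simp: L_def)
      then show "real (card (L g)) \<le> B / sqrt (\<theta> * s)"
        using gap_count[of "fst g" "snd g" s "L g"] g s finL spec by simp
    qed
    also have "\<dots> = C0 / sqrt s" by (simp add: C0_def real_sqrt_mult)
    finally show ?thesis by (simp add: W_def s_def)
  qed
  have "(\<lambda>z. t z powr \<alpha>) summable_on \<Sigma>"
  proof (rule nonneg_bdd_above_summable_on)
    show "bdd_above (sum (\<lambda>z. t z powr \<alpha>) ` {F. F \<subseteq> \<Sigma> \<and> finite F})"
    proof (rule bdd_aboveI2)
      fix F assume F: "F \<in> {F. F \<subseteq> \<Sigma> \<and> finite F}"
      show "(\<Sum>z\<in>F. t z powr \<alpha>) \<le> C0 powr (2 * \<alpha>) * (\<Sum>j. real j powr (- 2 * \<alpha>))"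
        using F tpos count assms(7) C0 by (intro sum_powr_bounded) auto
    qed
  qed simp
  then show ?thesis by (simp add: t_def \<Sigma>_def)
qed

end
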